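(* Let $n\geq 1$ and for $1\le i<j\le n+1$ let $$E_{ji}:=[E_{j-1},[E_{j-2},[\cdots[E_{i+1},E_i]_{q^{-1}}\cdots]_{q^{-1}}]_{q^{-1}}\in U_q(\mathfrak{sl}_{n+1}),\qquad E_{i+1,i}:=E_i .$$ (Up to sign, these are Lusztig's positive root vectors for the reduced decomposition $w_0=(s_ns_{n-1}\cdots s_1)(s_ns_{n-1}\cdots s_2)\cdots(s_ns_{n-1})s_n$ of the longest element of $S_{n+1}$.) Then the subspace $$T^{(0,1)}:=\mathrm{span}_{\mathbb C}\{E_{ji}\mid 1\le i<j\le n+1\}$$ is a tangent space for the Hopf algebra $\mathcal O_q(\mathrm{SU}_{n+1})$.
   Context: All algebras are over $\mathbb C$. Fix $q\in\mathbb R$, $q\ne -1,0,1$. For an algebra and $c\in\mathbb C$, $[a,b]_c:=ab-c\,ba$. $U_q(\mathfrak{sl}_{n+1})$ is the algebra generated by $E_i,F_i,K_i^{\pm1}$, $i=1,\dots,n$, with $K_iK_j=K_jK_i$, $K_iK_i^{-1}=K_i^{-1}K_i=1$, $K_iE_j=q^{a_{ij}}E_jK_i$, $K_iF_j=q^{-a_{ij}}F_jK_i$, $E_iF_j-F_jE_i=\delta_{ij}\frac{K_i-K_i^{-1}}{q-q^{-1}}$, where $(a_{ij})$ is the Cartan matrix of type $A_n$, and the quantum Serre relations $E_i^2E_j-(q+q^{-1})E_iE_jE_i+E_jE_i^2=0$ for $|i-j|=1$, $E_iE_j=E_jE_i$ for $|i-j|>1$, and the same for the $F_i$. Its Hopf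 structure is determined by $\Delta(K_i)=K_i\otimes K_i$, $\Delta(E_i)=E_i\otimes K_i+1\otimes E_i$, $\Delta(F_i)=F_i\otimes1+K_i^{-1}\otimes F_i$, $\varepsilon(E_i)=\varepsilon(F_i)=0$, $\varepsilon(K_i)=1$. $\mathcal O_q(\mathrm{SU}_{n+1})$ is the Hopf subalgebra of the Hopf dual $U_q(\mathfrak{sl}_{n+1})^\circ$ spanned by the matrix coefficients $X\mapsto f(Xv)$ of the finite-dimensional type-1 representations; evaluation gives a pairing $\langle-,-\rangle:U_q(\mathfrak{sl}_{n+1})\times\mathcal O_q(\mathrm{SU}_{n+1})\to\mathbb C$, through which elements of $U_q(\mathfrak{sl}_{n+1})$ are regarded as elements of the dual Hopf algebra $\mathcal O_q(\mathrm{SU}_{n+1})^\circ$. A tangent space for a Hopf algebra $A$ is a linear subspace $T\subseteq A^\circ$ of the dual Hopf algebra such that $X(1)=0$ for all $X\in T$ and $T\oplus\mathbb C1$ is a right coideal of $A^\circ$, i.e. $\Delta(T\oplus\mathbb C1)\subseteq(T\oplus\mathbb C1)\otimes A^\circ$. *)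

theory Defs
  imports
    Complex_Main
    "HOL-Library.Poly_Mapping"
    "HOL-Library.Function_Algebras"
    "HOL-Algebra.QuotRing"
    "Jordan_Normal_Form.Matrix"
begin

section \<open>Complex algebras, linear forms and tensor products\<close>

text \<open>
  A complex algebra is a record of type \<open>(complex, 'a) module\<close>; the locale \<open>algebra\<close> of
  HOL-Algebra is restricted to commutative multiplications and is not used. Spaces of
  functionals are subspaces of a full function type \<open>'x \<Rightarrow> complex\<close>.
\<close>

definition fscale :: "complex \<Rightarrow> ('x \<Rightarrow> complex) \<Rightarrow> 'x \<Rightarrow> complex" where
  "fscale c f = (\<lambda>x. c * f x)"

lemma vector_space_fscale: "vector_space fscale"
  by unfold_locales (auto simp: fscale_def fun_eq_iff algebra_simps)

abbreviation fspan :: "('x \<Rightarrow> complex) set \<Rightarrow> ('x \<Rightarrow> complex) set" where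
  "fspan \<equiv> module.span fscale"

abbreviation fsubspace :: "('x \<Rightarrow> complex) set \<Rightarrow> bool" where
  "fsubspace \<equiv> module.subspace fscale"

definition linear_form :: "(complex, 'a, 'm) module_scheme \<Rightarrow> ('a \<Rightarrow> complex) \<Rightarrow> bool" where
  "linear_form V f \<longleftrightarrow>
     (\<forall>x\<in>carrier V. \<forall>y\<in>carrier V. f (x \<oplus>\<^bsub>V\<^esub> y) = f x + f y) \<and>
     (\<forall>c. \<forall>x\<in>carrier V. f (c \<odot>\<^bsub>V\<^esub> x) = c * f x)"

definition restrict0 :: "(complex, 'a, 'm) module_scheme \<Rightarrow> ('a \<Rightarrow> complex) \<Rightarrow> 'a \<Rightarrow> complex" where
  "restrict0 V f = (\<lambda>x. if x \<in> carrier V then f x else 0)"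

text \<open>
  Elements of the linear dual vanish outside the carrier, so that equality of functions is
  equality of functionals and the vector space operations are pointwise.
\<close>

definition linear_dual :: "(complex, 'a, 'm) module_scheme \<Rightarrow> ('a \<Rightarrow> complex) set" where
  "linear_dual V = {f. linear_form V f \<and> (\<forall>x. x \<notin> carrier V \<longrightarrow> f x = 0)}"

definition bilinear_form :: "(complex, 'a, 'm) module_scheme \<Rightarrow> ('a \<Rightarrow> 'a \<Rightarrow> complex) \<Rightarrow> bool" where
  "bilinear_form V \<beta> \<longleftrightarrow>
     (\<forall>x\<in>carrier V. linear_form V (\<lambda>y. \<beta> x y)) \<and>
     (\<forall>y\<in>carrier V. linear_form V (\<lambda>x. \<beta> x y))"

text \<open>
  The algebraic tensor product \<open>V \<otimes> V\<close> over the field of complex numbers embeds into the dual of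
  the space of bilinear forms on \<open>V\<close>, the pure tensor \<open>x \<otimes> y\<close> being evaluation at \<open>(x, y)\<close>
  (two elements of \<open>V \<otimes> V\<close> on which all bilinear forms agree are equal). It is realised as the
  span of these evaluations. For a tensor \<open>t = (\<Sum>i. x\<^sub>i \<otimes> y\<^sub>i)\<close> and a bilinear form \<open>\<beta>\<close>, the number
  \<open>t \<beta>\<close> is \<open>(\<Sum>i. \<beta> x\<^sub>i y\<^sub>i)\<close>; in particular \<open>t (\<lambda>a b. f a * g b)\<close> is \<open>(f \<otimes> g)(t)\<close>.
\<close>

type_synonym 'a tensor = "('a \<Rightarrow> 'a \<Rightarrow> complex) \<Rightarrow> complex"

definition pure_tensor :: "(complex, 'a, 'm) module_scheme \<Rightarrow> 'a \<Rightarrow> 'a \<Rightarrow> 'a tensor" where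
  "pure_tensor V x y = (\<lambda>\<beta>. if bilinear_form V \<beta> then \<beta> x y else 0)"

text \<open>For subspaces \<open>S\<close> and \<open>R\<close> of \<open>V\<close>, the subspace \<open>S \<otimes> R\<close> of \<open>V \<otimes> V\<close>.\<close>

definition tensor_space ::
    "(complex, 'a, 'm) module_scheme \<Rightarrow> 'a set \<Rightarrow> 'a set \<Rightarrow> 'a tensor set" where
  "tensor_space V S R = fspan {pure_tensor V x y | x y. x \<in> S \<and> y \<in> R}"

text \<open>
  The multiplication below is the bilinear extension of
  \<open>(x \<otimes> y)(x' \<otimes> y') = x x' \<otimes> y y'\<close>, evaluated on a bilinear form.
\<close>

definition tensor_alg :: "(complex, 'a, 'm) module_scheme \<Rightarrow> (complex, 'a tensor) module" where
  "tensor_alg A = \<lparr>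
     carrier = tensor_space A (carrier A) (carrier A),
     monoid.mult = (\<lambda>s t \<beta>. if bilinear_form A \<beta>
        then s (\<lambda>x y. t (\<lambda>x' y'. \<beta> (x \<otimes>\<^bsub>A\<^esub> x') (y \<otimes>\<^bsub>A\<^esub> y'))) else 0),
     one = pure_tensor A \<one>\<^bsub>A\<^esub> \<one>\<^bsub>A\<^esub>,
     zero = 0, add = (+), smult = fscale\<rparr>"

definition complex_alg :: "(complex, complex) module" where
  "complex_alg = \<lparr>carrier = UNIV, monoid.mult = (*), one = 1, zero = 0, add = (+), smult = (*)\<rparr>"

definition quotient_alg :: "(complex, 'a) module \<Rightarrow> 'a set \<Rightarrow> (complex, 'a set) module" where
  "quotient_alg A I = ring.extend (A Quot I)
     (module.fields (\<lambda>c X. \<Union>x\<in>X. I +>\<^bsub>A\<^esub> (c \<odot>\<^bsub>A\<^esub> x)))"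

definition qcomm :: "(complex, 'a, 'm) module_scheme \<Rightarrow> complex \<Rightarrow> 'a \<Rightarrow> 'a \<Rightarrow> 'a" where
  "qcomm A c a b = (a \<otimes>\<^bsub>A\<^esub> b) \<ominus>\<^bsub>A\<^esub> (c \<odot>\<^bsub>A\<^esub> (b \<otimes>\<^bsub>A\<^esub> a))"


section \<open>Hopf algebras and their duals\<close>

text \<open>
  Of the Hopf structure only the bialgebra part is recorded: an antipode is determined by it
  and does not enter any of the notions below.
\<close>

record 'a bialg = "(complex, 'a) module" +
  comult :: "'a \<Rightarrow> 'a tensor"
  counit :: "'a \<Rightarrow> complex"

text \<open>The dual of the coalgebra \<open>H\<close> is an algebra under convolution, with unit the counit of \<open>H\<close>.\<close>

definition convolution ::
    "('a, 'm) bialg_scheme \<Rightarrow> ('a \<Rightarrow> complex) \<Rightarrow> ('a \<Rightarrow> complex) \<Rightarrow> 'a \<Rightarrow> complex" where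
  "convolution H f g = restrict0 H (\<lambda>x. comult H x (\<lambda>a b. f a * g b))"

definition convolution_alg ::
    "('a, 'm) bialg_scheme \<Rightarrow> ('a \<Rightarrow> complex) set \<Rightarrow> (complex, 'a \<Rightarrow> complex) module" where
  "convolution_alg H C = \<lparr>carrier = C, monoid.mult = convolution H, one = restrict0 H (counit H),
     zero = 0, add = (+), smult = fscale\<rparr>"

text \<open>
  \<open>is_dual_coproduct H C f t\<close>: the tensor \<open>t\<close> in \<open>C \<otimes> C\<close> is the coproduct of the functional \<open>f\<close>,
  that is, \<open>(\<Sum>i. g\<^sub>i(a) h\<^sub>i(b)) = f(ab)\<close> for \<open>t = (\<Sum>i. g\<^sub>i \<otimes> h\<^sub>i)\<close>. Such a \<open>t\<close> is unique, since
  functionals are separated by their values.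
\<close>

definition is_dual_coproduct ::
    "('a, 'm) bialg_scheme \<Rightarrow> ('a \<Rightarrow> complex) set \<Rightarrow> ('a \<Rightarrow> complex) \<Rightarrow> ('a \<Rightarrow> complex) tensor \<Rightarrow> bool"
where
  "is_dual_coproduct H C f t \<longleftrightarrow>
     t \<in> tensor_space (convolution_alg H C) C C \<and>
     (\<forall>a\<in>carrier H. \<forall>b\<in>carrier H. t (\<lambda>g h. g a * h b) = f (a \<otimes>\<^bsub>H\<^esub> b))"

text \<open>
  The finite dual \<open>H\<^sup>\<circ>\<close> consists of the functionals \<open>f\<close> for which \<open>(a, b) \<mapsto> f(ab)\<close> lies in
  \<open>H* \<otimes> H*\<close>.
\<close>

definition finite_dual :: "('a, 'm) bialg_scheme \<Rightarrow> ('a \<Rightarrow> complex) set" where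
  "finite_dual H = {f \<in> linear_dual H. \<exists>t. is_dual_coproduct H (linear_dual H) f t}"

text \<open>The structure that the dual of \<open>H\<close> induces on a space \<open>C\<close> of functionals.\<close>

definition dual_bialg ::
    "('a, 'm) bialg_scheme \<Rightarrow> ('a \<Rightarrow> complex) set \<Rightarrow> ('a \<Rightarrow> complex) bialg" where
  "dual_bialg H C = module.extend (convolution_alg H C)
     (bialg.fields (\<lambda>f. THE t. is_dual_coproduct H C f t) (\<lambda>f. f \<one>\<^bsub>H\<^esub>))"

definition hopf_dual :: "('a, 'm) bialg_scheme \<Rightarrow> ('a \<Rightarrow> complex) bialg" where
  "hopf_dual H = dual_bialg H (finite_dual H)"

definition plus_unit :: "(complex, 'x \<Rightarrow> complex, 'm) module_scheme \<Rightarrow> ('x \<Rightarrow> complex) set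
    \<Rightarrow> ('x \<Rightarrow> complex) set" where
  "plus_unit B T = {t + fscale c \<one>\<^bsub>B\<^esub> | t c. t \<in> T}"

text \<open>
  The sum of \<open>T\<close> and the line through the unit is automatically direct, because the unit of
  \<open>A\<^sup>\<circ>\<close> takes the value 1 at the unit of \<open>A\<close> whereas all elements of \<open>T\<close> vanish there.
\<close>

definition tangent_space :: "('a, 'm) bialg_scheme \<Rightarrow> ('a \<Rightarrow> complex) set \<Rightarrow> bool" where
  "tangent_space A T \<longleftrightarrow>
     fsubspace T \<and> T \<subseteq> carrier (hopf_dual A) \<and>
     (\<forall>X\<in>T. X \<one>\<^bsub>A\<^esub> = 0) \<and>
     (\<forall>X\<in>plus_unit (hopf_dual A) T.
        comult (hopf_dual A) X
          \<in> tensor_space (hopf_dual A) (plus_unit (hopf_dual A) T) (carrier (hopf_dual A)))"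


section \<open>The quantised enveloping algebra of type A\<close>

text \<open>\<open>gKi i\<close> stands for the inverse of \<open>K\<^sub>i\<close>.\<close>

datatype gen = gE nat | gF nat | gK nat | gKi nat

text \<open>Words form a monoid under concatenation, so \<open>word \<Rightarrow>\<^sub>0 complex\<close> is the free algebra on \<open>gen\<close>.\<close>

datatype word = Word (letters: "gen list")

instantiation word :: monoid_add
begin
definition "0 = Word []"
definition "v + w = Word (letters v @ letters w)"
instance
  by standard (auto simp: zero_word_def plus_word_def)
end

type_synonym falg = "word \<Rightarrow>\<^sub>0 complex"

definition var :: "gen \<Rightarrow> falg" where
  "var x = Poly_Mapping.single (Word [x]) 1"

definition const :: "complex \<Rightarrow> falg" where
  "const c = Poly_Mapping.single 0 c"

definition gens :: "nat \<Rightarrow> gen set" where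
  "gens n = gE ` {1..n} \<union> gF ` {1..n} \<union> gK ` {1..n} \<union> gKi ` {1..n}"

definition free_alg :: "nat \<Rightarrow> (complex, falg) module" where
  "free_alg n = \<lparr>carrier = {p. \<forall>w\<in>Poly_Mapping.keys p. set (letters w) \<subseteq> gens n},
     monoid.mult = (*), one = 1, zero = 0, add = (+), smult = (\<lambda>c p. const c * p)\<rparr>"

definition cartan :: "nat \<Rightarrow> nat \<Rightarrow> int" where
  "cartan i j = (if i = j then 2 else if i = j + 1 \<or> j = i + 1 then - 1 else 0)"

text \<open>The relation \<open>l = r\<close> is encoded by the element \<open>l - r\<close> of the free algebra.\<close>

inductive_set uq_rels :: "nat \<Rightarrow> real \<Rightarrow> falg set" for n :: nat and q :: real where
  KK: "i \<in> {1..n} \<Longrightarrow> j \<in> {1..n} \<Longrightarrow>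
    var (gK i) * var (gK j) - var (gK j) * var (gK i) \<in> uq_rels n q"
| KKi: "i \<in> {1..n} \<Longrightarrow> var (gK i) * var (gKi i) - 1 \<in> uq_rels n q"
| KiK: "i \<in> {1..n} \<Longrightarrow> var (gKi i) * var (gK i) - 1 \<in> uq_rels n q"
| KE: "i \<in> {1..n} \<Longrightarrow> j \<in> {1..n} \<Longrightarrow>
    var (gK i) * var (gE j)
      - const (complex_of_real (q powi cartan i j)) * var (gE j) * var (gK i) \<in> uq_rels n q"
| KF: "i \<in> {1..n} \<Longrightarrow> j \<in> {1..n} \<Longrightarrow>
    var (gK i) * var (gF j)
      - const (complex_of_real (q powi (- cartan i j))) * var (gF j) * var (gK i) \<in> uq_rels n q"
| EF: "i \<in> {1..n} \<Longrightarrow> j \<in> {1..n} \<Longrightarrow>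
    var (gE i) * var (gF j) - var (gF j) * var (gE i)
      - (if i = j then const (complex_of_real (1 / (q - inverse q))) * (var (gK i) - var (gKi i))
         else 0) \<in> uq_rels n q"
| serreE: "i \<in> {1..n} \<Longrightarrow> j \<in> {1..n} \<Longrightarrow> i = j + 1 \<or> j = i + 1 \<Longrightarrow>
    var (gE i) * var (gE i) * var (gE j)
      - const (complex_of_real (q + inverse q)) * var (gE i) * var (gE j) * var (gE i)
      + var (gE j) * var (gE i) * var (gE i) \<in> uq_rels n q"
| serreF: "i \<in> {1..n} \<Longrightarrow> j \<in> {1..n} \<Longrightarrow> i = j + 1 \<or> j = i + 1 \<Longrightarrow>
    var (gF i) * var (gF i) * var (gF j)
      - const (complex_of_real (q + inverse q)) * var (gF i) * var (gF j) * var (gF i)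
      + var (gF j) * var (gF i) * var (gF i) \<in> uq_rels n q"
| commE: "i \<in> {1..n} \<Longrightarrow> j \<in> {1..n} \<Longrightarrow> i > j + 1 \<or> j > i + 1 \<Longrightarrow>
    var (gE i) * var (gE j) - var (gE j) * var (gE i) \<in> uq_rels n q"
| commF: "i \<in> {1..n} \<Longrightarrow> j \<in> {1..n} \<Longrightarrow> i > j + 1 \<or> j > i + 1 \<Longrightarrow>
    var (gF i) * var (gF j) - var (gF j) * var (gF i) \<in> uq_rels n q"

definition uq_ideal :: "nat \<Rightarrow> real \<Rightarrow> falg set" where
  "uq_ideal n q = genideal (free_alg n) (uq_rels n q)"

definition uq_alg :: "nat \<Rightarrow> real \<Rightarrow> (complex, falg set) module" where
  "uq_alg n q = quotient_alg (free_alg n) (uq_ideal n q)"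

definition uq_gen :: "nat \<Rightarrow> real \<Rightarrow> gen \<Rightarrow> falg set" where
  "uq_gen n q x = uq_ideal n q +>\<^bsub>free_alg n\<^esub> var x"

definition free_lift :: "(complex, 'b, 'm) module_scheme \<Rightarrow> (gen \<Rightarrow> 'b) \<Rightarrow> falg \<Rightarrow> 'b" where
  "free_lift B g p = (\<Oplus>\<^bsub>B\<^esub>w\<in>Poly_Mapping.keys p.
     Poly_Mapping.lookup p w \<odot>\<^bsub>B\<^esub> foldr (\<lambda>x b. g x \<otimes>\<^bsub>B\<^esub> b) (letters w) \<one>\<^bsub>B\<^esub>)"

text \<open>
  The algebra map on the quotient induced by an assignment on generators. It is well defined,
  because the free lift is constant on cosets whenever the assignment respects the relations.
\<close>

definition induced_map :: "(complex, 'b, 'm) module_scheme \<Rightarrow> (gen \<Rightarrow> 'b) \<Rightarrow> falg set \<Rightarrow> 'b" where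
  "induced_map B g X = the_elem (free_lift B g ` X)"

primrec uq_comult_gen :: "nat \<Rightarrow> real \<Rightarrow> gen \<Rightarrow> falg set tensor" where
  "uq_comult_gen n q (gE i) =
     pure_tensor (uq_alg n q) (uq_gen n q (gE i)) (uq_gen n q (gK i)) +
     pure_tensor (uq_alg n q) \<one>\<^bsub>uq_alg n q\<^esub> (uq_gen n q (gE i))"
| "uq_comult_gen n q (gF i) =
     pure_tensor (uq_alg n q) (uq_gen n q (gF i)) \<one>\<^bsub>uq_alg n q\<^esub> +
     pure_tensor (uq_alg n q) (uq_gen n q (gKi i)) (uq_gen n q (gF i))"
| "uq_comult_gen n q (gK i) =
     pure_tensor (uq_alg n q) (uq_gen n q (gK i)) (uq_gen n q (gK i))"
| "uq_comult_gen n q (gKi i) =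
     pure_tensor (uq_alg n q) (uq_gen n q (gKi i)) (uq_gen n q (gKi i))"

primrec uq_counit_gen :: "gen \<Rightarrow> complex" where
  "uq_counit_gen (gE i) = 0"
| "uq_counit_gen (gF i) = 0"
| "uq_counit_gen (gK i) = 1"
| "uq_counit_gen (gKi i) = 1"

text \<open>\<open>uq n q\<close> is \<open>U\<^sub>q(sl\<^sub>n\<^sub>+\<^sub>1)\<close>.\<close>

definition uq :: "nat \<Rightarrow> real \<Rightarrow> falg set bialg" where
  "uq n q = module.extend (uq_alg n q)
     (bialg.fields (induced_map (tensor_alg (uq_alg n q)) (uq_comult_gen n q))
                   (induced_map complex_alg uq_counit_gen))"


section \<open>The quantised coordinate algebra\<close>

definition uq_rep :: "nat \<Rightarrow> real \<Rightarrow> nat \<Rightarrow> (falg set \<Rightarrow> complex mat) \<Rightarrow> bool" where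
  "uq_rep n q d \<rho> \<longleftrightarrow>
     \<rho> \<in> Ring.ring_hom (uq n q) (ring_mat TYPE(complex) d ()) \<and>
     (\<forall>c. \<forall>X\<in>carrier (uq n q). \<rho> (c \<odot>\<^bsub>uq n q\<^esub> X) = c \<cdot>\<^sub>m \<rho> X)"

text \<open>
  Type 1: the representation space has a basis (the columns of \<open>P\<close>) of weight vectors with
  integral weights, on which \<open>K\<^sub>i\<close> acts by an integral power of \<open>q\<close> (without additional sign).
\<close>

definition type1 :: "nat \<Rightarrow> real \<Rightarrow> nat \<Rightarrow> (falg set \<Rightarrow> complex mat) \<Rightarrow> bool" where
  "type1 n q d \<rho> \<longleftrightarrow>
     (\<exists>P\<in>carrier_mat d d. invertible_mat P \<and>
        (\<forall>k<d. \<exists>wt :: nat \<Rightarrow> int. \<forall>i\<in>{1..n}.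
           \<rho> (uq_gen n q (gK i)) *\<^sub>v col P k = complex_of_real (q powi wt i) \<cdot>\<^sub>v col P k))"

text \<open>Functionals on \<open>\<complex>\<^sup>d\<close> are given by the scalar product with a vector \<open>u\<close>.\<close>

definition matrix_coeff ::
    "nat \<Rightarrow> real \<Rightarrow> (falg set \<Rightarrow> complex mat) \<Rightarrow> complex vec \<Rightarrow> complex vec \<Rightarrow> falg set \<Rightarrow> complex" where
  "matrix_coeff n q \<rho> u v = restrict0 (uq n q) (\<lambda>X. u \<bullet> (\<rho> X *\<^sub>v v))"

definition oq_carrier :: "nat \<Rightarrow> real \<Rightarrow> (falg set \<Rightarrow> complex) set" where
  "oq_carrier n q = fspan {matrix_coeff n q \<rho> u v | d \<rho> u v.
     uq_rep n q d \<rho> \<and> type1 n q d \<rho> \<and> u \<in> carrier_vec d \<and> v \<in> carrier_vec d}"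

text \<open>\<open>oq n q\<close> is \<open>O\<^sub>q(SU\<^sub>n\<^sub>+\<^sub>1)\<close>, with the structure inherited from the dual of \<open>uq n q\<close>.\<close>

definition oq :: "nat \<Rightarrow> real \<Rightarrow> (falg set \<Rightarrow> complex) bialg" where
  "oq n q = dual_bialg (uq n q) (oq_carrier n q)"

text \<open>An element of \<open>U\<^sub>q(sl\<^sub>n\<^sub>+\<^sub>1)\<close>, regarded as a functional on \<open>O\<^sub>q(SU\<^sub>n\<^sub>+\<^sub>1)\<close> by evaluation.\<close>

definition as_functional :: "nat \<Rightarrow> real \<Rightarrow> falg set \<Rightarrow> (falg set \<Rightarrow> complex) \<Rightarrow> complex" where
  "as_functional n q X = restrict0 (oq n q) (\<lambda>f. f X)"


section \<open>Root vectors and their span\<close>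

text \<open>
  \<open>root_vec n q j i\<close> is \<open>E\<^sub>j\<^sub>i\<close>, meaningful for \<open>1 \<le> i < j \<le> n + 1\<close>; the recursion reads
  \<open>E\<^sub>j\<^sub>+\<^sub>1\<^sub>,\<^sub>i = [E\<^sub>j, E\<^sub>j\<^sub>i]\<close> with deformation parameter \<open>q\<^sup>-\<^sup>1\<close>.
\<close>

primrec root_vec :: "nat \<Rightarrow> real \<Rightarrow> nat \<Rightarrow> nat \<Rightarrow> falg set" where
  "root_vec n q 0 i = \<zero>\<^bsub>uq n q\<^esub>"
| "root_vec n q (Suc j) i =
     (if j = i then uq_gen n q (gE i)
      else qcomm (uq n q) (complex_of_real (inverse q)) (uq_gen n q (gE j)) (root_vec n q j i))"

definition T01 :: "nat \<Rightarrow> real \<Rightarrow> ((falg set \<Rightarrow> complex) \<Rightarrow> complex) set" where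
  "T01 n q = fspan {as_functional n q (root_vec n q j i) | i j. 1 \<le> i \<and> i < j \<and> j \<le> n + 1}"

end

theory Submission
  imports Defs
begin

text \<open>
  The heart of the matter is the shape of the coproduct of a root vector,
  \<open>\<Delta>(E\<^sub>j\<^sub>i) = E\<^sub>j\<^sub>i \<otimes> \<kappa> + 1 \<otimes> E\<^sub>j\<^sub>i + (\<Sum>i<k<j. E\<^sub>k\<^sub>i \<otimes> y\<^sub>k)\<close>: the first legs are root vectors with the same second
  index, or 1 (lemma \<open>Delta_root_vec\<close>). It is obtained by induction on \<open>j\<close> from
  \<open>E\<^sub>j\<^sub>+\<^sub>1\<^sub>,\<^sub>i = E\<^sub>j E\<^sub>j\<^sub>i - q\<^sup>-\<^sup>1 E\<^sub>j\<^sub>i E\<^sub>j\<close> and \<open>\<Delta>(E\<^sub>j) = E\<^sub>j \<otimes> K\<^sub>j + 1 \<otimes> E\<^sub>j\<close>. For a summand \<open>z \<otimes> y\<close> whose first leg is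
  1 or \<open>E\<^sub>k\<^sub>i\<close> with \<open>k < j\<close>, the element \<open>z\<close> commutes with \<open>E\<^sub>j\<close>, and \<open>y\<close> contains the letter \<open>E\<^sub>j\<^sub>-\<^sub>1\<close> exactly
  once and no letter \<open>E\<^sub>j\<close>, whence \<open>K\<^sub>j y = q\<^sup>-\<^sup>1 y K\<^sub>j\<close>. The deformation parameter of the commutator is chosen
  such that the contribution of \<open>E\<^sub>j \<otimes> K\<^sub>j\<close>, namely \<open>E\<^sub>j z \<otimes> (K\<^sub>j y - q\<^sup>-\<^sup>1 y K\<^sub>j)\<close>, vanishes; what remains is
  \<open>z \<otimes> [E\<^sub>j, y]\<close>, with the same first leg. Only the leading summand \<open>E\<^sub>j\<^sub>i \<otimes> \<kappa>\<close>, in which \<open>\<kappa>\<close> is a product of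
  the \<open>K\<^sub>i\<close>, gives rise to a new first leg, which is \<open>E\<^sub>j\<^sub>+\<^sub>1\<^sub>,\<^sub>i\<close>. Since the counit annihilates the
  generators \<open>E\<^sub>i\<close>, it annihilates the root vectors.

  The rest of the proof gives access to this computation. First, \<open>\<Delta>\<close> and the counit are given on
  generators, so one has to check that they respect the relations of the presentation; only the
  quantum Serre relations are not immediate, and they hold because the two summands of \<open>\<Delta>(E\<^sub>i)\<close>
  commute up to powers of \<open>q\<close> (lemma \<open>quantum_serre_sum\<close>). Second, the product of the coordinate
  algebra is \<open>(f g)(X) = (f \<otimes> g)(\<Delta>(X))\<close>, and the coordinate algebra is closed under it, because
  the product of matrix coefficients of two representations of type 1 is a matrix coefficient of
  their tensor product, which is again of type 1 (lemma \<open>conv_closed\<close>). Hence evaluation at \<open>X\<close> has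
  a coproduct in the finite dual, obtained by evaluating at the legs of \<open>\<Delta>(X)\<close>
  (lemma \<open>as_functional_coproduct\<close>). Third, a tensor of functionals is determined by its values
  (lemma \<open>dual_coproduct_unique\<close>), so the coproduct in the dual bialgebra is this one.
\<close>

section \<open>Complex algebras\<close>

locale complex_algebra = ring A for A :: "(complex, 'a, 'm) module_scheme" (structure) +
  assumes smult_closed [simp, intro]: "x \<in> carrier A \<Longrightarrow> c \<odot> x \<in> carrier A"
    and smult_l_distr: "x \<in> carrier A \<Longrightarrow> (c + d) \<odot> x = c \<odot> x \<oplus> d \<odot> x"
    and smult_r_distr: "x \<in> carrier A \<Longrightarrow> y \<in> carrier A \<Longrightarrow> c \<odot> (x \<oplus> y) = c \<odot> x \<oplus> c \<odot> y"
    and smult_assoc: "x \<in> carrier A \<Longrightarrow> (c * d) \<odot> x = c \<odot> (d \<odot> x)"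
    and smult_one [simp]: "x \<in> carrier A \<Longrightarrow> 1 \<odot> x = x"
    and smult_mult_left: "x \<in> carrier A \<Longrightarrow> y \<in> carrier A \<Longrightarrow> (c \<odot> x) \<otimes> y = c \<odot> (x \<otimes> y)"
    and smult_mult_right: "x \<in> carrier A \<Longrightarrow> y \<in> carrier A \<Longrightarrow> x \<otimes> (c \<odot> y) = c \<odot> (x \<otimes> y)"
begin

lemma smult_zero_left [simp]: "x \<in> carrier A \<Longrightarrow> 0 \<odot> x = \<zero>"
  using smult_l_distr[of x 0 0] by simp

lemma smult_zero_right [simp]: "c \<odot> \<zero> = \<zero>"
  using smult_r_distr[of \<zero> \<zero> c] by simp

lemma smult_minus_one:
  assumes x: "x \<in> carrier A"
  shows "(- 1) \<odot> x = \<ominus> x"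
proof (rule sym, rule minus_equality)
  show "(- 1) \<odot> x \<oplus> x = \<zero>"
    using smult_l_distr[OF x, of "- 1" 1] x by simp
qed (use x in auto)

end

locale algebra_hom =
  dom: complex_algebra A + cod: complex_algebra B
  for A :: "(complex, 'a, 'm) module_scheme" and B :: "(complex, 'b, 'k) module_scheme" +
  fixes h
  assumes ring_hom: "h \<in> Ring.ring_hom A B"
    and hom_smult: "x \<in> carrier A \<Longrightarrow> h (c \<odot>\<^bsub>A\<^esub> x) = c \<odot>\<^bsub>B\<^esub> h x"
begin

lemmas hom_closed = ring_hom_closed[OF ring_hom]
  and hom_mult = ring_hom_mult[OF ring_hom]
  and hom_add = ring_hom_add[OF ring_hom]
  and hom_one = ring_hom_one[OF ring_hom]

lemma hom_zero: "h \<zero>\<^bsub>A\<^esub> = \<zero>\<^bsub>B\<^esub>"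
  by (rule ring_hom_zero[OF ring_hom dom.ring_axioms cod.ring_axioms])

lemma hom_uminus: "x \<in> carrier A \<Longrightarrow> h (\<ominus>\<^bsub>A\<^esub> x) = \<ominus>\<^bsub>B\<^esub> h x"
  by (metis dom.smult_minus_one cod.smult_minus_one hom_smult hom_closed)

lemma hom_minus:
  "x \<in> carrier A \<Longrightarrow> y \<in> carrier A \<Longrightarrow> h (x \<ominus>\<^bsub>A\<^esub> y) = h x \<ominus>\<^bsub>B\<^esub> h y"
  by (simp add: a_minus_def hom_add hom_uminus dom.a_inv_closed)

end

section \<open>The free algebra and its quotients\<close>

lemma free_alg_carrier:
  "p \<in> carrier (free_alg n) \<longleftrightarrow> (\<forall>w\<in>Poly_Mapping.keys p. set (letters w) \<subseteq> gens n)"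
  by (simp add: free_alg_def)

lemma free_alg_simps [simp]:
  "x \<otimes>\<^bsub>free_alg n\<^esub> y = x * y" "x \<oplus>\<^bsub>free_alg n\<^esub> y = x + y"
  "\<one>\<^bsub>free_alg n\<^esub> = 1" "\<zero>\<^bsub>free_alg n\<^esub> = 0" "c \<odot>\<^bsub>free_alg n\<^esub> x = const c * x"
  by (simp_all add: free_alg_def)

lemma const_add: "const (c + d) = const c + const d"
  by (simp add: const_def single_add)

lemma const_mult: "const (c * d) = const c * const d"
  by (simp add: const_def mult_single)

lemma const_0 [simp]: "const 0 = 0" and const_1 [simp]: "const 1 = 1"
  by (simp_all add: const_def)

lemma poly_mapping_sum_single:
  "p = (\<Sum>w\<in>Poly_Mapping.keys p. Poly_Mapping.single w (Poly_Mapping.lookup p w))"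
  by (rule poly_mapping_eqI)
    (simp add: lookup_sum lookup_single when_def in_keys_iff)

lemma const_central: "const c * p = p * const c"
proof -
  have "const c * (\<Sum>w\<in>S. Poly_Mapping.single w (f w)) = (\<Sum>w\<in>S. Poly_Mapping.single w (f w)) * const c"
    for S and f :: "word \<Rightarrow> complex"
    by (simp add: sum_distrib_left sum_distrib_right const_def mult_single mult.commute)
  then show ?thesis
    using poly_mapping_sum_single[of p] by metis
qed

lemma free_alg_induct [consumes 1, case_names zero single add]:
  assumes p: "p \<in> carrier (free_alg n)"
    and zero: "P 0"
    and single: "\<And>w c. set (letters w) \<subseteq> gens n \<Longrightarrow> P (Poly_Mapping.single w c)"
    and add: "\<And>p r. p \<in> carrier (free_alg n) \<Longrightarrow> r \<in> carrier (free_alg n) \<Longrightarrow> P p \<Longrightarrow> P r \<Longrightarrow> P (p + r)"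
  shows "P p"
proof -
  define f where "f = Poly_Mapping.lookup p"
  have "(\<Sum>w\<in>S. Poly_Mapping.single w (f w)) \<in> carrier (free_alg n) \<and>
      P (\<Sum>w\<in>S. Poly_Mapping.single w (f w))"
    if "finite S" "S \<subseteq> Poly_Mapping.keys p" for S
    using that
  proof (induction S rule: finite_induct)
    case empty
    then show ?case using zero by (simp add: free_alg_carrier)
  next
    case (insert w S)
    have w: "set (letters w) \<subseteq> gens n"
      using insert.prems p by (auto simp: free_alg_carrier)
    have c: "Poly_Mapping.single w (f w) \<in> carrier (free_alg n)"
      using w by (simp add: free_alg_carrier)
    have IH: "(\<Sum>w\<in>S. Poly_Mapping.single w (f w)) \<in> carrier (free_alg n)"
       "P (\<Sum>w\<in>S. Poly_Mapping.single w (f w))"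
      using insert by auto
    have "Poly_Mapping.single w (f w) + (\<Sum>w\<in>S. Poly_Mapping.single w (f w)) \<in> carrier (free_alg n)"
      using c IH(1) keys_add by (fastforce simp: free_alg_carrier)
    then show ?case
      using insert.hyps add[OF c IH(1) single[OF w] IH(2)] by simp
  qed
  from this[of "Poly_Mapping.keys p"] show ?thesis
    using poly_mapping_sum_single[of p] by (simp add: f_def)
qed

lemma letters_plus: "letters (v + w) = letters v @ letters w"
  by (simp add: plus_word_def)

lemma letters_zero: "letters 0 = []"
  by (simp add: zero_word_def)

lemma free_alg_add:
  "p \<in> carrier (free_alg n) \<Longrightarrow> r \<in> carrier (free_alg n) \<Longrightarrow> p + r \<in> carrier (free_alg n)"
  using keys_add[of p r] unfolding free_alg_carrier by blast

lemma free_alg_mult: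
  assumes "p \<in> carrier (free_alg n)" "r \<in> carrier (free_alg n)"
  shows "p * r \<in> carrier (free_alg n)"
  unfolding free_alg_carrier
proof
  fix w assume "w \<in> Poly_Mapping.keys (p * r)"
  then obtain u v where "w = u + v" "u \<in> Poly_Mapping.keys p" "v \<in> Poly_Mapping.keys r"
    using keys_mult[of p r] by blast
  then show "set (letters w) \<subseteq> gens n"
    using assms by (simp add: free_alg_carrier letters_plus)
qed

lemma free_alg_uminus: "p \<in> carrier (free_alg n) \<Longrightarrow> - p \<in> carrier (free_alg n)"
  by (simp add: free_alg_carrier in_keys_iff)

lemma free_alg_const: "const c \<in> carrier (free_alg n)"
  by (simp add: free_alg_carrier const_def letters_zero)

lemma free_alg_var: "x \<in> gens n \<Longrightarrow> var x \<in> carrier (free_alg n)"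
  by (simp add: free_alg_carrier var_def)

lemma free_alg_zero: "0 \<in> carrier (free_alg n)"
  by (simp add: free_alg_carrier)

lemma free_alg_one: "1 \<in> carrier (free_alg n)"
  by (simp add: free_alg_carrier letters_zero)

lemmas free_alg_closed = free_alg_add free_alg_mult free_alg_uminus free_alg_const free_alg_var
  free_alg_zero free_alg_one

lemma free_alg_minus:
  "p \<in> carrier (free_alg n) \<Longrightarrow> r \<in> carrier (free_alg n) \<Longrightarrow> p - r \<in> carrier (free_alg n)"
  using free_alg_add[of p n "- r"] free_alg_uminus[of r n] by simp

lemma complex_algebra_free_alg: "complex_algebra (free_alg n)"
proof -
  have "ring (free_alg n)"
  proof (rule ringI)
    show "abelian_group (free_alg n)"
    proof (rule abelian_groupI)
      fix x assume "x \<in> carrier (free_alg n)"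
      then show "\<exists>y\<in>carrier (free_alg n). y \<oplus>\<^bsub>free_alg n\<^esub> x = \<zero>\<^bsub>free_alg n\<^esub>"
        by (intro bexI[of _ "- x"]) (auto simp: free_alg_uminus)
    qed (auto simp: free_alg_closed algebra_simps)
    show "Group.monoid (free_alg n)"
      by (rule monoidI) (auto simp: free_alg_closed algebra_simps)
  qed (auto simp: algebra_simps)
  then interpret ring "free_alg n" .
  show ?thesis
    by unfold_locales
      (auto simp: free_alg_closed const_add const_mult distrib_left distrib_right mult.assoc,
        metis mult.assoc const_central)
qed

definition word_value :: "(complex, 'b, 'm) module_scheme \<Rightarrow> (gen \<Rightarrow> 'b) \<Rightarrow> gen list \<Rightarrow> 'b" where
  "word_value B g xs = foldr (\<lambda>x b. g x \<otimes>\<^bsub>B\<^esub> b) xs \<one>\<^bsub>B\<^esub>"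

lemma word_value_simps [simp]:
  "word_value B g [] = \<one>\<^bsub>B\<^esub>" "word_value B g (x # xs) = g x \<otimes>\<^bsub>B\<^esub> word_value B g xs"
  by (simp_all add: word_value_def)

context complex_algebra begin

lemma word_value_closed:
  "g \<in> gens n \<rightarrow> carrier A \<Longrightarrow> set xs \<subseteq> gens n \<Longrightarrow> word_value A g xs \<in> carrier A"
  by (induction xs) auto

lemma word_value_append:
  "g \<in> gens n \<rightarrow> carrier A \<Longrightarrow> set xs \<subseteq> gens n \<Longrightarrow> set ys \<subseteq> gens n \<Longrightarrow>
    word_value A g (xs @ ys) = word_value A g xs \<otimes> word_value A g ys"
proof (induction xs)
  case (Cons x xs)
  then have "g x \<in> carrier A" "word_value A g xs \<in> carrier A" "word_value A g ys \<in> carrier A"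
    by (auto intro!: word_value_closed)
  with Cons show ?case by (simp add: m_assoc)
qed (simp add: word_value_closed)

text \<open>
  The free lift sums over the support of its argument. Summing over any larger finite set of words
  instead allows the lifts of two elements to be written as sums over the same set, from which
  additivity is immediate.
\<close>

lemma free_lift_eq_finsum:
  assumes g: "g \<in> gens n \<rightarrow> carrier A" and S: "finite S" "Poly_Mapping.keys p \<subseteq> S"
    and n: "\<forall>w\<in>S. set (letters w) \<subseteq> gens n"
  shows "free_lift A g p = (\<Oplus>w\<in>S. Poly_Mapping.lookup p w \<odot> word_value A g (letters w))"
  unfolding free_lift_def word_value_def[symmetric]
proof (rule add.finprod_mono_neutral_cong_left)
  show "Poly_Mapping.lookup p w \<odot> word_value A g (letters w) = \<zero>"
    if "w \<in> S - Poly_Mapping.keys p" for w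
    using that n word_value_closed[OF g] by (simp add: in_keys_iff)
qed (use S n word_value_closed[OF g] in auto)

lemma free_lift_single:
  assumes g: "g \<in> gens n \<rightarrow> carrier A" and w: "set (letters w) \<subseteq> gens n"
  shows "free_lift A g (Poly_Mapping.single w c) = c \<odot> word_value A g (letters w)"
  using free_lift_eq_finsum[OF g, of "{w}" "Poly_Mapping.single w c"] w
    word_value_closed[OF g w] by (simp add: add.finprod_insert)

lemma free_lift_closed:
  assumes g: "g \<in> gens n \<rightarrow> carrier A" and p: "p \<in> carrier (free_alg n)"
  shows "free_lift A g p \<in> carrier A"
  using p word_value_closed[OF g] unfolding free_lift_def word_value_def[symmetric]
  by (intro finsum_closed) (auto simp: free_alg_carrier)

lemma free_lift_add:
  assumes g: "g \<in> gens n \<rightarrow> carrier A"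
    and p: "p \<in> carrier (free_alg n)" and r: "r \<in> carrier (free_alg n)"
  shows "free_lift A g (p + r) = free_lift A g p \<oplus> free_lift A g r"
proof -
  define S where "S = Poly_Mapping.keys p \<union> Poly_Mapping.keys r"
  have S: "finite S" "\<forall>w\<in>S. set (letters w) \<subseteq> gens n" "Poly_Mapping.keys (p + r) \<subseteq> S"
    "Poly_Mapping.keys p \<subseteq> S" "Poly_Mapping.keys r \<subseteq> S"
    using p r keys_add[of p r] by (auto simp: S_def free_alg_carrier)
  have W: "word_value A g (letters w) \<in> carrier A" if "w \<in> S" for w
    using that S word_value_closed[OF g] by blast
  have "(\<Oplus>w\<in>S. Poly_Mapping.lookup (p + r) w \<odot> word_value A g (letters w)) =
      (\<Oplus>w\<in>S. Poly_Mapping.lookup p w \<odot> word_value A g (letters w)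
        \<oplus> Poly_Mapping.lookup r w \<odot> word_value A g (letters w))"
    by (rule finsum_cong') (auto simp: W lookup_add smult_l_distr)
  also have "\<dots> = (\<Oplus>w\<in>S. Poly_Mapping.lookup p w \<odot> word_value A g (letters w))
      \<oplus> (\<Oplus>w\<in>S. Poly_Mapping.lookup r w \<odot> word_value A g (letters w))"
    by (rule finsum_addf) (auto simp: W)
  finally show ?thesis
    by (simp add: free_lift_eq_finsum[OF g S(1,3,2)] free_lift_eq_finsum[OF g S(1,4,2)]
      free_lift_eq_finsum[OF g S(1,5,2)])
qed

lemma free_lift_zero: "free_lift A g 0 = \<zero>"
  by (simp add: free_lift_def)

text \<open>
  Both sides are additive in each factor, which reduces the claim to two words; on words it is the
  compatibility of \<open>word_value\<close> with concatenation.
\<close>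

lemma free_lift_mult:
  assumes g: "g \<in> gens n \<rightarrow> carrier A"
    and p: "p \<in> carrier (free_alg n)" and r: "r \<in> carrier (free_alg n)"
  shows "free_lift A g (p * r) = free_lift A g p \<otimes> free_lift A g r"
  using p
proof (induction p rule: free_alg_induct)
  case zero
  then show ?case using free_lift_closed[OF g r] by (simp add: free_lift_zero)
next
  case (single w c)
  have cw: "Poly_Mapping.single w c \<in> carrier (free_alg n)" for c
    using single by (simp add: free_alg_carrier)
  note W = word_value_closed[OF g single]
  show ?case using r
  proof (induction r rule: free_alg_induct)
    case zero
    then show ?case using free_lift_closed[OF g cw] by (simp add: free_lift_zero)
  next
    case (single v d)
    then show ?case
      using W word_value_closed[OF g single] \<open>set (letters w) \<subseteq> gens n\<close>
      by (simp add: mult_single free_lift_single[OF g] letters_plus word_value_append[OF g]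
          smult_mult_left smult_mult_right mult.commute flip: smult_assoc)
  next
    case (add p r)
    then show ?case
      by (simp add: distrib_left free_lift_add[OF g] free_alg_mult cw free_lift_closed[OF g] r_distr)
  qed
next
  case (add p r')
  then show ?case
    using r by (simp add: distrib_right free_lift_add[OF g] free_alg_mult free_lift_closed[OF g] l_distr)
qed

lemma free_lift_const:
  "g \<in> gens n \<rightarrow> carrier A \<Longrightarrow> free_lift A g (const c) = c \<odot> \<one>"
  using free_lift_single[of g n 0 c] by (simp add: const_def letters_zero)

lemma free_lift_var:
  "g \<in> gens n \<rightarrow> carrier A \<Longrightarrow> x \<in> gens n \<Longrightarrow> free_lift A g (var x) = g x"
  using free_lift_single[of g n "Word [x]" 1] funcset_mem[of g "gens n" "carrier A" x]
  by (simp add: var_def)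

lemma free_lift_hom:
  assumes g: "g \<in> gens n \<rightarrow> carrier A"
  shows "algebra_hom (free_alg n) A (free_lift A g)"
proof -
  interpret F: complex_algebra "free_alg n" by (rule complex_algebra_free_alg)
  show ?thesis
  proof unfold_locales
    show "free_lift A g \<in> Ring.ring_hom (free_alg n) A"
      using free_lift_const[OF g, of 1]
      by (intro ring_hom_memI)
        (auto simp: free_lift_closed[OF g] free_lift_add[OF g] free_lift_mult[OF g])
  next
    fix x c assume "x \<in> carrier (free_alg n)"
    then show "free_lift A g (c \<odot>\<^bsub>free_alg n\<^esub> x) = c \<odot> free_lift A g x"
      by (simp add: free_lift_mult[OF g] free_alg_const free_lift_const[OF g] free_lift_closed[OF g]
          smult_mult_left)
  qed
qed

end

lemma complex_algebra_cong:
  assumes A: "complex_algebra A"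
    and "carrier B = carrier A" "monoid.mult B = monoid.mult A" "one B = one A" "zero B = zero A"
      "add B = add A" "smult B = smult A"
  shows "complex_algebra B"
proof -
  interpret A: complex_algebra A by fact
  note [simp] = assms(2-)
  have "ring B"
  proof (rule ringI)
    show "abelian_group B"
    proof (rule abelian_groupI)
      fix x assume "x \<in> carrier B"
      then show "\<exists>y\<in>carrier B. y \<oplus>\<^bsub>B\<^esub> x = \<zero>\<^bsub>B\<^esub>"
        using A.l_neg A.a_inv_closed by (intro bexI[of _ "\<ominus>\<^bsub>A\<^esub> x"]) auto
    qed (auto simp: A.a_assoc A.a_comm A.a_lcomm)
    show "Group.monoid B"
      by (rule monoidI) (auto simp: A.m_assoc)
  qed (auto simp: A.l_distr A.r_distr)
  then interpret ring B .
  show ?thesis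
    by unfold_locales (auto simp: A.smult_l_distr A.smult_r_distr A.smult_assoc A.smult_mult_left
        A.smult_mult_right)
qed

lemma quotient_alg_simps:
  "carrier (quotient_alg A I) = carrier (A Quot I)"
  "monoid.mult (quotient_alg A I) = monoid.mult (A Quot I)"
  "one (quotient_alg A I) = one (A Quot I)"
  "zero (quotient_alg A I) = zero (A Quot I)"
  "add (quotient_alg A I) = add (A Quot I)"
  "smult (quotient_alg A I) = (\<lambda>c X. \<Union>x\<in>X. I +>\<^bsub>A\<^esub> (c \<odot>\<^bsub>A\<^esub> x))"
  by (simp_all add: quotient_alg_def ring.defs module.defs)

lemma quotient_algebra_hom:
  fixes A :: "(complex, 'a) module"
  assumes "complex_algebra A" and "ideal I A"
  shows "algebra_hom A (quotient_alg A I) (\<lambda>x. I +>\<^bsub>A\<^esub> x)"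
proof -
  interpret complex_algebra A by fact
  interpret I: ideal I A by fact
  let ?Q = "quotient_alg A I" and ?p = "\<lambda>x. I +>\<^bsub>A\<^esub> x"
  have ring_hom: "?p \<in> Ring.ring_hom A ?Q"
    using I.rcos_ring_hom by (simp add: Ring.ring_hom_def quotient_alg_simps)
  have carr: "X \<in> carrier ?Q \<longleftrightarrow> (\<exists>x\<in>carrier A. X = ?p x)" for X
  proof -
    have "carrier ?Q = (\<Union>x\<in>carrier A. {?p x})"
      by (simp only: quotient_alg_simps FactRing_def partial_object.simps A_RCOSETS_def' a_r_coset_def')
    then show ?thesis by simp
  qed
  have smult: "c \<odot>\<^bsub>?Q\<^esub> (?p x) = ?p (c \<odot>\<^bsub>A\<^esub> x)" if x: "x \<in> carrier A" for c x
  proof -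
    have "?p (c \<odot>\<^bsub>A\<^esub> x') = ?p (c \<odot>\<^bsub>A\<^esub> x)" if "x' \<in> ?p x" for x'
    proof -
      obtain h where h: "h \<in> I" "x' = h \<oplus>\<^bsub>A\<^esub> x"
        using \<open>x' \<in> ?p x\<close> by (auto simp: a_r_coset_def')
      \<comment> \<open>A ring ideal is a subspace, because scalars act as multiplication by multiples of the unit.\<close>
      have "c \<odot>\<^bsub>A\<^esub> h = (c \<odot>\<^bsub>A\<^esub> \<one>\<^bsub>A\<^esub>) \<otimes>\<^bsub>A\<^esub> h"
        using h by (simp add: smult_mult_left)
      then have "c \<odot>\<^bsub>A\<^esub> h \<in> I"
        using h I.I_l_closed by simp
      then have "c \<odot>\<^bsub>A\<^esub> x' \<in> ?p (c \<odot>\<^bsub>A\<^esub> x)"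
        using h x by (auto simp: a_r_coset_def' smult_r_distr)
      then show ?thesis
        using I.a_repr_independence' x by simp
    qed
    moreover have "x \<in> ?p x"
      using x by (rule I.a_rcos_self)
    ultimately show ?thesis
      unfolding quotient_alg_simps by (intro SUP_eq_const) blast+
  qed
  have add: "?p x \<oplus>\<^bsub>?Q\<^esub> ?p y = ?p (x \<oplus>\<^bsub>A\<^esub> y)" and mult: "?p x \<otimes>\<^bsub>?Q\<^esub> ?p y = ?p (x \<otimes>\<^bsub>A\<^esub> y)"
    if "x \<in> carrier A" "y \<in> carrier A" for x y
    using that ring_hom_add[OF ring_hom] ring_hom_mult[OF ring_hom] by auto
  have in_carr: "?p x \<in> carrier ?Q" if "x \<in> carrier A" for x
    using that carr by auto
  interpret QR: ring "A Quot I" by (rule I.quotient_is_ring)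
  have "ring ?Q"
  proof (rule ringI)
    show "abelian_group ?Q"
    proof (rule abelian_groupI)
      fix x assume "x \<in> carrier ?Q"
      then show "\<exists>y\<in>carrier ?Q. y \<oplus>\<^bsub>?Q\<^esub> x = \<zero>\<^bsub>?Q\<^esub>"
        using QR.l_neg[of x] QR.a_inv_closed by (auto simp: quotient_alg_simps)
    qed (auto simp: quotient_alg_simps QR.a_assoc QR.a_comm QR.a_lcomm)
    show "Group.monoid ?Q"
      by (rule monoidI) (auto simp: quotient_alg_simps QR.m_assoc)
  qed (auto simp: quotient_alg_simps QR.l_distr QR.r_distr)
  then interpret Q: ring ?Q .
  show ?thesis
  proof unfold_locales
    show "?p \<in> Ring.ring_hom A ?Q" by (rule ring_hom)
  qed (auto simp: carr smult add mult in_carr smult_l_distr smult_r_distr smult_assoc smult_mult_left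
      smult_mult_right)
qed

section \<open>Presentation of the quantised enveloping algebra\<close>

lemma gens_iff [simp]:
  "gE i \<in> gens n \<longleftrightarrow> i \<in> {1..n}" "gF i \<in> gens n \<longleftrightarrow> i \<in> {1..n}"
  "gK i \<in> gens n \<longleftrightarrow> i \<in> {1..n}" "gKi i \<in> gens n \<longleftrightarrow> i \<in> {1..n}"
  by (auto simp: gens_def)

lemma uq_rels_carrier: "uq_rels n q \<subseteq> carrier (free_alg n)"
proof
  fix r assume "r \<in> uq_rels n q"
  then show "r \<in> carrier (free_alg n)"
    by induction (auto intro!: free_alg_minus free_alg_closed)
qed

lemma uq_ideal_ideal: "ideal (uq_ideal n q) (free_alg n)"
proof -
  interpret complex_algebra "free_alg n" by (rule complex_algebra_free_alg)
  show ?thesis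
    unfolding uq_ideal_def by (rule genideal_ideal[OF uq_rels_carrier])
qed

lemma uq_simps [simp]:
  "carrier (uq n q) = carrier (uq_alg n q)"
  "monoid.mult (uq n q) = monoid.mult (uq_alg n q)"
  "one (uq n q) = one (uq_alg n q)"
  "zero (uq n q) = zero (uq_alg n q)"
  "add (uq n q) = add (uq_alg n q)"
  "smult (uq n q) = smult (uq_alg n q)"
  "comult (uq n q) = induced_map (tensor_alg (uq_alg n q)) (uq_comult_gen n q)"
  "counit (uq n q) = induced_map complex_alg uq_counit_gen"
  by (simp_all add: uq_def module.defs bialg.defs)

definition uq_proj :: "nat \<Rightarrow> real \<Rightarrow> falg \<Rightarrow> falg set" where
  "uq_proj n q p = uq_ideal n q +>\<^bsub>free_alg n\<^esub> p"

lemma uq_proj_hom: "algebra_hom (free_alg n) (uq_alg n q) (uq_proj n q)"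
  using quotient_algebra_hom[OF complex_algebra_free_alg uq_ideal_ideal]
  by (simp add: uq_alg_def uq_proj_def[abs_def])

lemma uq_proj_var: "uq_proj n q (var x) = uq_gen n q x"
  by (simp add: uq_proj_def uq_gen_def)

lemma complex_algebra_uq_alg: "complex_algebra (uq_alg n q)"
  using uq_proj_hom by (rule algebra_hom.axioms(2))

lemma complex_algebra_uq: "complex_algebra (uq n q)"
  by (rule complex_algebra_cong[OF complex_algebra_uq_alg]) simp_all

lemma uq_carrier: "X \<in> carrier (uq_alg n q) \<longleftrightarrow> (\<exists>p\<in>carrier (free_alg n). X = uq_proj n q p)"
proof -
  have "carrier (uq_alg n q) = (\<Union>p\<in>carrier (free_alg n). {uq_proj n q p})"
    by (simp only: uq_alg_def uq_proj_def quotient_alg_simps FactRing_def partial_object.simps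
        A_RCOSETS_def' a_r_coset_def')
  then show ?thesis by simp
qed

lemma uq_proj_rel: "r \<in> uq_rels n q \<Longrightarrow> uq_proj n q r = \<zero>\<^bsub>uq_alg n q\<^esub>"
proof -
  assume r: "r \<in> uq_rels n q"
  interpret complex_algebra "free_alg n" by (rule complex_algebra_free_alg)
  interpret ideal "uq_ideal n q" "free_alg n" by (rule uq_ideal_ideal)
  have "r \<in> uq_ideal n q"
    unfolding uq_ideal_def using genideal_self[OF uq_rels_carrier] r by blast
  then show ?thesis
    unfolding uq_proj_def uq_alg_def quotient_alg_simps FactRing_def
    by (simp add: a_rcos_const)
qed

text \<open>
  The universal property: an assignment on the generators which respects the relations has the
  ideal of relations in the kernel of its free lift, so the lift is constant on cosets.
\<close>

lemma
  assumes B: "complex_algebra B" and g: "g \<in> gens n \<rightarrow> carrier B"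
    and rels: "\<And>r. r \<in> uq_rels n q \<Longrightarrow> free_lift B g r = \<zero>\<^bsub>B\<^esub>"
  shows induced_map_hom: "algebra_hom (uq_alg n q) B (induced_map B g)"
    and induced_map_gen: "x \<in> gens n \<Longrightarrow> induced_map B g (uq_gen n q x) = g x"
proof -
  interpret F: complex_algebra "free_alg n" by (rule complex_algebra_free_alg)
  interpret U: complex_algebra "uq_alg n q" by (rule complex_algebra_uq_alg)
  interpret P: algebra_hom "free_alg n" "uq_alg n q" "uq_proj n q" by (rule uq_proj_hom)
  interpret B: complex_algebra B by fact
  interpret L: algebra_hom "free_alg n" B "free_lift B g" by (rule B.free_lift_hom[OF g])
  interpret I: ideal "uq_ideal n q" "free_alg n" by (rule uq_ideal_ideal)
  have R: "ring_hom_ring (free_alg n) B (free_lift B g)"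
    by (rule ring_hom_ringI2[OF F.ring_axioms B.ring_axioms L.ring_hom])
  have "uq_ideal n q \<subseteq> a_kernel (free_alg n) B (free_lift B g)"
    unfolding uq_ideal_def
  proof (rule F.genideal_minimal[OF ring_hom_ring.kernel_is_ideal[OF R]], rule subsetI)
    fix r assume r: "r \<in> uq_rels n q"
    show "r \<in> a_kernel (free_alg n) B (free_lift B g)"
      unfolding a_kernel_def' using rels[OF r] subsetD[OF uq_rels_carrier r] by simp
  qed
  then have ker: "free_lift B g h = \<zero>\<^bsub>B\<^esub>" if "h \<in> uq_ideal n q" for h
    using that unfolding a_kernel_def' by blast
  have val: "induced_map B g (uq_proj n q p) = free_lift B g p" if p: "p \<in> carrier (free_alg n)" for p
  proof -
    have "free_lift B g p' = free_lift B g p" if "p' \<in> uq_proj n q p" for p'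
    proof -
      obtain h where h: "h \<in> uq_ideal n q" "p' = h + p"
        using \<open>p' \<in> uq_proj n q p\<close> by (auto simp: uq_proj_def a_r_coset_def')
      show ?thesis
        using h p I.a_Hcarr[OF h(1)] L.hom_add[of h p] L.hom_closed[OF p] ker[OF h(1)]
        by simp
    qed
    moreover have "p \<in> uq_proj n q p"
      unfolding uq_proj_def by (rule I.a_rcos_self[OF p])
    ultimately have "free_lift B g ` uq_proj n q p = {free_lift B g p}"
      by blast
    then show ?thesis
      by (simp add: induced_map_def)
  qed
  show "algebra_hom (uq_alg n q) B (induced_map B g)"
  proof unfold_locales
    show "induced_map B g \<in> Ring.ring_hom (uq_alg n q) B"
    proof (rule ring_hom_memI)
      show "induced_map B g \<one>\<^bsub>uq_alg n q\<^esub> = \<one>\<^bsub>B\<^esub>"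
        using val[of 1] L.hom_one P.hom_one by (simp add: free_alg_one)
    next
      fix x assume "x \<in> carrier (uq_alg n q)"
      then show "induced_map B g x \<in> carrier B"
        using val L.hom_closed by (auto simp: uq_carrier)
    next
      fix x y assume "x \<in> carrier (uq_alg n q)" "y \<in> carrier (uq_alg n q)"
      then obtain p r where pr: "p \<in> carrier (free_alg n)" "r \<in> carrier (free_alg n)"
        "x = uq_proj n q p" "y = uq_proj n q r"
        by (auto simp: uq_carrier)
      show "induced_map B g (x \<otimes>\<^bsub>uq_alg n q\<^esub> y) = induced_map B g x \<otimes>\<^bsub>B\<^esub> induced_map B g y"
        using pr P.hom_mult[of p r] L.hom_mult[of p r] val[of p] val[of r] val[of "p * r"]
        by (simp add: free_alg_mult)
      show "induced_map B g (x \<oplus>\<^bsub>uq_alg n q\<^esub> y) = induced_map B g x \<oplus>\<^bsub>B\<^esub> induced_map B g y"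
        using pr P.hom_add[of p r] L.hom_add[of p r] val[of p] val[of r] val[of "p + r"]
        by (simp add: free_alg_add)
    qed
  next
    fix x c assume "x \<in> carrier (uq_alg n q)"
    then obtain p where p: "p \<in> carrier (free_alg n)" "x = uq_proj n q p"
      by (auto simp: uq_carrier)
    show "induced_map B g (c \<odot>\<^bsub>uq_alg n q\<^esub> x) = c \<odot>\<^bsub>B\<^esub> induced_map B g x"
      using p P.hom_smult[of p c] L.hom_smult[of p c] val[of p] val[of "const c * p"]
      by (simp add: free_alg_mult free_alg_const)
  qed
  show "induced_map B g (uq_gen n q x) = g x" if "x \<in> gens n"
    using val[of "var x"] B.free_lift_var[OF g that] that by (simp add: free_alg_var uq_proj_var)
qed

section \<open>The tensor square of an algebra\<close>

interpretation fs: vector_space fscale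
  by (rule vector_space_fscale)

lemma fscale_apply: "fscale c f x = c * f x"
  by (simp add: fscale_def)

text \<open>
  Tensors are handled as finite lists of pairs of legs; distinct lists may represent the same
  tensor. Lists make it possible to keep track of the legs that occur.
\<close>

definition tens :: "(complex, 'a, 'm) module_scheme \<Rightarrow> ('a \<times> 'a) list \<Rightarrow> 'a tensor" where
  "tens V ps = (\<lambda>\<beta>. if bilinear_form V \<beta> then \<Sum>(x, y)\<leftarrow>ps. \<beta> x y else 0)"

lemma pure_tensor_eq_tens: "pure_tensor V x y = tens V [(x, y)]"
  by (simp add: pure_tensor_def tens_def fun_eq_iff)

lemma tens_Nil: "tens V [] = 0"
  by (auto simp: tens_def)

lemma tens_append: "tens V (ps @ rs) = tens V ps + tens V rs"
  by (auto simp: tens_def)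

lemma bilinear_form_addL:
  "bilinear_form V \<beta> \<Longrightarrow> x \<in> carrier V \<Longrightarrow> y \<in> carrier V \<Longrightarrow> z \<in> carrier V \<Longrightarrow>
    \<beta> (x \<oplus>\<^bsub>V\<^esub> y) z = \<beta> x z + \<beta> y z"
  by (simp add: bilinear_form_def linear_form_def)

lemma bilinear_form_addR:
  "bilinear_form V \<beta> \<Longrightarrow> x \<in> carrier V \<Longrightarrow> y \<in> carrier V \<Longrightarrow> z \<in> carrier V \<Longrightarrow>
    \<beta> z (x \<oplus>\<^bsub>V\<^esub> y) = \<beta> z x + \<beta> z y"
  by (simp add: bilinear_form_def linear_form_def)

lemma bilinear_form_smultL:
  "bilinear_form V \<beta> \<Longrightarrow> x \<in> carrier V \<Longrightarrow> z \<in> carrier V \<Longrightarrow> \<beta> (c \<odot>\<^bsub>V\<^esub> x) z = c * \<beta> x z"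
  by (simp add: bilinear_form_def linear_form_def)

lemma bilinear_form_smultR:
  "bilinear_form V \<beta> \<Longrightarrow> x \<in> carrier V \<Longrightarrow> z \<in> carrier V \<Longrightarrow> \<beta> z (c \<odot>\<^bsub>V\<^esub> x) = c * \<beta> z x"
  by (simp add: bilinear_form_def linear_form_def)

lemmas bilinear_form_simps =
  bilinear_form_addL bilinear_form_addR bilinear_form_smultL bilinear_form_smultR

lemma tens_scale:
  assumes "set ps \<subseteq> carrier V \<times> carrier V"
  shows "fscale c (tens V ps) = tens V (map (\<lambda>(x, y). (c \<odot>\<^bsub>V\<^esub> x, y)) ps)"
proof
  fix \<beta>
  have "c * (\<Sum>(x, y)\<leftarrow>ps. \<beta> x y) = (\<Sum>(x, y)\<leftarrow>map (\<lambda>(x, y). (c \<odot>\<^bsub>V\<^esub> x, y)) ps. \<beta> x y)"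
    if \<beta>: "bilinear_form V \<beta>"
    using assms by (induction ps) (auto simp: algebra_simps bilinear_form_simps[OF \<beta>])
  then show "fscale c (tens V ps) \<beta> = tens V (map (\<lambda>(x, y). (c \<odot>\<^bsub>V\<^esub> x, y)) ps) \<beta>"
    by (simp add: tens_def fscale_def)
qed

lemma tens_in_tensor_space: "set ps \<subseteq> S \<times> R \<Longrightarrow> tens V ps \<in> tensor_space V S R"
proof (induction ps)
  case Nil
  show ?case unfolding tensor_space_def tens_Nil by (rule fs.span_zero)
next
  case (Cons p ps)
  obtain x y where p: "p = (x, y)" by force
  have "tens V (p # ps) = pure_tensor V x y + tens V ps"
    using tens_append[of V "[p]" ps] by (simp add: pure_tensor_eq_tens p)
  moreover have "pure_tensor V x y \<in> tensor_space V S R"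
    using Cons.prems p by (auto simp: tensor_space_def intro!: fs.span_base)
  moreover have "tens V ps \<in> tensor_space V S R"
    using Cons by simp
  ultimately show ?case
    unfolding tensor_space_def by (simp only: fs.span_add)
qed

lemma tensor_space_tens:
  assumes t: "t \<in> tensor_space V S R"
    and S: "S \<subseteq> carrier V" "\<And>c x. x \<in> S \<Longrightarrow> c \<odot>\<^bsub>V\<^esub> x \<in> S" and R: "R \<subseteq> carrier V"
  obtains ps where "set ps \<subseteq> S \<times> R" "t = tens V ps"
proof -
  have "\<exists>ps. set ps \<subseteq> S \<times> R \<and> t = tens V ps"
    using t unfolding tensor_space_def
  proof (induction rule: fs.span_induct_alt)
    case base
    show ?case by (rule exI[of _ "[]"]) (simp add: tens_Nil)
  next
    case (step c s t)
    then obtain x y ps where s: "s = pure_tensor V x y" "x \<in> S" "y \<in> R"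
      and ps: "set ps \<subseteq> S \<times> R" "t = tens V ps" by auto
    have "fscale c s = tens V [(c \<odot>\<^bsub>V\<^esub> x, y)]"
      using s S R tens_scale[of "[(x, y)]" V c] by (auto simp: pure_tensor_eq_tens)
    then show ?case
      using s ps S(2) by (intro exI[of _ "(c \<odot>\<^bsub>V\<^esub> x, y) # ps"])
        (auto simp flip: tens_append)
  qed
  then show thesis using that by blast
qed

lemma tensor_space_eq:
  assumes S: "S \<subseteq> carrier V" "\<And>c x. x \<in> S \<Longrightarrow> c \<odot>\<^bsub>V\<^esub> x \<in> S" and R: "R \<subseteq> carrier V"
  shows "t \<in> tensor_space V S R \<longleftrightarrow> (\<exists>ps. set ps \<subseteq> S \<times> R \<and> t = tens V ps)"
  using tensor_space_tens[OF _ S R, of t] tens_in_tensor_space by metis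

lemma linear_form_sum_list:
  "(\<And>p. p \<in> set ps \<Longrightarrow> linear_form V (\<lambda>x. f p x)) \<Longrightarrow> linear_form V (\<lambda>x. \<Sum>p\<leftarrow>ps. f p x)"
  by (induction ps) (simp_all add: linear_form_def algebra_simps)

lemma bilinear_form_sum_list:
  "(\<And>p. p \<in> set ps \<Longrightarrow> bilinear_form V (\<lambda>x y. f p x y)) \<Longrightarrow>
    bilinear_form V (\<lambda>x y. \<Sum>p\<leftarrow>ps. f p x y)"
  unfolding bilinear_form_def by (intro conjI ballI linear_form_sum_list) auto

lemma bilinear_form_cong:
  assumes "\<And>x y. x \<in> carrier V \<Longrightarrow> y \<in> carrier V \<Longrightarrow> \<beta> x y = \<gamma> x y"
    and cl: "\<And>x y. x \<in> carrier V \<Longrightarrow> y \<in> carrier V \<Longrightarrow> x \<oplus>\<^bsub>V\<^esub> y \<in> carrier V"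
      "\<And>c x. x \<in> carrier V \<Longrightarrow> c \<odot>\<^bsub>V\<^esub> x \<in> carrier V"
  shows "bilinear_form V \<beta> \<longleftrightarrow> bilinear_form V \<gamma>"
  using assms by (simp add: bilinear_form_def linear_form_def)

lemma tensor_alg_simps:
  "carrier (tensor_alg A) = tensor_space A (carrier A) (carrier A)"
  "s \<otimes>\<^bsub>tensor_alg A\<^esub> t = (\<lambda>\<beta>. if bilinear_form A \<beta>
        then s (\<lambda>x y. t (\<lambda>x' y'. \<beta> (x \<otimes>\<^bsub>A\<^esub> x') (y \<otimes>\<^bsub>A\<^esub> y'))) else 0)"
  "\<one>\<^bsub>tensor_alg A\<^esub> = pure_tensor A \<one>\<^bsub>A\<^esub> \<one>\<^bsub>A\<^esub>"
  "\<zero>\<^bsub>tensor_alg A\<^esub> = 0" "s \<oplus>\<^bsub>tensor_alg A\<^esub> t = s + t" "c \<odot>\<^bsub>tensor_alg A\<^esub> t = fscale c t"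
  by (simp_all add: tensor_alg_def)

context complex_algebra begin

lemma tensor_alg_carrier:
  "t \<in> carrier (tensor_alg A) \<longleftrightarrow> (\<exists>ps. set ps \<subseteq> carrier A \<times> carrier A \<and> t = tens A ps)"
  unfolding tensor_alg_simps by (rule tensor_space_eq) auto

lemma tens_closed: "set ps \<subseteq> carrier A \<times> carrier A \<Longrightarrow> tens A ps \<in> carrier (tensor_alg A)"
  unfolding tensor_alg_carrier by blast

text \<open>
  When a product in \<open>tensor_alg\<close> is evaluated at a bilinear form, both factors are again evaluated at
  bilinear forms, so that their default value 0 does not interfere.
\<close>

lemma bilinear_form_translate:
  assumes "bilinear_form A \<beta>" "x \<in> carrier A" "y \<in> carrier A"
  shows "bilinear_form A (\<lambda>x' y'. \<beta> (x \<otimes> x') (y \<otimes> y'))" (is ?l)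
    "bilinear_form A (\<lambda>x' y'. \<beta> (x' \<otimes> x) (y' \<otimes> y))" (is ?r)
proof -
  show ?l ?r
    using assms(2-) unfolding bilinear_form_def linear_form_def
    by (auto simp: r_distr l_distr smult_mult_left smult_mult_right bilinear_form_simps[OF assms(1)])
qed

lemma tens_mult:
  assumes ps: "set ps \<subseteq> carrier A \<times> carrier A" and rs: "set rs \<subseteq> carrier A \<times> carrier A"
  shows "tens A ps \<otimes>\<^bsub>tensor_alg A\<^esub> tens A rs =
    (\<lambda>\<beta>. if bilinear_form A \<beta> then \<Sum>(x, y)\<leftarrow>ps. \<Sum>(x', y')\<leftarrow>rs. \<beta> (x \<otimes> x') (y \<otimes> y') else 0)"
proof
  fix \<beta>
  define \<gamma> where "\<gamma> x y = tens A rs (\<lambda>x' y'. \<beta> (x \<otimes> x') (y \<otimes> y'))" for x y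
  show "(tens A ps \<otimes>\<^bsub>tensor_alg A\<^esub> tens A rs) \<beta> =
    (if bilinear_form A \<beta> then \<Sum>(x, y)\<leftarrow>ps. \<Sum>(x', y')\<leftarrow>rs. \<beta> (x \<otimes> x') (y \<otimes> y') else 0)"
  proof (cases "bilinear_form A \<beta>")
    case True
    have \<gamma>: "\<gamma> x y = (\<Sum>(x', y')\<leftarrow>rs. \<beta> (x \<otimes> x') (y \<otimes> y'))" if "x \<in> carrier A" "y \<in> carrier A" for x y
      using bilinear_form_translate(1)[OF True that] by (simp add: \<gamma>_def tens_def)
    have "bilinear_form A (\<lambda>x y. \<Sum>p\<leftarrow>rs. \<beta> (x \<otimes> fst p) (y \<otimes> snd p))"
      using rs by (intro bilinear_form_sum_list bilinear_form_translate(2)[OF True]) auto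
    then have b: "bilinear_form A \<gamma>"
      by (subst bilinear_form_cong[of A \<gamma>]) (auto simp: \<gamma> case_prod_unfold)
    have "(tens A ps \<otimes>\<^bsub>tensor_alg A\<^esub> tens A rs) \<beta> = tens A ps \<gamma>"
      using True by (simp add: tensor_alg_simps \<gamma>_def[abs_def])
    also have "\<dots> = (\<Sum>(x, y)\<leftarrow>ps. \<gamma> x y)"
      using b by (simp add: tens_def)
    also have "\<dots> = (\<Sum>(x, y)\<leftarrow>ps. \<Sum>(x', y')\<leftarrow>rs. \<beta> (x \<otimes> x') (y \<otimes> y'))"
      using ps by (intro arg_cong[of _ _ sum_list] map_cong) (auto simp: \<gamma>)
    finally show ?thesis
      using True by simp
  qed (simp add: tensor_alg_simps)
qed

definition list_mult :: "('a \<times> 'a) list \<Rightarrow> ('a \<times> 'a) list \<Rightarrow> ('a \<times> 'a) list" where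
  "list_mult ps rs = concat (map (\<lambda>(x, y). map (\<lambda>(x', y'). (x \<otimes> x', y \<otimes> y')) rs) ps)"

lemma list_mult_closed:
  "set ps \<subseteq> carrier A \<times> carrier A \<Longrightarrow> set rs \<subseteq> carrier A \<times> carrier A \<Longrightarrow>
    set (list_mult ps rs) \<subseteq> carrier A \<times> carrier A"
  by (force simp: list_mult_def)

lemma tens_mult_list:
  assumes "set ps \<subseteq> carrier A \<times> carrier A" "set rs \<subseteq> carrier A \<times> carrier A"
  shows "tens A ps \<otimes>\<^bsub>tensor_alg A\<^esub> tens A rs = tens A (list_mult ps rs)"
proof -
  have "(\<Sum>(x, y)\<leftarrow>ps. \<Sum>(x', y')\<leftarrow>rs. \<beta> (x \<otimes> x') (y \<otimes> y')) = (\<Sum>(x, y)\<leftarrow>list_mult ps rs. \<beta> x y)"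
    for \<beta> :: "'a \<Rightarrow> 'a \<Rightarrow> complex"
    by (induction ps) (auto simp: list_mult_def case_prod_unfold o_def)
  then show ?thesis
    unfolding tens_mult[OF assms] by (simp add: tens_def fun_eq_iff)
qed

lemma list_mult_assoc:
  assumes "set ps \<subseteq> carrier A \<times> carrier A" "set rs \<subseteq> carrier A \<times> carrier A"
    "set us \<subseteq> carrier A \<times> carrier A"
  shows "list_mult (list_mult ps rs) us = list_mult ps (list_mult rs us)"
  using assms
proof (induction ps)
  case (Cons p ps)
  obtain x y where p: "p = (x, y)" "x \<in> carrier A" "y \<in> carrier A"
    using Cons.prems by force
  have append: "list_mult (vs @ vs') us = list_mult vs us @ list_mult vs' us" for vs vs'
    by (simp add: list_mult_def)
  have "list_mult (map (\<lambda>(x', y'). (x \<otimes> x', y \<otimes> y')) rs) us =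
      map (\<lambda>(x', y'). (x \<otimes> x', y \<otimes> y')) (list_mult rs us)"
    using Cons.prems(2)
  proof (induction rs)
    case (Cons r rs)
    then show ?case
      using p Cons.prems \<open>set us \<subseteq> _\<close> by (fastforce simp: list_mult_def m_assoc)
  qed (simp add: list_mult_def)
  then show ?case
    using Cons p append[of "map (\<lambda>(x', y'). (x \<otimes> x', y \<otimes> y')) rs" "list_mult ps rs"]
    by (simp add: list_mult_def)
qed (simp add: list_mult_def)

lemma pure_tensor_mult:
  assumes "x \<in> carrier A" "y \<in> carrier A" "x' \<in> carrier A" "y' \<in> carrier A"
  shows "pure_tensor A x y \<otimes>\<^bsub>tensor_alg A\<^esub> pure_tensor A x' y' = pure_tensor A (x \<otimes> x') (y \<otimes> y')"
  unfolding pure_tensor_eq_tens using assms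
  by (subst tens_mult_list) (auto simp: list_mult_def)

text \<open>
  Associativity and the unit laws already hold for lists. Distributivity on the right does so only up to the
  order of the summands, so it is checked after evaluation at a bilinear form.
\<close>

lemma complex_algebra_tensor_alg: "complex_algebra (tensor_alg A)"
proof -
  let ?T = "tensor_alg A"
  note carr = tensor_alg_carrier
  have one: "\<one>\<^bsub>?T\<^esub> = tens A [(\<one>, \<one>)]"
    by (simp add: tensor_alg_simps pure_tensor_eq_tens)
  have mult_closed: "s \<otimes>\<^bsub>?T\<^esub> t \<in> carrier ?T" if "s \<in> carrier ?T" "t \<in> carrier ?T" for s t
    using that list_mult_closed unfolding carr by (metis tens_mult_list)
  have smult_closed: "fscale c t \<in> carrier ?T" if "t \<in> carrier ?T" for c t
    unfolding tensor_alg_simps tensor_space_def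
    using that by (simp add: tensor_alg_simps tensor_space_def fs.span_scale)
  have add_closed: "s + t \<in> carrier ?T" if "s \<in> carrier ?T" "t \<in> carrier ?T" for s t
    using that by (simp add: tensor_alg_simps tensor_space_def fs.span_add)
  have "ring ?T"
  proof (rule ringI)
    show "abelian_group ?T"
    proof (rule abelian_groupI)
      fix t assume "t \<in> carrier ?T"
      then show "\<exists>s\<in>carrier ?T. s \<oplus>\<^bsub>?T\<^esub> t = \<zero>\<^bsub>?T\<^esub>"
        using smult_closed[of t "- 1"]
        by (intro bexI[of _ "fscale (- 1) t"]) (auto simp: tensor_alg_simps(4,5) fscale_def)
    next
      show "\<zero>\<^bsub>?T\<^esub> \<in> carrier ?T"
        by (simp add: tensor_alg_simps tensor_space_def fs.span_zero)
    qed (auto simp: tensor_alg_simps(4,5) add_closed algebra_simps)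
    show "Group.monoid ?T"
    proof (rule monoidI)
      show "\<one>\<^bsub>?T\<^esub> \<in> carrier ?T"
        unfolding one by (rule tens_closed) simp
    next
      fix t assume t: "t \<in> carrier ?T"
      then obtain ps where ps: "set ps \<subseteq> carrier A \<times> carrier A" "t = tens A ps"
        by (auto simp: carr)
      have "list_mult [(\<one>, \<one>)] ps = ps" "list_mult ps [(\<one>, \<one>)] = ps"
        using ps(1) by (auto simp: list_mult_def intro!: map_idI) (induction ps, auto)
      then show "\<one>\<^bsub>?T\<^esub> \<otimes>\<^bsub>?T\<^esub> t = t" "t \<otimes>\<^bsub>?T\<^esub> \<one>\<^bsub>?T\<^esub> = t"
        unfolding one ps(2) using ps(1) by (auto simp: tens_mult_list)
    next
      fix s t u assume "s \<in> carrier ?T" "t \<in> carrier ?T" "u \<in> carrier ?T"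
      then obtain ps rs us where
        "set ps \<subseteq> carrier A \<times> carrier A" "s = tens A ps"
        "set rs \<subseteq> carrier A \<times> carrier A" "t = tens A rs"
        "set us \<subseteq> carrier A \<times> carrier A" "u = tens A us"
        unfolding carr by blast
      then show "s \<otimes>\<^bsub>?T\<^esub> t \<otimes>\<^bsub>?T\<^esub> u = s \<otimes>\<^bsub>?T\<^esub> (t \<otimes>\<^bsub>?T\<^esub> u)"
        by (simp add: tens_mult_list list_mult_closed list_mult_assoc)
    qed (rule mult_closed)
  next
    fix s t u assume "s \<in> carrier ?T" "t \<in> carrier ?T" "u \<in> carrier ?T"
    then obtain ps rs us where l:
      "set ps \<subseteq> carrier A \<times> carrier A" "s = tens A ps"
      "set rs \<subseteq> carrier A \<times> carrier A" "t = tens A rs"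
      "set us \<subseteq> carrier A \<times> carrier A" "u = tens A us"
      unfolding carr by blast
    show "(s \<oplus>\<^bsub>?T\<^esub> t) \<otimes>\<^bsub>?T\<^esub> u = s \<otimes>\<^bsub>?T\<^esub> u \<oplus>\<^bsub>?T\<^esub> t \<otimes>\<^bsub>?T\<^esub> u"
      by (auto simp: tensor_alg_simps(2,5))
    have "s \<oplus>\<^bsub>?T\<^esub> t = tens A (ps @ rs)"
      by (simp add: tensor_alg_simps(5) tens_append l)
    then show "u \<otimes>\<^bsub>?T\<^esub> (s \<oplus>\<^bsub>?T\<^esub> t) = u \<otimes>\<^bsub>?T\<^esub> s \<oplus>\<^bsub>?T\<^esub> u \<otimes>\<^bsub>?T\<^esub> t"
      using l by (auto simp: tens_mult tensor_alg_simps(5) case_prod_unfold sum_list_addf)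
  qed
  then interpret T: ring ?T .
  show ?thesis
  proof unfold_locales
    fix s t c assume "s \<in> carrier ?T" "t \<in> carrier ?T"
    then obtain ps rs where l:
      "set ps \<subseteq> carrier A \<times> carrier A" "s = tens A ps"
      "set rs \<subseteq> carrier A \<times> carrier A" "t = tens A rs"
      unfolding carr by blast
    show "(c \<odot>\<^bsub>?T\<^esub> s) \<otimes>\<^bsub>?T\<^esub> t = c \<odot>\<^bsub>?T\<^esub> (s \<otimes>\<^bsub>?T\<^esub> t)"
      by (auto simp: tensor_alg_simps(2,6) fscale_def)
    have "c \<odot>\<^bsub>?T\<^esub> t = tens A (map (\<lambda>(x, y). (c \<odot> x, y)) rs)"
      using l by (simp add: tensor_alg_simps(6) tens_scale)
    moreover have "set (map (\<lambda>(x, y). (c \<odot> x, y)) rs) \<subseteq> carrier A \<times> carrier A"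
      using l by auto
    moreover have "(\<Sum>(x, y)\<leftarrow>ps. \<Sum>(x', y')\<leftarrow>map (\<lambda>(x, y). (c \<odot> x, y)) rs. \<beta> (x \<otimes> x') (y \<otimes> y'))
      = c * (\<Sum>(x, y)\<leftarrow>ps. \<Sum>(x', y')\<leftarrow>rs. \<beta> (x \<otimes> x') (y \<otimes> y'))" if \<beta>: "bilinear_form A \<beta>" for \<beta>
    proof -
      have "(\<Sum>(x', y')\<leftarrow>map (\<lambda>(x, y). (c \<odot> x, y)) rs. \<beta> (x \<otimes> x') (y \<otimes> y'))
        = c * (\<Sum>(x', y')\<leftarrow>rs. \<beta> (x \<otimes> x') (y \<otimes> y'))" if "x \<in> carrier A" "y \<in> carrier A" for x y
        using l(3) that
        by (induction rs) (auto simp: algebra_simps smult_mult_right bilinear_form_simps[OF \<beta>])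
      then show ?thesis
        using l(1) by (induction ps) (auto simp: algebra_simps)
    qed
    ultimately show "s \<otimes>\<^bsub>?T\<^esub> (c \<odot>\<^bsub>?T\<^esub> t) = c \<odot>\<^bsub>?T\<^esub> (s \<otimes>\<^bsub>?T\<^esub> t)"
      unfolding l(2,4) using l(1,3) by (simp add: tens_mult tensor_alg_simps(6) fscale_def fun_eq_iff)
  qed (auto simp: tensor_alg_simps(5,6) smult_closed fs.scale_left_distrib fs.scale_right_distrib)
qed

end

section \<open>The coproduct and the counit respect the relations\<close>

lemma (in complex_algebra) minus_eq_zero_iff:
  assumes "a \<in> carrier A" "b \<in> carrier A"
  shows "a \<ominus> b = \<zero> \<longleftrightarrow> a = b"
proof
  assume "a \<ominus> b = \<zero>"
  then show "a = b"
    using assms minus_equality[of a "\<ominus> b"] by (simp add: a_minus_def)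
qed (use assms in \<open>simp add: a_minus_def r_neg\<close>)

lemma (in complex_algebra) minus_plus_eq_zero_iff:
  assumes "a \<in> carrier A" "b \<in> carrier A" "d \<in> carrier A"
  shows "a \<ominus> b \<oplus> d = \<zero> \<longleftrightarrow> a \<oplus> d = b"
proof -
  have "a \<ominus> b \<oplus> d = (a \<oplus> d) \<ominus> b"
    using assms by (simp add: a_minus_def a_assoc a_comm a_lcomm)
  then show ?thesis
    using assms by (simp add: minus_eq_zero_iff)
qed

lemma (in complex_algebra) minus_minus_eq_zero_iff:
  assumes "a \<in> carrier A" "b \<in> carrier A" "d \<in> carrier A"
  shows "a \<ominus> b \<ominus> d = \<zero> \<longleftrightarrow> a = b \<oplus> d"
proof -
  have "a \<ominus> b \<ominus> d = a \<ominus> (b \<oplus> d)"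
    using assms by (simp add: a_minus_def a_assoc minus_add)
  then show ?thesis
    using assms by (simp add: minus_eq_zero_iff)
qed

text \<open>
  Families of elements of an algebra which satisfy the defining relations; both the generators and
  their coproducts are of this kind.
\<close>

locale uq_family = complex_algebra B for B :: "(complex, 'b, 'm) module_scheme" (structure) +
  fixes n :: nat and q :: real and g :: "gen \<Rightarrow> 'b"
  assumes gen_closed: "x \<in> gens n \<Longrightarrow> g x \<in> carrier B"
    and KK: "i \<in> {1..n} \<Longrightarrow> j \<in> {1..n} \<Longrightarrow> g (gK i) \<otimes> g (gK j) = g (gK j) \<otimes> g (gK i)"
    and KKi: "i \<in> {1..n} \<Longrightarrow> g (gK i) \<otimes> g (gKi i) = \<one>"
    and KiK: "i \<in> {1..n} \<Longrightarrow> g (gKi i) \<otimes> g (gK i) = \<one>"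
    and KE: "i \<in> {1..n} \<Longrightarrow> j \<in> {1..n} \<Longrightarrow>
      g (gK i) \<otimes> g (gE j) = complex_of_real (q powi cartan i j) \<odot> (g (gE j) \<otimes> g (gK i))"
    and KF: "i \<in> {1..n} \<Longrightarrow> j \<in> {1..n} \<Longrightarrow>
      g (gK i) \<otimes> g (gF j) = complex_of_real (q powi (- cartan i j)) \<odot> (g (gF j) \<otimes> g (gK i))"
    and EF: "i \<in> {1..n} \<Longrightarrow> j \<in> {1..n} \<Longrightarrow>
      g (gE i) \<otimes> g (gF j) = g (gF j) \<otimes> g (gE i) \<oplus>
        (if i = j then complex_of_real (1 / (q - inverse q)) \<odot> (g (gK i) \<ominus> g (gKi i)) else \<zero>)"
    and serreE: "i \<in> {1..n} \<Longrightarrow> j \<in> {1..n} \<Longrightarrow> i = j + 1 \<or> j = i + 1 \<Longrightarrow>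
      g (gE i) \<otimes> g (gE i) \<otimes> g (gE j) \<oplus> g (gE j) \<otimes> g (gE i) \<otimes> g (gE i) =
        complex_of_real (q + inverse q) \<odot> (g (gE i) \<otimes> g (gE j) \<otimes> g (gE i))"
    and serreF: "i \<in> {1..n} \<Longrightarrow> j \<in> {1..n} \<Longrightarrow> i = j + 1 \<or> j = i + 1 \<Longrightarrow>
      g (gF i) \<otimes> g (gF i) \<otimes> g (gF j) \<oplus> g (gF j) \<otimes> g (gF i) \<otimes> g (gF i) =
        complex_of_real (q + inverse q) \<odot> (g (gF i) \<otimes> g (gF j) \<otimes> g (gF i))"
    and commE: "i \<in> {1..n} \<Longrightarrow> j \<in> {1..n} \<Longrightarrow> i > j + 1 \<or> j > i + 1 \<Longrightarrow>
      g (gE i) \<otimes> g (gE j) = g (gE j) \<otimes> g (gE i)"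
    and commF: "i \<in> {1..n} \<Longrightarrow> j \<in> {1..n} \<Longrightarrow> i > j + 1 \<or> j > i + 1 \<Longrightarrow>
      g (gF i) \<otimes> g (gF j) = g (gF j) \<otimes> g (gF i)"

locale free_alg_hom = algebra_hom "free_alg n" B h
  for n :: nat and B :: "(complex, 'b, 'm) module_scheme" and h
begin

lemma h_add: "p \<in> carrier (free_alg n) \<Longrightarrow> r \<in> carrier (free_alg n) \<Longrightarrow> h (p + r) = h p \<oplus>\<^bsub>B\<^esub> h r"
  using hom_add by simp

lemma h_mult: "p \<in> carrier (free_alg n) \<Longrightarrow> r \<in> carrier (free_alg n) \<Longrightarrow> h (p * r) = h p \<otimes>\<^bsub>B\<^esub> h r"
  using hom_mult by simp

lemma h_const: "h (const c) = c \<odot>\<^bsub>B\<^esub> \<one>\<^bsub>B\<^esub>"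
  using hom_smult[of 1 c] hom_one by (simp add: free_alg_one)

lemma h_one: "h 1 = \<one>\<^bsub>B\<^esub>"
  using hom_one by simp

lemma h_zero: "h 0 = \<zero>\<^bsub>B\<^esub>"
  using hom_zero by simp

lemma h_minus:
  assumes "p \<in> carrier (free_alg n)" "r \<in> carrier (free_alg n)"
  shows "h (p - r) = h p \<ominus>\<^bsub>B\<^esub> h r"
proof -
  have "\<ominus>\<^bsub>free_alg n\<^esub> r = - r"
    using assms by (intro dom.minus_equality) (auto simp: free_alg_uminus)
  then show ?thesis
    using hom_minus[OF assms] by (simp add: a_minus_def)
qed

lemma h_var: "x \<in> gens n \<Longrightarrow> h (var x) \<in> carrier B"
  by (simp add: hom_closed free_alg_var)

lemmas h_simps = h_add h_mult h_const h_one h_zero h_minus h_var free_alg_closed free_alg_minus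
  cod.smult_mult_left mult.assoc

text \<open>
  An algebra homomorphism on the free algebra annihilates the encoded relations if and only if the
  images of the variables satisfy them; this direction serves to construct homomorphisms on the
  quotient, the other one to compute in it.
\<close>

lemma uq_family_imp_kills:
  assumes fam: "uq_family B n q (\<lambda>x. h (var x))" and r: "r \<in> uq_rels n q"
  shows "h r = \<zero>\<^bsub>B\<^esub>"
proof -
  interpret uq_family B n q "\<lambda>x. h (var x)" by fact
  show ?thesis
    using r
  proof cases
    case (EF i j)
    then show ?thesis
      using uq_family.EF[OF fam EF(2,3)]
      by (simp add: h_simps cod.minus_minus_eq_zero_iff)
  next
    case (serreE i j)
    then show ?thesis
      using uq_family.serreE[OF fam serreE(2-4)]
      by (simp add: h_simps cod.minus_plus_eq_zero_iff cod.m_assoc)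
  next
    case (serreF i j)
    then show ?thesis
      using uq_family.serreF[OF fam serreF(2-4)]
      by (simp add: h_simps cod.minus_plus_eq_zero_iff cod.m_assoc)
  next
    case (commE i j)
    then show ?thesis
      using uq_family.commE[OF fam commE(2-4)] by (simp add: h_simps cod.minus_eq_zero_iff)
  next
    case (commF i j)
    then show ?thesis
      using uq_family.commF[OF fam commF(2-4)] by (simp add: h_simps cod.minus_eq_zero_iff)
  next
    case (KK i j)
    then show ?thesis
      using uq_family.KK[OF fam KK(2,3)] by (simp add: h_simps cod.minus_eq_zero_iff)
  qed (simp_all add: h_simps KKi KiK KE KF cod.minus_eq_zero_iff)
qed

lemma kills_imp_uq_family:
  assumes kills: "\<And>r. r \<in> uq_rels n q \<Longrightarrow> h r = \<zero>\<^bsub>B\<^esub>"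
  shows "uq_family B n q (\<lambda>x. h (var x))"
proof unfold_locales
  fix i j assume i: "i \<in> {1..n}" and j: "j \<in> {1..n}"
  note [simp] = h_simps cod.minus_eq_zero_iff cod.minus_minus_eq_zero_iff cod.minus_plus_eq_zero_iff
    cod.m_assoc
  note ij = i j i[simplified] j[simplified]
  show "h (var (gK i)) \<otimes>\<^bsub>B\<^esub> h (var (gK j)) = h (var (gK j)) \<otimes>\<^bsub>B\<^esub> h (var (gK i))"
    using kills[OF uq_rels.KK[OF i j]] ij by simp
  show "h (var (gK i)) \<otimes>\<^bsub>B\<^esub> h (var (gE j)) =
      complex_of_real (q powi cartan i j) \<odot>\<^bsub>B\<^esub> (h (var (gE j)) \<otimes>\<^bsub>B\<^esub> h (var (gK i)))"
    using kills[OF uq_rels.KE[OF i j]] ij by simp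
  show "h (var (gK i)) \<otimes>\<^bsub>B\<^esub> h (var (gF j)) =
      complex_of_real (q powi (- cartan i j)) \<odot>\<^bsub>B\<^esub> (h (var (gF j)) \<otimes>\<^bsub>B\<^esub> h (var (gK i)))"
    using kills[OF uq_rels.KF[OF i j]] ij by simp
  show "h (var (gE i)) \<otimes>\<^bsub>B\<^esub> h (var (gF j)) = h (var (gF j)) \<otimes>\<^bsub>B\<^esub> h (var (gE i)) \<oplus>\<^bsub>B\<^esub>
      (if i = j then complex_of_real (1 / (q - inverse q)) \<odot>\<^bsub>B\<^esub>
        (h (var (gK i)) \<ominus>\<^bsub>B\<^esub> h (var (gKi i))) else \<zero>\<^bsub>B\<^esub>)"
    using kills[OF uq_rels.EF[OF i j]] ij by (simp del: cod.minus_eq_zero_iff split: if_splits)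
  show "h (var (gE i)) \<otimes>\<^bsub>B\<^esub> h (var (gE i)) \<otimes>\<^bsub>B\<^esub> h (var (gE j)) \<oplus>\<^bsub>B\<^esub>
      h (var (gE j)) \<otimes>\<^bsub>B\<^esub> h (var (gE i)) \<otimes>\<^bsub>B\<^esub> h (var (gE i)) =
      complex_of_real (q + inverse q) \<odot>\<^bsub>B\<^esub>
        (h (var (gE i)) \<otimes>\<^bsub>B\<^esub> h (var (gE j)) \<otimes>\<^bsub>B\<^esub> h (var (gE i)))" if "i = j + 1 \<or> j = i + 1"
    using kills[OF uq_rels.serreE[OF i j that]] ij by simp
  show "h (var (gF i)) \<otimes>\<^bsub>B\<^esub> h (var (gF i)) \<otimes>\<^bsub>B\<^esub> h (var (gF j)) \<oplus>\<^bsub>B\<^esub>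
      h (var (gF j)) \<otimes>\<^bsub>B\<^esub> h (var (gF i)) \<otimes>\<^bsub>B\<^esub> h (var (gF i)) =
      complex_of_real (q + inverse q) \<odot>\<^bsub>B\<^esub>
        (h (var (gF i)) \<otimes>\<^bsub>B\<^esub> h (var (gF j)) \<otimes>\<^bsub>B\<^esub> h (var (gF i)))" if "i = j + 1 \<or> j = i + 1"
    using kills[OF uq_rels.serreF[OF i j that]] ij by simp
  show "h (var (gE i)) \<otimes>\<^bsub>B\<^esub> h (var (gE j)) = h (var (gE j)) \<otimes>\<^bsub>B\<^esub> h (var (gE i))"
    if "i > j + 1 \<or> j > i + 1"
    using kills[OF uq_rels.commE[OF i j that]] ij by simp
  show "h (var (gF i)) \<otimes>\<^bsub>B\<^esub> h (var (gF j)) = h (var (gF j)) \<otimes>\<^bsub>B\<^esub> h (var (gF i))"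
    if "i > j + 1 \<or> j > i + 1"
    using kills[OF uq_rels.commF[OF i j that]] ij by simp
next
  fix i assume i: "i \<in> {1..n}"
  note [simp] = h_simps cod.minus_eq_zero_iff
  show "h (var (gK i)) \<otimes>\<^bsub>B\<^esub> h (var (gKi i)) = \<one>\<^bsub>B\<^esub>"
    using kills[OF uq_rels.KKi[OF i]] i by simp
  show "h (var (gKi i)) \<otimes>\<^bsub>B\<^esub> h (var (gK i)) = \<one>\<^bsub>B\<^esub>"
    using kills[OF uq_rels.KiK[OF i]] i by simp
qed (rule h_var)

end

lemma uq_family_uq_gen: "uq_family (uq_alg n q) n q (uq_gen n q)"
proof -
  interpret free_alg_hom n "uq_alg n q" "uq_proj n q"
    by (simp add: free_alg_hom_def uq_proj_hom)
  show ?thesis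
    using kills_imp_uq_family[of q] uq_proj_rel by (simp add: uq_proj_var)
qed

lemma (in uq_family)
  shows family_hom: "algebra_hom (uq_alg n q) B (induced_map B g)"
    and family_hom_gen: "x \<in> gens n \<Longrightarrow> induced_map B g (uq_gen n q x) = g x"
proof -
  have g: "g \<in> gens n \<rightarrow> carrier B"
    using gen_closed by blast
  interpret L: free_alg_hom n B "free_lift B g"
    unfolding free_alg_hom_def by (rule free_lift_hom[OF g])
  have "uq_family B n q (\<lambda>x. free_lift B g (var x))"
    by unfold_locales (simp_all only: free_lift_var[OF g] gens_iff,
      (rule gen_closed KK KKi KiK KE KF EF serreE serreF commE commF; assumption)+)
  then have kills: "free_lift B g r = \<zero>" if "r \<in> uq_rels n q" for r
    using L.uq_family_imp_kills that by blast
  show "algebra_hom (uq_alg n q) B (induced_map B g)"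
    by (rule induced_map_hom[OF complex_algebra_axioms g kills])
  show "x \<in> gens n \<Longrightarrow> induced_map B g (uq_gen n q x) = g x"
    by (rule induced_map_gen[OF complex_algebra_axioms g kills])
qed

lemma complex_algebra_complex_alg: "complex_algebra complex_alg"
proof -
  have "ring complex_alg"
  proof (rule ringI)
    show "abelian_group complex_alg"
    proof (rule abelian_groupI)
      show "\<exists>y\<in>carrier complex_alg. y \<oplus>\<^bsub>complex_alg\<^esub> x = \<zero>\<^bsub>complex_alg\<^esub>" for x
        by (rule bexI[of _ "- x"]) (simp_all add: complex_alg_def)
    qed (simp_all add: complex_alg_def)
    show "Group.monoid complex_alg"
      by (rule monoidI) (simp_all add: complex_alg_def)
  qed (simp_all add: complex_alg_def algebra_simps)
  then interpret ring complex_alg .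
  show ?thesis
    by unfold_locales (simp_all add: complex_alg_def algebra_simps)
qed

lemma uq_family_counit: "uq_family complex_alg n q uq_counit_gen"
proof -
  interpret complex_algebra complex_alg by (rule complex_algebra_complex_alg)
  have z: "\<zero>\<^bsub>complex_alg\<^esub> = 0" and s: "c \<odot>\<^bsub>complex_alg\<^esub> x = c * x"
    and o: "\<one>\<^bsub>complex_alg\<^esub> = 1"
    and p: "x \<oplus>\<^bsub>complex_alg\<^esub> y = x + y" and m: "x \<otimes>\<^bsub>complex_alg\<^esub> y = x * y"
    and c: "carrier complex_alg = UNIV" for c x y
    by (simp_all add: complex_alg_def)
  have d: "x \<ominus>\<^bsub>complex_alg\<^esub> x = 0" for x
    using minus_eq_zero_iff[of x x] by (simp add: z c)
  show ?thesis
    by unfold_locales (simp_all add: z s p m c o d)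
qed

text \<open>
  In algebras of functions with pointwise linear structure, such as the tensor square, an identity
  between linear combinations of monomials can be tested at each argument, where it becomes an identity
  of complex numbers.
\<close>

locale function_algebra = complex_algebra B for B :: "(complex, 'x \<Rightarrow> complex, 'm) module_scheme" (structure) +
  assumes add_fun: "x \<oplus> y = (\<lambda>t. x t + y t)" and smult_fun: "c \<odot> x = (\<lambda>t. c * x t)"
    and zero_fun: "\<zero> = (\<lambda>t. 0)"
begin

text \<open>
  If \<open>x, x'\<close> and \<open>y, y'\<close> satisfy the quantum Serre relation and commute with each other up to suitable
  powers of \<open>p\<close>, so do \<open>x + y, x' + y'\<close>: after moving \<open>x, x'\<close> to the left of \<open>y, y'\<close>, the coefficient of each
  mixed monomial vanishes, since it is a combination like \<open>1 + p\<^sup>2 - p (p + p\<^sup>-\<^sup>1)\<close>. The summands of the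
  coproducts of the \<open>E\<^sub>i\<close> are of this kind for \<open>p = q\<close>, those of the \<open>F\<^sub>i\<close> for \<open>p = q\<^sup>-\<^sup>1\<close>.
\<close>

lemma quantum_serre_sum:
  assumes [simp]: "x \<in> carrier B" "y \<in> carrier B" "x' \<in> carrier B" "y' \<in> carrier B"
    and p: "p \<noteq> 0"
    and yx: "x \<otimes> y = p\<^sup>2 \<odot> (y \<otimes> x)"
    and yx': "y \<otimes> x' = p \<odot> (x' \<otimes> y)" and xy': "y' \<otimes> x = p \<odot> (x \<otimes> y')"
    and sx: "x \<otimes> x \<otimes> x' \<oplus> x' \<otimes> x \<otimes> x = (p + 1 / p) \<odot> (x \<otimes> x' \<otimes> x)"
    and sy: "y \<otimes> y \<otimes> y' \<oplus> y' \<otimes> y \<otimes> y = (p + 1 / p) \<odot> (y \<otimes> y' \<otimes> y)"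
  shows "(x \<oplus> y) \<otimes> (x \<oplus> y) \<otimes> (x' \<oplus> y') \<oplus> (x' \<oplus> y') \<otimes> (x \<oplus> y) \<otimes> (x \<oplus> y) =
    (p + 1 / p) \<odot> ((x \<oplus> y) \<otimes> (x' \<oplus> y') \<otimes> (x \<oplus> y))"
proof -
  have yx_: "y \<otimes> x = (1 / p\<^sup>2) \<odot> (x \<otimes> y)"
    using p by (simp add: yx smult_assoc[symmetric])
  have left: "b \<otimes> (a \<otimes> z) = c \<odot> (a \<otimes> (b \<otimes> z))"
    if "b \<otimes> a = c \<odot> (a \<otimes> b)" "a \<in> carrier B" "b \<in> carrier B" "z \<in> carrier B" for a b c z
    using that by (metis m_assoc m_closed smult_mult_left)
  note order = yx_ yx' xy' left[OF yx_] left[OF yx'] left[OF xy']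
  show ?thesis
  proof
    fix t
    have sx': "(x' \<otimes> (x \<otimes> x)) t = (p + 1 / p) * (x \<otimes> (x' \<otimes> x)) t - (x \<otimes> (x \<otimes> x')) t"
      using fun_cong[OF sx, of t] by (simp add: m_assoc add_fun smult_fun eq_diff_eq add.commute)
    have sy': "(y' \<otimes> (y \<otimes> y)) t = (p + 1 / p) * (y \<otimes> (y' \<otimes> y)) t - (y \<otimes> (y \<otimes> y')) t"
      using fun_cong[OF sy, of t] by (simp add: m_assoc add_fun smult_fun eq_diff_eq add.commute)
    show "((x \<oplus> y) \<otimes> (x \<oplus> y) \<otimes> (x' \<oplus> y') \<oplus> (x' \<oplus> y') \<otimes> (x \<oplus> y) \<otimes> (x \<oplus> y)) t =
      ((p + 1 / p) \<odot> ((x \<oplus> y) \<otimes> (x' \<oplus> y') \<otimes> (x \<oplus> y))) t"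
      using p by (simp add: l_distr r_distr m_assoc order smult_mult_left smult_mult_right smult_r_distr
          smult_assoc[symmetric])
       (simp add: add_fun smult_fun sx' sy' field_simps power2_eq_square)
  qed
qed

end

context complex_algebra begin

lemma function_algebra_tensor_alg: "function_algebra (tensor_alg A)"
proof -
  interpret T: complex_algebra "tensor_alg A" by (rule complex_algebra_tensor_alg)
  show ?thesis
    by unfold_locales (auto simp: tensor_alg_simps(4-6) fscale_def)
qed

lemma pure_tensor_closed:
  "x \<in> carrier A \<Longrightarrow> y \<in> carrier A \<Longrightarrow> pure_tensor A x y \<in> carrier (tensor_alg A)"
  unfolding pure_tensor_eq_tens by (rule tens_closed) simp

lemma pure_tensor_addL:
  "x \<in> carrier A \<Longrightarrow> x' \<in> carrier A \<Longrightarrow> y \<in> carrier A \<Longrightarrow>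
    pure_tensor A (x \<oplus> x') y = pure_tensor A x y \<oplus>\<^bsub>tensor_alg A\<^esub> pure_tensor A x' y"
  by (auto simp: pure_tensor_def tensor_alg_simps(5) bilinear_form_simps)

lemma pure_tensor_addR:
  "x \<in> carrier A \<Longrightarrow> y \<in> carrier A \<Longrightarrow> y' \<in> carrier A \<Longrightarrow>
    pure_tensor A x (y \<oplus> y') = pure_tensor A x y \<oplus>\<^bsub>tensor_alg A\<^esub> pure_tensor A x y'"
  by (auto simp: pure_tensor_def tensor_alg_simps(5) bilinear_form_simps)

lemma pure_tensor_smultL:
  "x \<in> carrier A \<Longrightarrow> y \<in> carrier A \<Longrightarrow>
    pure_tensor A (c \<odot> x) y = c \<odot>\<^bsub>tensor_alg A\<^esub> pure_tensor A x y"
  by (auto simp: pure_tensor_def tensor_alg_simps(6) fscale_def bilinear_form_simps)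

lemma pure_tensor_smultR:
  "x \<in> carrier A \<Longrightarrow> y \<in> carrier A \<Longrightarrow>
    pure_tensor A x (c \<odot> y) = c \<odot>\<^bsub>tensor_alg A\<^esub> pure_tensor A x y"
  by (auto simp: pure_tensor_def tensor_alg_simps(6) fscale_def bilinear_form_simps)

lemma pure_tensor_zero:
  assumes "x \<in> carrier A"
  shows "pure_tensor A \<zero> x = \<zero>\<^bsub>tensor_alg A\<^esub>" "pure_tensor A x \<zero> = \<zero>\<^bsub>tensor_alg A\<^esub>"
  using pure_tensor_smultL[of \<zero> x 0] pure_tensor_smultR[of x \<zero> 0] assms
  by (simp_all add: tensor_alg_simps(4,6))

lemma minus_eq: "x \<in> carrier A \<Longrightarrow> y \<in> carrier A \<Longrightarrow> x \<ominus> y = x \<oplus> (- 1) \<odot> y"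
  by (simp add: a_minus_def smult_minus_one)

lemmas pure_tensor_simps = pure_tensor_mult pure_tensor_closed pure_tensor_addL pure_tensor_addR
  pure_tensor_smultL pure_tensor_smultR

lemma inverse_commutation:
  assumes "k \<in> carrier A" "k' \<in> carrier A" "x \<in> carrier A" and kk': "k \<otimes> k' = \<one>" and k'k: "k' \<otimes> k = \<one>"
    and c: "c \<noteq> 0" and kx: "k \<otimes> x = c \<odot> (x \<otimes> k)"
  shows "k' \<otimes> x = (1 / c) \<odot> (x \<otimes> k')"
proof -
  have "c \<odot> (k' \<otimes> x) = c \<odot> (k' \<otimes> (x \<otimes> (k \<otimes> k')))"
    using assms by simp
  also have "\<dots> = k' \<otimes> ((c \<odot> (x \<otimes> k)) \<otimes> k')"
    using assms(1-3) by (simp add: m_assoc smult_mult_left smult_mult_right)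
  also have "\<dots> = (k' \<otimes> k) \<otimes> (x \<otimes> k')"
    using assms(1-3) by (simp add: m_assoc flip: kx)
  finally have "c \<odot> (k' \<otimes> x) = x \<otimes> k'"
    using assms(1-3) k'k by simp
  then show ?thesis
    using c assms(1-3) smult_assoc[of "k' \<otimes> x" "1 / c" c] by simp
qed

text \<open>
  With a common second leg (and likewise with a common first leg), a three-term relation such as
  the Serre relation passes to pure tensors.
\<close>

lemma pure_tensor_relationL:
  assumes "a \<oplus> b = s \<odot> c" "a \<in> carrier A" "b \<in> carrier A" "c \<in> carrier A" "k \<in> carrier A"
  shows "pure_tensor A a k \<oplus>\<^bsub>tensor_alg A\<^esub> pure_tensor A b k = s \<odot>\<^bsub>tensor_alg A\<^esub> pure_tensor A c k"
  using assms by (simp flip: pure_tensor_addL pure_tensor_smultL)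

lemma pure_tensor_relationR:
  assumes "a \<oplus> b = s \<odot> c" "a \<in> carrier A" "b \<in> carrier A" "c \<in> carrier A" "k \<in> carrier A"
  shows "pure_tensor A k a \<oplus>\<^bsub>tensor_alg A\<^esub> pure_tensor A k b = s \<odot>\<^bsub>tensor_alg A\<^esub> pure_tensor A k c"
  using assms by (simp flip: pure_tensor_addR pure_tensor_smultR)

end

lemma cartan_sym: "cartan i j = cartan j i"
  by (auto simp: cartan_def)

locale uq_presentation =
  fixes n :: nat and q :: real
  assumes q_nonzero: "q \<noteq> 0"
begin

abbreviation "U \<equiv> uq_alg n q"
abbreviation "E i \<equiv> uq_gen n q (gE i)"
abbreviation "F i \<equiv> uq_gen n q (gF i)"
abbreviation "K i \<equiv> uq_gen n q (gK i)"
abbreviation "K' i \<equiv> uq_gen n q (gKi i)"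

sublocale U: uq_family "uq_alg n q" n q "uq_gen n q"
  by (rule uq_family_uq_gen)

sublocale T: function_algebra "tensor_alg (uq_alg n q)"
  by (rule U.function_algebra_tensor_alg)

lemma gens_closed:
  assumes "i \<in> {1..n}"
  shows "E i \<in> carrier U" "F i \<in> carrier U" "K i \<in> carrier U" "K' i \<in> carrier U"
  using assms by (auto intro!: U.gen_closed)

text \<open>
  The parameter as a complex number. Being a constant, it is left alone by the simplification rules
  that push the coercion from the reals into \<open>q + q\<^sup>-\<^sup>1\<close>.
\<close>

definition qc :: complex where "qc = complex_of_real q"

lemma qc_nonzero: "qc \<noteq> 0"
  using q_nonzero by (simp add: qc_def)

lemma K'E:
  assumes "i \<in> {1..n}" "j \<in> {1..n}"
  shows "K' i \<otimes>\<^bsub>U\<^esub> E j = (1 / complex_of_real (q powi cartan i j)) \<odot>\<^bsub>U\<^esub> (E j \<otimes>\<^bsub>U\<^esub> K' i)"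
  by (rule U.inverse_commutation[OF _ _ _ U.KKi U.KiK _ U.KE])
    (use assms gens_closed q_nonzero in auto)

lemma K'F:
  assumes "i \<in> {1..n}" "j \<in> {1..n}"
  shows "K' i \<otimes>\<^bsub>U\<^esub> F j = complex_of_real (q powi cartan i j) \<odot>\<^bsub>U\<^esub> (F j \<otimes>\<^bsub>U\<^esub> K' i)"
proof -
  have "K' i \<otimes>\<^bsub>U\<^esub> F j = (1 / complex_of_real (q powi (- cartan i j))) \<odot>\<^bsub>U\<^esub> (F j \<otimes>\<^bsub>U\<^esub> K' i)"
    by (rule U.inverse_commutation[OF _ _ _ U.KKi U.KiK _ U.KF])
      (use assms gens_closed q_nonzero in auto)
  then show ?thesis
    by (simp add: power_int_minus divide_inverse)
qed

lemma K'K: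
  assumes "i \<in> {1..n}" "j \<in> {1..n}"
  shows "K' i \<otimes>\<^bsub>U\<^esub> K j = K j \<otimes>\<^bsub>U\<^esub> K' i"
  using U.inverse_commutation[OF _ _ _ U.KKi U.KiK, of i "K j" 1] U.KK[of i j] assms gens_closed by simp

lemma K'K':
  assumes "i \<in> {1..n}" "j \<in> {1..n}"
  shows "K' i \<otimes>\<^bsub>U\<^esub> K' j = K' j \<otimes>\<^bsub>U\<^esub> K' i"
  using U.inverse_commutation[OF _ _ _ U.KKi U.KiK, of i "K' j" 1] K'K[of j i] assms gens_closed by simp

abbreviation pt (infixl "\<boxtimes>" 75) where "x \<boxtimes> y \<equiv> pure_tensor U x y"

lemma uq_comult_gen_simps:
  "uq_comult_gen n q (gE i) = E i \<boxtimes> K i \<oplus>\<^bsub>tensor_alg U\<^esub> \<one>\<^bsub>U\<^esub> \<boxtimes> E i"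
  "uq_comult_gen n q (gF i) = F i \<boxtimes> \<one>\<^bsub>U\<^esub> \<oplus>\<^bsub>tensor_alg U\<^esub> K' i \<boxtimes> F i"
  "uq_comult_gen n q (gK i) = K i \<boxtimes> K i"
  "uq_comult_gen n q (gKi i) = K' i \<boxtimes> K' i"
  by (simp_all add: tensor_alg_simps(5))

lemma comult_serre:
  assumes i: "i \<in> {1..n}" and j: "j \<in> {1..n}" and ij: "i = j + 1 \<or> j = i + 1"
  defines "T \<equiv> tensor_alg U" and "\<Delta> \<equiv> uq_comult_gen n q"
  shows "\<Delta> (gE i) \<otimes>\<^bsub>T\<^esub> \<Delta> (gE i) \<otimes>\<^bsub>T\<^esub> \<Delta> (gE j) \<oplus>\<^bsub>T\<^esub> \<Delta> (gE j) \<otimes>\<^bsub>T\<^esub> \<Delta> (gE i) \<otimes>\<^bsub>T\<^esub> \<Delta> (gE i) =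
      complex_of_real (q + inverse q) \<odot>\<^bsub>T\<^esub> (\<Delta> (gE i) \<otimes>\<^bsub>T\<^esub> \<Delta> (gE j) \<otimes>\<^bsub>T\<^esub> \<Delta> (gE i))" (is ?E)
    and "\<Delta> (gF i) \<otimes>\<^bsub>T\<^esub> \<Delta> (gF i) \<otimes>\<^bsub>T\<^esub> \<Delta> (gF j) \<oplus>\<^bsub>T\<^esub> \<Delta> (gF j) \<otimes>\<^bsub>T\<^esub> \<Delta> (gF i) \<otimes>\<^bsub>T\<^esub> \<Delta> (gF i) =
      complex_of_real (q + inverse q) \<odot>\<^bsub>T\<^esub> (\<Delta> (gF i) \<otimes>\<^bsub>T\<^esub> \<Delta> (gF j) \<otimes>\<^bsub>T\<^esub> \<Delta> (gF i))" (is ?F)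
proof -
  note [simp] = gens_closed[OF i] gens_closed[OF j] U.pure_tensor_simps qc_nonzero
  have c: "cartan i i = 2" "cartan j j = 2" "cartan i j = - 1" "cartan j i = - 1"
    using ij by (auto simp: cartan_def)
  define s where "s = complex_of_real (q + inverse q)"
  have s: "qc + 1 / qc = s" "1 / qc + 1 / (1 / qc) = s"
    by (simp_all add: qc_def divide_inverse s_def)
  have KK: "K j \<otimes>\<^bsub>U\<^esub> K i = K i \<otimes>\<^bsub>U\<^esub> K j"
    by (rule U.KK[OF j i])
  then have KK': "K j \<otimes>\<^bsub>U\<^esub> (K i \<otimes>\<^bsub>U\<^esub> K i) = K i \<otimes>\<^bsub>U\<^esub> (K i \<otimes>\<^bsub>U\<^esub> K j)"
    by (metis U.m_assoc gens_closed(3) i j)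
  have inv: "K' j \<otimes>\<^bsub>U\<^esub> K' i = K' i \<otimes>\<^bsub>U\<^esub> K' j"
    by (rule K'K'[OF j i])
  then have inv': "K' j \<otimes>\<^bsub>U\<^esub> (K' i \<otimes>\<^bsub>U\<^esub> K' i) = K' i \<otimes>\<^bsub>U\<^esub> (K' i \<otimes>\<^bsub>U\<^esub> K' j)"
    by (metis U.m_assoc gens_closed(4) i j)
  have KE: "K i \<otimes>\<^bsub>U\<^esub> E i = qc\<^sup>2 \<odot>\<^bsub>U\<^esub> (E i \<otimes>\<^bsub>U\<^esub> K i)" "K i \<otimes>\<^bsub>U\<^esub> E j = (1 / qc) \<odot>\<^bsub>U\<^esub> (E j \<otimes>\<^bsub>U\<^esub> K i)"
    "K j \<otimes>\<^bsub>U\<^esub> E i = (1 / qc) \<odot>\<^bsub>U\<^esub> (E i \<otimes>\<^bsub>U\<^esub> K j)"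
    using U.KE[OF i i] U.KE[OF i j] U.KE[OF j i]
    by (simp_all add: c power_int_minus qc_def divide_inverse)
  have KF: "K' i \<otimes>\<^bsub>U\<^esub> F i = qc\<^sup>2 \<odot>\<^bsub>U\<^esub> (F i \<otimes>\<^bsub>U\<^esub> K' i)" "K' i \<otimes>\<^bsub>U\<^esub> F j = (1 / qc) \<odot>\<^bsub>U\<^esub> (F j \<otimes>\<^bsub>U\<^esub> K' i)"
    "K' j \<otimes>\<^bsub>U\<^esub> F i = (1 / qc) \<odot>\<^bsub>U\<^esub> (F i \<otimes>\<^bsub>U\<^esub> K' j)"
    using K'F[OF i i] K'F[OF i j] K'F[OF j i]
    by (simp_all add: c power_int_minus qc_def divide_inverse)
  have serre:
    "E i \<otimes>\<^bsub>U\<^esub> (E i \<otimes>\<^bsub>U\<^esub> E j) \<oplus>\<^bsub>U\<^esub> E j \<otimes>\<^bsub>U\<^esub> (E i \<otimes>\<^bsub>U\<^esub> E i) = s \<odot>\<^bsub>U\<^esub> (E i \<otimes>\<^bsub>U\<^esub> (E j \<otimes>\<^bsub>U\<^esub> E i))"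
    "F i \<otimes>\<^bsub>U\<^esub> (F i \<otimes>\<^bsub>U\<^esub> F j) \<oplus>\<^bsub>U\<^esub> F j \<otimes>\<^bsub>U\<^esub> (F i \<otimes>\<^bsub>U\<^esub> F i) = s \<odot>\<^bsub>U\<^esub> (F i \<otimes>\<^bsub>U\<^esub> (F j \<otimes>\<^bsub>U\<^esub> F i))"
    using U.serreE[OF i j ij, folded s_def] U.serreF[OF i j ij, folded s_def]
    by (simp_all add: U.m_assoc)
  show ?E
    unfolding s_def[symmetric] s(1)[symmetric] uq_comult_gen_simps T_def \<Delta>_def
    by (rule T.quantum_serre_sum, unfold s)
      (simp_all add: KE KK KK' U.m_assoc U.smult_assoc[symmetric] T.smult_assoc[symmetric]
        serre U.pure_tensor_relationL U.pure_tensor_relationR)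
  show ?F
    unfolding s_def[symmetric] s(2)[symmetric] uq_comult_gen_simps T_def \<Delta>_def
    by (rule T.quantum_serre_sum, unfold s)
      (simp_all add: KF inv inv' U.m_assoc power_divide U.smult_assoc[symmetric] T.smult_assoc[symmetric]
        serre U.pure_tensor_relationL U.pure_tensor_relationR)
qed

lemma uq_family_comult: "uq_family (tensor_alg U) n q (uq_comult_gen n q)"
proof unfold_locales
  fix x assume "x \<in> gens n"
  then show "uq_comult_gen n q x \<in> carrier (tensor_alg U)"
    by (cases x) (simp_all only: uq_comult_gen_simps gens_iff gens_closed U.pure_tensor_closed
        T.add.m_closed U.one_closed)
next
  fix i assume i: "i \<in> {1..n}"
  note [simp] = gens_closed[OF i] U.pure_tensor_simps
  show "uq_comult_gen n q (gK i) \<otimes>\<^bsub>tensor_alg U\<^esub> uq_comult_gen n q (gKi i) = \<one>\<^bsub>tensor_alg U\<^esub>"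
    "uq_comult_gen n q (gKi i) \<otimes>\<^bsub>tensor_alg U\<^esub> uq_comult_gen n q (gK i) = \<one>\<^bsub>tensor_alg U\<^esub>"
    unfolding uq_comult_gen_simps using U.KKi[OF i] U.KiK[OF i] by (simp_all add: tensor_alg_simps(3))
next
  fix i j assume i: "i \<in> {1..n}" and j: "j \<in> {1..n}"
  note [simp] = gens_closed[OF i] gens_closed[OF j] U.pure_tensor_simps T.l_distr T.r_distr
    T.smult_r_distr
  have KK: "K j \<otimes>\<^bsub>U\<^esub> K i = K i \<otimes>\<^bsub>U\<^esub> K j"
    by (rule U.KK[OF j i])
  note KE = U.KE[OF i j] and KF = U.KF[OF i j]
  show "uq_comult_gen n q (gK i) \<otimes>\<^bsub>tensor_alg U\<^esub> uq_comult_gen n q (gK j) =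
      uq_comult_gen n q (gK j) \<otimes>\<^bsub>tensor_alg U\<^esub> uq_comult_gen n q (gK i)"
    unfolding uq_comult_gen_simps by (simp add: KK)
  show "uq_comult_gen n q (gK i) \<otimes>\<^bsub>tensor_alg U\<^esub> uq_comult_gen n q (gE j) =
      complex_of_real (q powi cartan i j) \<odot>\<^bsub>tensor_alg U\<^esub>
        (uq_comult_gen n q (gE j) \<otimes>\<^bsub>tensor_alg U\<^esub> uq_comult_gen n q (gK i))"
    unfolding uq_comult_gen_simps by (simp add: KK KE)
  show "uq_comult_gen n q (gK i) \<otimes>\<^bsub>tensor_alg U\<^esub> uq_comult_gen n q (gF j) =
      complex_of_real (q powi (- cartan i j)) \<odot>\<^bsub>tensor_alg U\<^esub>
        (uq_comult_gen n q (gF j) \<otimes>\<^bsub>tensor_alg U\<^esub> uq_comult_gen n q (gK i))"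
    unfolding uq_comult_gen_simps using K'K[OF j i] by (simp add: KF)
  show "uq_comult_gen n q (gE i) \<otimes>\<^bsub>tensor_alg U\<^esub> uq_comult_gen n q (gF j) =
      uq_comult_gen n q (gF j) \<otimes>\<^bsub>tensor_alg U\<^esub> uq_comult_gen n q (gE i) \<oplus>\<^bsub>tensor_alg U\<^esub>
        (if i = j then complex_of_real (1 / (q - inverse q)) \<odot>\<^bsub>tensor_alg U\<^esub>
          (uq_comult_gen n q (gK i) \<ominus>\<^bsub>tensor_alg U\<^esub> uq_comult_gen n q (gKi i)) else \<zero>\<^bsub>tensor_alg U\<^esub>)"
  proof -
    \<comment> \<open>The mixed terms \<open>E\<^sub>i K\<^sub>j\<^sup>-\<^sup>1 \<otimes> K\<^sub>i F\<^sub>j\<close> and \<open>K\<^sub>j\<^sup>-\<^sup>1 E\<^sub>i \<otimes> F\<^sub>j K\<^sub>i\<close> agree, as the powers of \<open>q\<close> that arise from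
      reordering the two legs are inverse to each other; they enter with opposite signs.\<close>
    define c where "c = complex_of_real (1 / (q - inverse q))"
    define d where "d = complex_of_real (q powi cartan i j)"
    have d: "d \<noteq> 0"
      using q_nonzero by (simp add: d_def)
    have K'E: "K' j \<otimes>\<^bsub>U\<^esub> E i = (1 / d) \<odot>\<^bsub>U\<^esub> (E i \<otimes>\<^bsub>U\<^esub> K' j)"
      using K'E[OF j i] by (simp add: d_def cartan_sym)
    have KF: "K i \<otimes>\<^bsub>U\<^esub> F j = (1 / d) \<odot>\<^bsub>U\<^esub> (F j \<otimes>\<^bsub>U\<^esub> K i)"
      using KF by (simp add: d_def power_int_minus divide_inverse)
    show ?thesis
      unfolding uq_comult_gen_simps c_def[symmetric]
      using d U.EF[OF i j, folded c_def]
      by (intro ext) (simp add: K'E KF U.minus_eq T.minus_eq U.smult_r_distr U.pure_tensor_zero,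
        simp add: T.add_fun T.smult_fun T.zero_fun U.smult_assoc[symmetric] T.smult_assoc[symmetric] algebra_simps)
  qed
  show "uq_comult_gen n q (gE i) \<otimes>\<^bsub>tensor_alg U\<^esub> uq_comult_gen n q (gE j) =
      uq_comult_gen n q (gE j) \<otimes>\<^bsub>tensor_alg U\<^esub> uq_comult_gen n q (gE i)" if ij: "i > j + 1 \<or> j > i + 1"
  proof -
    have "cartan i j = 0" "cartan j i = 0"
      using ij by (auto simp: cartan_def)
    then show ?thesis
      unfolding uq_comult_gen_simps
      using U.KE[OF i j] U.KE[OF j i] U.commE[OF i j ij] by (simp add: KK T.a_assoc T.a_comm T.a_lcomm)
  qed
  show "uq_comult_gen n q (gF i) \<otimes>\<^bsub>tensor_alg U\<^esub> uq_comult_gen n q (gF j) =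
      uq_comult_gen n q (gF j) \<otimes>\<^bsub>tensor_alg U\<^esub> uq_comult_gen n q (gF i)" if ij: "i > j + 1 \<or> j > i + 1"
  proof -
    have "cartan i j = 0" "cartan j i = 0"
      using ij by (auto simp: cartan_def)
    then show ?thesis
      unfolding uq_comult_gen_simps
      using K'F[OF i j] K'F[OF j i] U.commF[OF i j ij] K'K'[OF i j] by (simp add: T.a_assoc T.a_comm T.a_lcomm)
  qed
qed (rule comult_serre; assumption)+

end

section \<open>Coproducts of root vectors\<close>

context complex_algebra begin

lemma qcomm_eq:
  "x \<in> carrier A \<Longrightarrow> y \<in> carrier A \<Longrightarrow> qcomm A c x y = x \<otimes> y \<oplus> (- c) \<odot> (y \<otimes> x)"
  by (simp add: qcomm_def minus_eq smult_assoc[symmetric])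

lemma qcomm_closed: "x \<in> carrier A \<Longrightarrow> y \<in> carrier A \<Longrightarrow> qcomm A c x y \<in> carrier A"
  by (simp add: qcomm_eq)

lemma qcomm_add:
  "x \<in> carrier A \<Longrightarrow> y \<in> carrier A \<Longrightarrow> z \<in> carrier A \<Longrightarrow>
    qcomm A c x (y \<oplus> z) = qcomm A c x y \<oplus> qcomm A c x z"
  by (simp add: qcomm_eq l_distr r_distr smult_r_distr a_assoc a_comm a_lcomm)

lemma commutation_mult:
  assumes "k \<in> carrier A" "x \<in> carrier A" "y \<in> carrier A"
    and kx: "k \<otimes> x = c \<odot> (x \<otimes> k)" and ky: "k \<otimes> y = d \<odot> (y \<otimes> k)"
  shows "k \<otimes> (x \<otimes> y) = (c * d) \<odot> (x \<otimes> y \<otimes> k)"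
proof -
  have "k \<otimes> (x \<otimes> y) = c \<odot> (x \<otimes> (k \<otimes> y))"
    using assms(1-3) by (simp add: m_assoc[symmetric] kx smult_mult_left)
  then show ?thesis
    using assms(1-3) by (simp add: ky smult_mult_right m_assoc smult_assoc)
qed

lemma commutation_qcomm:
  assumes "k \<in> carrier A" "x \<in> carrier A" "y \<in> carrier A"
    and kx: "k \<otimes> x = c \<odot> (x \<otimes> k)" and ky: "k \<otimes> y = d \<odot> (y \<otimes> k)"
  shows "k \<otimes> qcomm A e x y = (c * d) \<odot> (qcomm A e x y \<otimes> k)"
  using commutation_mult[OF assms(1-3) kx ky] commutation_mult[OF assms(1,3,2) ky kx] assms(1-3)
  by (simp add: qcomm_eq r_distr l_distr smult_mult_left smult_mult_right smult_r_distr mult.commute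
      mult.left_commute flip: smult_assoc)

text \<open>
  The q-commutator of \<open>e \<otimes> k + 1 \<otimes> e\<close> with \<open>z \<otimes> y\<close> only acts on the second leg, provided that \<open>e\<close>
  commutes with \<open>z\<close> and that the factor picked up by moving \<open>k\<close> past \<open>y\<close> is the deformation parameter.
\<close>

lemma qcomm_pure_tensor:
  assumes "e \<in> carrier A" "k \<in> carrier A" "z \<in> carrier A" "y \<in> carrier A"
    and ez: "e \<otimes> z = z \<otimes> e" and ky: "k \<otimes> y = c \<odot> (y \<otimes> k)"
  shows "qcomm (tensor_alg A) c (pure_tensor A e k \<oplus>\<^bsub>tensor_alg A\<^esub> pure_tensor A \<one> e) (pure_tensor A z y)
    = pure_tensor A z (qcomm A c e y)"
proof -
  interpret T: function_algebra "tensor_alg A" by (rule function_algebra_tensor_alg)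
  show ?thesis
    using assms(1-4)
    by (intro ext) (simp add: T.qcomm_eq qcomm_eq pure_tensor_simps T.l_distr T.r_distr T.smult_r_distr ez ky,
      simp add: T.add_fun T.smult_fun algebra_simps)
qed

text \<open>
  If \<open>k\<close> and \<open>y\<close> commute, the same expansion produces the q-commutator in each of the two legs.
\<close>

lemma qcomm_pure_tensor_commuting:
  assumes "e \<in> carrier A" "k \<in> carrier A" "z \<in> carrier A" "y \<in> carrier A"
    and ky: "k \<otimes> y = y \<otimes> k"
  shows "qcomm (tensor_alg A) c (pure_tensor A e k \<oplus>\<^bsub>tensor_alg A\<^esub> pure_tensor A \<one> e) (pure_tensor A z y)
    = pure_tensor A (qcomm A c e z) (k \<otimes> y) \<oplus>\<^bsub>tensor_alg A\<^esub> pure_tensor A z (qcomm A c e y)"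
proof -
  interpret T: function_algebra "tensor_alg A" by (rule function_algebra_tensor_alg)
  show ?thesis
    using assms(1-4)
    by (intro ext) (simp add: T.qcomm_eq qcomm_eq pure_tensor_simps T.l_distr T.r_distr T.smult_r_distr ky,
      simp add: T.add_fun T.smult_fun algebra_simps)
qed

end

lemma (in algebra_hom) hom_qcomm:
  assumes "x \<in> carrier A" "y \<in> carrier A"
  shows "h (qcomm A c x y) = qcomm B c (h x) (h y)"
  using assms by (simp add: dom.qcomm_eq cod.qcomm_eq hom_add hom_mult hom_smult hom_closed)

context uq_presentation begin

abbreviation "\<Delta> \<equiv> comult (uq n q)"

sublocale Delta: algebra_hom "uq_alg n q" "tensor_alg (uq_alg n q)" "comult (uq n q)"
  using uq_family.family_hom[OF uq_family_comult] by simp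

lemma Delta_tens:
  assumes "X \<in> carrier U"
  obtains ps where "set ps \<subseteq> carrier U \<times> carrier U" "\<Delta> X = tens U ps"
  using Delta.hom_closed[OF assms] unfolding U.tensor_alg_carrier by blast

lemma Delta_gen: "x \<in> gens n \<Longrightarrow> \<Delta> (uq_gen n q x) = uq_comult_gen n q x"
  using uq_family.family_hom_gen[OF uq_family_comult] by simp

lemma counit_hom: "algebra_hom U complex_alg (counit (uq n q))"
  using uq_family.family_hom[OF uq_family_counit] by simp

lemma counit_gen: "x \<in> gens n \<Longrightarrow> counit (uq n q) (uq_gen n q x) = uq_counit_gen x"
  using uq_family.family_hom_gen[OF uq_family_counit] by simp

abbreviation "qi \<equiv> inverse (complex_of_real q)"

abbreviation "R j i \<equiv> root_vec n q j i"

lemma qcomm_uq: "x \<in> carrier U \<Longrightarrow> y \<in> carrier U \<Longrightarrow> qcomm (uq n q) c x y = qcomm U c x y"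
  using complex_algebra.qcomm_eq[OF complex_algebra_uq, of x n q y c] by (simp add: U.qcomm_eq)

lemma root_vec_closed:
  assumes "1 \<le> i" "i < j" "j \<le> n + 1"
  shows "R j i \<in> carrier U"
  using assms(2,3)
proof (induction j)
  case (Suc j)
  show ?case
  proof (cases "j = i")
    case False
    then show ?thesis
      using Suc assms(1) U.qcomm_closed gens_closed(1)[of j] by (simp add: qcomm_uq)
  qed (use Suc assms(1) in \<open>simp add: gens_closed\<close>)
qed simp

lemma root_vec_step:
  assumes "1 \<le> i" "i < j" "j \<le> n"
  shows "R (Suc j) i = qcomm U qi (E j) (R j i)"
  using assms root_vec_closed[of i j] gens_closed(1)[of j] by (simp add: qcomm_uq)

lemma E_root_vec_commute:
  assumes "1 \<le> i" "i < j" "j < m" "m \<le> n"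
  shows "E m \<otimes>\<^bsub>U\<^esub> R j i = R j i \<otimes>\<^bsub>U\<^esub> E m"
  using assms(2,3)
proof (induction j)
  case (Suc j)
  show ?case
  proof (cases "j = i")
    case True
    then show ?thesis
      using Suc.prems assms U.commE[of m j] by simp
  next
    case False
    have j: "j \<in> {1..n}" and m: "m \<in> {1..n}" and c: "R j i \<in> carrier U"
      using False Suc.prems assms by (auto intro: root_vec_closed)
    have "E m \<otimes>\<^bsub>U\<^esub> E j = 1 \<odot>\<^bsub>U\<^esub> (E j \<otimes>\<^bsub>U\<^esub> E m)" "E m \<otimes>\<^bsub>U\<^esub> R j i = 1 \<odot>\<^bsub>U\<^esub> (R j i \<otimes>\<^bsub>U\<^esub> E m)"
      using False Suc assms j m c U.commE[of m j] gens_closed by simp_all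
    from U.commutation_qcomm[OF gens_closed(1)[OF m] gens_closed(1)[OF j] c this, of qi]
    show ?thesis
      using False Suc.prems assms c gens_closed(1)[OF m] gens_closed(1)[OF j]
      by (simp add: qcomm_uq U.qcomm_closed)
  qed
qed simp

lemma K_commute_E:
  assumes "m \<in> {1..n}" "j \<in> {1..n}" "j < m"
  shows "K m \<otimes>\<^bsub>U\<^esub> E j = (if m = Suc j then qi else 1) \<odot>\<^bsub>U\<^esub> (E j \<otimes>\<^bsub>U\<^esub> K m)"
  using U.KE[OF assms(1,2)] assms by (auto simp: cartan_def power_int_minus)

text \<open>
  The first and the second legs which occur in the coproduct of \<open>E\<^sub>j\<^sub>i\<close>, apart from the leading
  summand. Second legs have pairing \<open>-1\<close> with the coroot of index \<open>j\<close> and 0 with all later ones; for \<open>j = n + 1\<close>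
  there is no such coroot and the condition is void.
\<close>

definition lower_legs :: "nat \<Rightarrow> nat \<Rightarrow> falg set set" where
  "lower_legs j i = insert \<one>\<^bsub>U\<^esub> {R k i | k. i < k \<and> k < j}"

definition weight_space :: "nat \<Rightarrow> falg set set" where
  "weight_space j = {y \<in> carrier U. (j \<le> n \<longrightarrow> K j \<otimes>\<^bsub>U\<^esub> y = qi \<odot>\<^bsub>U\<^esub> (y \<otimes>\<^bsub>U\<^esub> K j)) \<and>
     (\<forall>m\<in>{j<..n}. K m \<otimes>\<^bsub>U\<^esub> y = y \<otimes>\<^bsub>U\<^esub> K m)}"

text \<open>
  Of the generators \<open>K\<^sub>m\<close> with \<open>m > j\<close>, only \<open>K\<^sub>j\<^sub>+\<^sub>1\<close> notices the new letter \<open>E\<^sub>j\<close>.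
\<close>

lemma weight_space_qcomm:
  assumes j: "j \<in> {1..n}" and y: "y \<in> carrier U" "\<And>m. m \<in> {j<..n} \<Longrightarrow> K m \<otimes>\<^bsub>U\<^esub> y = y \<otimes>\<^bsub>U\<^esub> K m"
  shows "qcomm U qi (E j) y \<in> weight_space (Suc j)"
proof -
  have "K m \<otimes>\<^bsub>U\<^esub> qcomm U qi (E j) y = (if m = Suc j then qi else 1) \<odot>\<^bsub>U\<^esub> (qcomm U qi (E j) y \<otimes>\<^bsub>U\<^esub> K m)"
    if m: "m \<in> {j<..n}" for m
  proof -
    have m': "m \<in> {1..n}" "j < m" using m by auto
    have "K m \<otimes>\<^bsub>U\<^esub> y = 1 \<odot>\<^bsub>U\<^esub> (y \<otimes>\<^bsub>U\<^esub> K m)"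
      using y m m' gens_closed by simp
    from U.commutation_qcomm[OF gens_closed(3)[OF m'(1)] gens_closed(1)[OF j] y(1) K_commute_E[OF m'(1) j m'(2)] this]
    show ?thesis by simp
  qed
  from this[of "Suc j"] this show ?thesis
    using j y gens_closed(1)[OF j] gens_closed(3)
    by (auto simp: weight_space_def U.qcomm_closed)
qed

text \<open>
  The claim about \<open>\<kappa>\<close> includes \<open>m = j\<close>, so that \<open>\<kappa>\<close> commutes with \<open>K\<^sub>j\<close>; this distinguishes the leading
  summand, to which \<open>qcomm_pure_tensor_commuting\<close> applies, from the other ones, which fall under
  \<open>qcomm_pure_tensor\<close>.
\<close>

lemma Delta_root_vec:
  assumes "1 \<le> i" "i < j" "j \<le> n + 1"
  shows "\<exists>\<kappa> ps. \<Delta> (R j i) = tens U ((R j i, \<kappa>) # ps) \<and> \<kappa> \<in> carrier U \<and>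
    (\<forall>m\<in>{j..n}. K m \<otimes>\<^bsub>U\<^esub> \<kappa> = \<kappa> \<otimes>\<^bsub>U\<^esub> K m) \<and> set ps \<subseteq> lower_legs j i \<times> weight_space j"
  using assms(2,3)
proof (induction j)
  case (Suc j)
  have j: "j \<in> {1..n}"
    using Suc.prems assms by auto
  note cl = gens_closed[OF j]
  have Delta_E: "\<Delta> (E j) = E j \<boxtimes> K j \<oplus>\<^bsub>tensor_alg U\<^esub> \<one>\<^bsub>U\<^esub> \<boxtimes> E j"
    using Delta_gen[of "gE j"] j by (simp add: uq_comult_gen_simps del: uq_comult_gen.simps)
  show ?case
  proof (cases "j = i")
    case True
    have "\<Delta> (R (Suc j) i) = tens U [(R (Suc j) i, K j), (\<one>\<^bsub>U\<^esub>, E j)]"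
      using Delta_E True tens_append[of U "[(E j, K j)]" "[(\<one>\<^bsub>U\<^esub>, E j)]"]
      by (simp add: pure_tensor_eq_tens tensor_alg_simps(5) del: uq_simps)
    moreover have "K m \<otimes>\<^bsub>U\<^esub> K j = K j \<otimes>\<^bsub>U\<^esub> K m" if "m \<in> {Suc j..n}" for m
      using that j by (intro U.KK) auto
    moreover have "E j \<in> weight_space (Suc j)"
      using j K_commute_E[of _ j] cl gens_closed(3) by (auto simp: weight_space_def)
    ultimately show ?thesis
      using cl by (intro exI[of _ "K j"] exI[of _ "[(\<one>\<^bsub>U\<^esub>, E j)]"]) (auto simp: lower_legs_def)
  next
    case False
    then have ij: "i < j" "j \<le> n"
      using Suc.prems by auto
    let ?T = "tensor_alg U"
    obtain \<kappa> ps where D: "\<Delta> (R j i) = tens U ((R j i, \<kappa>) # ps)"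
      and \<kappa>: "\<kappa> \<in> carrier U" "\<And>m. m \<in> {j..n} \<Longrightarrow> K m \<otimes>\<^bsub>U\<^esub> \<kappa> = \<kappa> \<otimes>\<^bsub>U\<^esub> K m"
      and ps: "set ps \<subseteq> lower_legs j i \<times> weight_space j"
      using Suc.IH ij Suc.prems by auto
    have Rj: "R j i \<in> carrier U"
      using ij assms by (intro root_vec_closed) auto
    have R_legs: "R k i \<in> carrier U" "E j \<otimes>\<^bsub>U\<^esub> R k i = R k i \<otimes>\<^bsub>U\<^esub> E j" if "i < k" "k < j" for k
      using root_vec_closed[of i k] E_root_vec_commute[of i k j] that ij assms(1) by simp_all
    have legs: "z \<in> carrier U" "E j \<otimes>\<^bsub>U\<^esub> z = z \<otimes>\<^bsub>U\<^esub> E j" if "z \<in> lower_legs j i" for z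
      using that R_legs cl by (auto simp: lower_legs_def simp del: root_vec.simps)
    have ps_closed: "set ps \<subseteq> carrier U \<times> carrier U"
      using ps legs by (auto simp: weight_space_def)
    define ps' where "ps' = map (\<lambda>(z, y). (z, qcomm U qi (E j) y)) ps"
    have rest: "qcomm ?T qi (\<Delta> (E j)) (tens U ps) = tens U ps'"
      using ps ps_closed unfolding ps'_def
    proof (induction ps)
      case Nil
      have "qcomm ?T qi (\<Delta> (E j)) \<zero>\<^bsub>?T\<^esub> = \<zero>\<^bsub>?T\<^esub>"
        using Delta.hom_closed[OF cl(1)] by (simp add: T.qcomm_eq del: uq_simps)
      then show ?case unfolding list.map tens_Nil tensor_alg_simps(4) .
    next
      case (Cons p ps)
      obtain z y where p: "p = (z, y)" by force
      have z: "z \<in> lower_legs j i" and y: "y \<in> weight_space j"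
        using Cons.prems p by auto
      have y': "y \<in> carrier U" "K j \<otimes>\<^bsub>U\<^esub> y = qi \<odot>\<^bsub>U\<^esub> (y \<otimes>\<^bsub>U\<^esub> K j)"
        using y ij by (auto simp: weight_space_def)
      have app: "tens U (r # rs) = tens U [r] \<oplus>\<^bsub>?T\<^esub> tens U rs" for r rs
        using tens_append[of U "[r]" rs] by (simp add: tensor_alg_simps(5))
      have "qcomm ?T qi (\<Delta> (E j)) (z \<boxtimes> y) = z \<boxtimes> qcomm U qi (E j) y"
        unfolding Delta_E by (rule U.qcomm_pure_tensor[OF cl(1,3) legs(1)[OF z] y'(1) legs(2)[OF z] y'(2)])
      moreover have "qcomm ?T qi (\<Delta> (E j)) (tens U ps) = tens U (map (\<lambda>(z, y). (z, qcomm U qi (E j) y)) ps)"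
        using Cons by auto
      ultimately show ?case
        using Delta.hom_closed[OF cl(1)] legs(1)[OF z] y' Cons.prems U.tens_closed
        by (simp add: p app[of "(z, y)" ps] app[of "(z, qcomm U qi (E j) y)" "map _ ps"] T.qcomm_add
            U.pure_tensor_closed flip: pure_tensor_eq_tens del: uq_simps)
    qed
    have top: "qcomm ?T qi (\<Delta> (E j)) (R j i \<boxtimes> \<kappa>) =
        R (Suc j) i \<boxtimes> (K j \<otimes>\<^bsub>U\<^esub> \<kappa>) \<oplus>\<^bsub>?T\<^esub> R j i \<boxtimes> qcomm U qi (E j) \<kappa>"
      unfolding Delta_E root_vec_step[OF assms(1) ij]
      using ij by (intro U.qcomm_pure_tensor_commuting) (auto simp: cl Rj \<kappa>)
    have "\<Delta> (R (Suc j) i) = qcomm ?T qi (\<Delta> (E j)) (\<Delta> (R j i))"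
      unfolding root_vec_step[OF assms(1) ij] by (rule Delta.hom_qcomm[OF cl(1) Rj])
    also have "\<Delta> (R j i) = R j i \<boxtimes> \<kappa> \<oplus>\<^bsub>?T\<^esub> tens U ps"
      unfolding D using tens_append[of U "[(R j i, \<kappa>)]" ps]
      by (simp add: tensor_alg_simps(5) pure_tensor_eq_tens)
    also have "qcomm ?T qi (\<Delta> (E j)) \<dots> =
        R (Suc j) i \<boxtimes> (K j \<otimes>\<^bsub>U\<^esub> \<kappa>) \<oplus>\<^bsub>?T\<^esub> R j i \<boxtimes> qcomm U qi (E j) \<kappa> \<oplus>\<^bsub>?T\<^esub> tens U ps'"
      using Delta.hom_closed[OF cl(1)] Rj \<kappa>(1) ps_closed
      by (simp add: T.qcomm_add top rest U.pure_tensor_closed U.tens_closed del: uq_simps)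
    also have "\<dots> = tens U ((R (Suc j) i, K j \<otimes>\<^bsub>U\<^esub> \<kappa>) # (R j i, qcomm U qi (E j) \<kappa>) # ps')"
      unfolding pure_tensor_eq_tens tensor_alg_simps(5) tens_append[symmetric] by simp
    finally have *: "\<Delta> (R (Suc j) i) =
        tens U ((R (Suc j) i, K j \<otimes>\<^bsub>U\<^esub> \<kappa>) # (R j i, qcomm U qi (E j) \<kappa>) # ps')" .
    have "K m \<otimes>\<^bsub>U\<^esub> (K j \<otimes>\<^bsub>U\<^esub> \<kappa>) = K j \<otimes>\<^bsub>U\<^esub> \<kappa> \<otimes>\<^bsub>U\<^esub> K m" if m: "m \<in> {Suc j..n}" for m
    proof -
      have m': "m \<in> {1..n}" using m j by auto
      have "K m \<otimes>\<^bsub>U\<^esub> K j = 1 \<odot>\<^bsub>U\<^esub> (K j \<otimes>\<^bsub>U\<^esub> K m)" "K m \<otimes>\<^bsub>U\<^esub> \<kappa> = 1 \<odot>\<^bsub>U\<^esub> (\<kappa> \<otimes>\<^bsub>U\<^esub> K m)"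
        using U.KK[OF m' j] \<kappa>(2)[of m] \<kappa>(1) m gens_closed(3)[OF m'] cl by simp_all
      from U.commutation_mult[OF gens_closed(3)[OF m'] cl(3) \<kappa>(1) this] show ?thesis
        using \<kappa>(1) gens_closed(3)[OF m'] cl by simp
    qed
    moreover have "qcomm U qi (E j) \<kappa> \<in> weight_space (Suc j)"
      using \<kappa> by (intro weight_space_qcomm[OF j]) auto
    moreover have "set ps' \<subseteq> lower_legs (Suc j) i \<times> weight_space (Suc j)"
    proof -
      have "qcomm U qi (E j) y \<in> weight_space (Suc j)" if "y \<in> weight_space j" for y
        using that by (intro weight_space_qcomm[OF j]) (auto simp: weight_space_def)
      moreover have "lower_legs j i \<subseteq> lower_legs (Suc j) i"
        by (auto simp: lower_legs_def)
      ultimately show ?thesis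
        using ps by (auto simp: ps'_def)
    qed
    moreover have "R j i \<in> lower_legs (Suc j) i"
      using ij by (auto simp: lower_legs_def)
    ultimately show ?thesis
      using * \<kappa>(1) cl
      by (intro exI[of _ "K j \<otimes>\<^bsub>U\<^esub> \<kappa>"] exI[of _ "(R j i, qcomm U qi (E j) \<kappa>) # ps'"])
        (auto simp del: uq_simps root_vec.simps)
  qed
qed simp

end

section \<open>Tensor products of representations\<close>

text \<open>
  The Kronecker product: the basis of the tensor product is numbered by \<open>(a, b) \<mapsto> a e + b\<close>, where
  \<open>e\<close> is the dimension of the second factor.
\<close>

definition kron :: "complex mat \<Rightarrow> complex mat \<Rightarrow> complex mat" where
  "kron A B = mat (dim_row A * dim_row B) (dim_col A * dim_col B)
     (\<lambda>(i, j). A $$ (i div dim_row B, j div dim_col B) * B $$ (i mod dim_row B, j mod dim_col B))"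

definition kron_vec :: "complex vec \<Rightarrow> complex vec \<Rightarrow> complex vec" where
  "kron_vec u v = vec (dim_vec u * dim_vec v) (\<lambda>i. u $ (i div dim_vec v) * v $ (i mod dim_vec v))"

lemma sum_div_mod:
  fixes f :: "nat \<Rightarrow> nat \<Rightarrow> 'a :: comm_monoid_add"
  shows "(\<Sum>k<d * e. f (k div e) (k mod e)) = (\<Sum>a<d. \<Sum>b<e. f a b)"
proof -
  have "bij_betw (\<lambda>k. (k div e, k mod e)) {..<d * e} ({..<d} \<times> {..<e})"
  proof (rule bij_betwI[where g = "\<lambda>(a, b). a * e + b"])
    show "(\<lambda>k. (k div e, k mod e)) \<in> {..<d * e} \<rightarrow> {..<d} \<times> {..<e}"
      by (cases "e = 0") (auto simp: less_mult_imp_div_less)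
    have "a * e + b < d * e" if "a < d" "b < e" for a b
    proof -
      have "a * e + b < Suc a * e" using that by simp
      also have "\<dots> \<le> d * e" using that by (intro mult_le_mono1) simp
      finally show ?thesis .
    qed
    then show "(\<lambda>(a, b). a * e + b) \<in> {..<d} \<times> {..<e} \<rightarrow> {..<d * e}"
      by auto
  qed (auto simp: less_mult_imp_div_less)
  from sum.reindex_bij_betw[OF this, of "\<lambda>(a, b). f a b"] show ?thesis
    by (simp add: sum.cartesian_product)
qed

lemma div_mod_less: "k < d * e \<Longrightarrow> k div e < d \<and> k mod e < (e :: nat)"
  by (cases "e = 0") (auto simp: less_mult_imp_div_less)

lemma kron_carrier: "A \<in> carrier_mat r c \<Longrightarrow> B \<in> carrier_mat r' c' \<Longrightarrow> kron A B \<in> carrier_mat (r * r') (c * c')"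
  by (auto simp: kron_def)

lemma kron_index:
  "A \<in> carrier_mat r c \<Longrightarrow> B \<in> carrier_mat r' c' \<Longrightarrow> i < r * r' \<Longrightarrow> j < c * c' \<Longrightarrow>
    kron A B $$ (i, j) = A $$ (i div r', j div c') * B $$ (i mod r', j mod c')"
  by (auto simp: kron_def)

lemma kron_vec_carrier: "u \<in> carrier_vec d \<Longrightarrow> v \<in> carrier_vec e \<Longrightarrow> kron_vec u v \<in> carrier_vec (d * e)"
  by (auto simp: kron_vec_def)

lemma kron_vec_index:
  "u \<in> carrier_vec d \<Longrightarrow> v \<in> carrier_vec e \<Longrightarrow> k < d * e \<Longrightarrow> kron_vec u v $ k = u $ (k div e) * v $ (k mod e)"
  by (auto simp: kron_vec_def)

lemma scalar_prod_sum: "v \<in> carrier_vec d \<Longrightarrow> u \<bullet> v = (\<Sum>k<d. u $ k * v $ k)"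
  by (auto simp: scalar_prod_def atLeast0LessThan)

lemma mult_mat_vec_index:
  "A \<in> carrier_mat r c \<Longrightarrow> v \<in> carrier_vec c \<Longrightarrow> i < r \<Longrightarrow> (A *\<^sub>v v) $ i = (\<Sum>k<c. A $$ (i, k) * v $ k)"
  by (auto simp: scalar_prod_def atLeast0LessThan intro!: sum.cong)

lemma mult_mat_index:
  "A \<in> carrier_mat r m \<Longrightarrow> B \<in> carrier_mat m c \<Longrightarrow> i < r \<Longrightarrow> j < c \<Longrightarrow>
    (A * B) $$ (i, j) = (\<Sum>k<m. A $$ (i, k) * B $$ (k, j))"
  by (auto simp: scalar_prod_def atLeast0LessThan intro!: sum.cong)

lemma scalar_prod_kron_vec:
  assumes "u \<in> carrier_vec d" "w \<in> carrier_vec d" "u' \<in> carrier_vec e" "w' \<in> carrier_vec e"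
  shows "kron_vec u u' \<bullet> kron_vec w w' = (u \<bullet> w) * (u' \<bullet> w')"
proof -
  have "kron_vec u u' \<bullet> kron_vec w w' =
      (\<Sum>k<d * e. (u $ (k div e) * u' $ (k mod e)) * (w $ (k div e) * w' $ (k mod e)))"
    using assms by (simp add: scalar_prod_sum[OF kron_vec_carrier] kron_vec_index)
  also have "\<dots> = (\<Sum>a<d. \<Sum>b<e. (u $ a * u' $ b) * (w $ a * w' $ b))"
    by (rule sum_div_mod)
  also have "\<dots> = (\<Sum>a<d. u $ a * w $ a) * (\<Sum>b<e. u' $ b * w' $ b)"
    by (simp add: sum_product algebra_simps)
  finally show ?thesis
    using assms by (simp add: scalar_prod_sum)
qed

lemma kron_mult_vec:
  assumes A: "A \<in> carrier_mat d d'" and B: "B \<in> carrier_mat e e'"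
    and v: "v \<in> carrier_vec d'" and w: "w \<in> carrier_vec e'"
  shows "kron A B *\<^sub>v kron_vec v w = kron_vec (A *\<^sub>v v) (B *\<^sub>v w)"
proof (rule eq_vecI)
  note c = kron_carrier[OF A B] kron_vec_carrier[OF v w]
  have c': "A *\<^sub>v v \<in> carrier_vec d" "B *\<^sub>v w \<in> carrier_vec e"
    using assms by auto
  fix i assume "i < dim_vec (kron_vec (A *\<^sub>v v) (B *\<^sub>v w))"
  then have i: "i < d * e"
    using kron_vec_carrier[OF c'] by simp
  note i' = conjunct1[OF div_mod_less[OF i]] conjunct2[OF div_mod_less[OF i]]
  have "(kron A B *\<^sub>v kron_vec v w) $ i = (\<Sum>k<d' * e'.
      (A $$ (i div e, k div e') * B $$ (i mod e, k mod e')) * (v $ (k div e') * w $ (k mod e')))"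
    using i by (simp add: mult_mat_vec_index[OF c] kron_index[OF A B] kron_vec_index[OF v w])
  also have "\<dots> = (\<Sum>a<d'. \<Sum>b<e'. (A $$ (i div e, a) * B $$ (i mod e, b)) * (v $ a * w $ b))"
    by (rule sum_div_mod)
  also have "\<dots> = (\<Sum>a<d'. A $$ (i div e, a) * v $ a) * (\<Sum>b<e'. B $$ (i mod e, b) * w $ b)"
    by (simp add: sum_product algebra_simps)
  finally show "(kron A B *\<^sub>v kron_vec v w) $ i = kron_vec (A *\<^sub>v v) (B *\<^sub>v w) $ i"
    using i i' by (simp add: kron_vec_index[OF c'] mult_mat_vec_index[OF A v] mult_mat_vec_index[OF B w])
qed (use assms in \<open>simp_all add: kron_def kron_vec_def\<close>)

lemma kron_mult:
  assumes A: "A \<in> carrier_mat d d'" and B: "B \<in> carrier_mat e e'"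
    and C: "C \<in> carrier_mat d' d''" and D: "D \<in> carrier_mat e' e''"
  shows "kron A B * kron C D = kron (A * C) (B * D)"
proof (rule eq_matI)
  have AC: "A * C \<in> carrier_mat d d''" and BD: "B * D \<in> carrier_mat e e''"
    using assms by auto
  fix i j assume "i < dim_row (kron (A * C) (B * D))" "j < dim_col (kron (A * C) (B * D))"
  then have i: "i < d * e" and j: "j < d'' * e''"
    using kron_carrier[OF AC BD] by auto
  note ij = div_mod_less[OF i] div_mod_less[OF j]
  have "(kron A B * kron C D) $$ (i, j) = (\<Sum>k<d' * e'. (A $$ (i div e, k div e') * B $$ (i mod e, k mod e'))
      * (C $$ (k div e', j div e'') * D $$ (k mod e', j mod e'')))"
    using i j by (simp add: mult_mat_index[OF kron_carrier[OF A B] kron_carrier[OF C D]]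
        kron_index[OF A B] kron_index[OF C D])
  also have "\<dots> = (\<Sum>a<d'. \<Sum>b<e'. (A $$ (i div e, a) * B $$ (i mod e, b))
      * (C $$ (a, j div e'') * D $$ (b, j mod e'')))"
    by (rule sum_div_mod)
  also have "\<dots> = (\<Sum>a<d'. A $$ (i div e, a) * C $$ (a, j div e'')) *
      (\<Sum>b<e'. B $$ (i mod e, b) * D $$ (b, j mod e''))"
    by (simp add: sum_product algebra_simps)
  finally show "(kron A B * kron C D) $$ (i, j) = kron (A * C) (B * D) $$ (i, j)"
    using i j ij by (simp add: kron_index[OF AC BD] mult_mat_index[OF A C] mult_mat_index[OF B D])
qed (use assms in \<open>simp_all add: kron_def\<close>)

lemma kron_one: "kron (1\<^sub>m d) (1\<^sub>m e) = 1\<^sub>m (d * e)"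
proof (rule eq_matI)
  fix i j assume "i < dim_row (1\<^sub>m (d * e) :: complex mat)" "j < dim_col (1\<^sub>m (d * e) :: complex mat)"
  then have ij: "i < d * e" "j < d * e" by auto
  have "i = j \<longleftrightarrow> i div e = j div e \<and> i mod e = j mod e"
    by (metis div_mult_mod_eq)
  then show "kron (1\<^sub>m d) (1\<^sub>m e) $$ (i, j) = 1\<^sub>m (d * e) $$ (i, j)"
    using ij div_mod_less[OF ij(1)] div_mod_less[OF ij(2)]
    by (auto simp: kron_index[OF one_carrier_mat one_carrier_mat])
qed (simp_all add: kron_def)

lemma invertible_kron:
  assumes P: "P \<in> carrier_mat d d" "invertible_mat P" and Q: "Q \<in> carrier_mat e e" "invertible_mat Q"
  shows "invertible_mat (kron P Q)"
proof -
  obtain P' where P': "P * P' = 1\<^sub>m d" "P' * P = 1\<^sub>m (dim_row P')"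
    using P by (auto simp: invertible_mat_def inverts_mat_def)
  obtain Q' where Q': "Q * Q' = 1\<^sub>m e" "Q' * Q = 1\<^sub>m (dim_row Q')"
    using Q by (auto simp: invertible_mat_def inverts_mat_def)
  have cP: "P' \<in> carrier_mat d d"
    using arg_cong[OF P'(1), of dim_col] arg_cong[OF P'(2), of dim_col] P by auto
  have cQ: "Q' \<in> carrier_mat e e"
    using arg_cong[OF Q'(1), of dim_col] arg_cong[OF Q'(2), of dim_col] Q by auto
  have "kron P Q * kron P' Q' = 1\<^sub>m (d * e)" "kron P' Q' * kron P Q = 1\<^sub>m (d * e)"
    using P' Q' cP cQ by (simp_all add: kron_mult[OF P(1) Q(1) cP cQ] kron_mult[OF cP cQ P(1) Q(1)] kron_one)
  then show ?thesis
    using kron_carrier[OF P(1) Q(1)] kron_carrier[OF cP cQ]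
    unfolding invertible_mat_def inverts_mat_def by (auto intro!: exI[of _ "kron P' Q'"])
qed

lemma col_kron:
  assumes P: "P \<in> carrier_mat d d'" and Q: "Q \<in> carrier_mat e e'" and k: "k < d' * e'"
  shows "col (kron P Q) k = kron_vec (col P (k div e')) (col Q (k mod e'))"
proof (rule eq_vecI)
  have c: "col P (k div e') \<in> carrier_vec d" "col Q (k mod e') \<in> carrier_vec e"
    using P Q by auto
  fix i assume "i < dim_vec (kron_vec (col P (k div e')) (col Q (k mod e')))"
  then have i: "i < d * e"
    using kron_vec_carrier[OF c] by simp
  then show "col (kron P Q) k $ i = kron_vec (col P (k div e')) (col Q (k mod e')) $ i"
    using k P Q div_mod_less[OF i] div_mod_less[OF k] kron_carrier[OF P Q]
    by (simp add: kron_vec_index[OF c] kron_index[OF P Q])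
qed (use P Q in \<open>simp add: kron_def kron_vec_def\<close>)

lemma scalar_prod_mult_mat_vec:
  assumes "A \<in> carrier_mat d d" "v \<in> carrier_vec d"
  shows "u \<bullet> (A *\<^sub>v v) = (\<Sum>k<d. \<Sum>l<d. u $ k * A $$ (k, l) * v $ l)"
  using assms by (simp add: scalar_prod_sum[of _ d] mult_mat_vec_index[OF assms] sum_distrib_left mult.assoc
      del: index_mult_mat_vec)

section \<open>The coordinate algebra is closed under multiplication\<close>

lemma linear_dual_subspace:
  assumes "\<And>x y. x \<in> carrier V \<Longrightarrow> y \<in> carrier V \<Longrightarrow> x \<oplus>\<^bsub>V\<^esub> y \<in> carrier V"
    "\<And>c x. x \<in> carrier V \<Longrightarrow> c \<odot>\<^bsub>V\<^esub> x \<in> carrier V"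
  shows "fsubspace (linear_dual V)"
  by (rule fs.subspaceI)
    (auto simp: linear_dual_def linear_form_def fscale_def algebra_simps)

lemma bilinear_form_product:
  assumes "linear_form V f" "linear_form V g"
  shows "bilinear_form V (\<lambda>x y. f x * g y)"
  using assms by (auto simp: bilinear_form_def linear_form_def algebra_simps)

locale matrix_rep = complex_algebra A for A :: "(complex, 'a, 'm) module_scheme" (structure) +
  fixes d :: nat and \<rho> :: "'a \<Rightarrow> complex mat"
  assumes rep_hom: "\<rho> \<in> Ring.ring_hom A (ring_mat TYPE(complex) d ())"
    and rep_smult: "x \<in> carrier A \<Longrightarrow> \<rho> (c \<odot> x) = c \<cdot>\<^sub>m \<rho> x"
begin

lemma rep_carrier: "x \<in> carrier A \<Longrightarrow> \<rho> x \<in> carrier_mat d d"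
  using ring_hom_closed[OF rep_hom] by (simp add: ring_mat_simps)

lemma rep_add: "x \<in> carrier A \<Longrightarrow> y \<in> carrier A \<Longrightarrow> \<rho> (x \<oplus> y) = \<rho> x + \<rho> y"
  using ring_hom_add[OF rep_hom] by (simp add: ring_mat_simps)

lemma rep_mult: "x \<in> carrier A \<Longrightarrow> y \<in> carrier A \<Longrightarrow> \<rho> (x \<otimes> y) = \<rho> x * \<rho> y"
  using ring_hom_mult[OF rep_hom] by (simp add: ring_mat_simps)

lemma rep_one: "\<rho> \<one> = 1\<^sub>m d"
  using ring_hom_one[OF rep_hom] by (simp add: ring_mat_simps)

lemma rep_entry_linear: "i < d \<Longrightarrow> j < d \<Longrightarrow> linear_form A (\<lambda>x. \<rho> x $$ (i, j))"
  by (simp add: linear_form_def rep_add rep_smult carrier_matD[OF rep_carrier])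

lemma rep_coeff_linear:
  assumes "u \<in> carrier_vec d" "v \<in> carrier_vec d"
  shows "linear_form A (\<lambda>x. u \<bullet> (\<rho> x *\<^sub>v v))"
proof -
  have "linear_form A (\<lambda>x. \<Sum>k<d. \<Sum>l<d. u $ k * \<rho> x $$ (k, l) * v $ l)"
    using rep_entry_linear unfolding linear_form_def
    by (simp add: algebra_simps sum.distrib sum_distrib_left)
  then show ?thesis
    using scalar_prod_mult_mat_vec[OF rep_carrier assms(2)]
    by (simp add: linear_form_def)
qed

end

text \<open>
  The tensor product of two representations \<open>\<rho>\<close> and \<open>\<sigma>\<close> along \<open>\<Delta>\<close>. Its matrix entries are the values of
  \<open>\<Delta>(X)\<close> at the bilinear forms \<open>entry k l\<close>, which are the entries of \<open>\<rho>(x) \<otimes> \<sigma>(y)\<close>; working with forms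
  avoids choosing legs of \<open>\<Delta>(X)\<close>.
\<close>

locale rep_pair = uq_presentation n q + \<rho>: matrix_rep "uq_alg n q" d \<rho> + \<sigma>: matrix_rep "uq_alg n q" e \<sigma>
  for n q d \<rho> e \<sigma>
begin

definition entry :: "nat \<Rightarrow> nat \<Rightarrow> falg set \<Rightarrow> falg set \<Rightarrow> complex" where
  "entry k l x y = \<rho> x $$ (k div e, l div e) * \<sigma> y $$ (k mod e, l mod e)"

definition tensor_rep :: "falg set \<Rightarrow> complex mat" where
  "tensor_rep X = mat (d * e) (d * e) (\<lambda>(k, l). \<Delta> X (entry k l))"

lemma entry_bilinear: "k < d * e \<Longrightarrow> l < d * e \<Longrightarrow> bilinear_form U (entry k l)"
  unfolding entry_def[abs_def]
  by (intro bilinear_form_product \<rho>.rep_entry_linear \<sigma>.rep_entry_linear) (auto dest: div_mod_less)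

lemma entry_kron:
  "x \<in> carrier U \<Longrightarrow> y \<in> carrier U \<Longrightarrow> k < d * e \<Longrightarrow> l < d * e \<Longrightarrow> entry k l x y = kron (\<rho> x) (\<sigma> y) $$ (k, l)"
  by (simp add: entry_def kron_index[OF \<rho>.rep_carrier \<sigma>.rep_carrier])

lemma tensor_rep_carrier: "tensor_rep X \<in> carrier_mat (d * e) (d * e)"
  by (simp add: tensor_rep_def)

lemma tensor_rep_index: "k < d * e \<Longrightarrow> l < d * e \<Longrightarrow> tensor_rep X $$ (k, l) = \<Delta> X (entry k l)"
  by (simp add: tensor_rep_def)

lemma entry_mult:
  assumes "x \<in> carrier U" "y \<in> carrier U" "x' \<in> carrier U" "y' \<in> carrier U" "k < d * e" "l < d * e"
  shows "entry k l (x \<otimes>\<^bsub>U\<^esub> x') (y \<otimes>\<^bsub>U\<^esub> y') = (\<Sum>m<d * e. entry k m x y * entry m l x' y')"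
proof -
  note c = \<rho>.rep_carrier[OF assms(1)] \<sigma>.rep_carrier[OF assms(2)]
    and c' = \<rho>.rep_carrier[OF assms(3)] \<sigma>.rep_carrier[OF assms(4)]
  have "entry k l (x \<otimes>\<^bsub>U\<^esub> x') (y \<otimes>\<^bsub>U\<^esub> y') = (kron (\<rho> x) (\<sigma> y) * kron (\<rho> x') (\<sigma> y')) $$ (k, l)"
    using assms by (simp add: entry_kron \<rho>.rep_mult \<sigma>.rep_mult kron_mult[OF c c'])
  also have "\<dots> = (\<Sum>m<d * e. entry k m x y * entry m l x' y')"
    using assms by (simp add: mult_mat_index[OF kron_carrier[OF c] kron_carrier[OF c']] entry_kron)
  finally show ?thesis .
qed

lemma tensor_rep_mult:
  assumes "X \<in> carrier U" "Y \<in> carrier U"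
  shows "tensor_rep (X \<otimes>\<^bsub>U\<^esub> Y) = tensor_rep X * tensor_rep Y"
proof (rule eq_matI)
  obtain ps where ps: "set ps \<subseteq> carrier U \<times> carrier U" "\<Delta> X = tens U ps"
    using assms Delta_tens by blast
  obtain rs where rs: "set rs \<subseteq> carrier U \<times> carrier U" "\<Delta> Y = tens U rs"
    using assms Delta_tens by blast
  fix k l assume "k < dim_row (tensor_rep X * tensor_rep Y)" "l < dim_col (tensor_rep X * tensor_rep Y)"
  then have kl: "k < d * e" "l < d * e"
    by (simp_all add: tensor_rep_def)
  have "tensor_rep (X \<otimes>\<^bsub>U\<^esub> Y) $$ (k, l) = (\<Delta> X \<otimes>\<^bsub>tensor_alg U\<^esub> \<Delta> Y) (entry k l)"
    using Delta.hom_mult[OF assms] kl by (simp add: tensor_rep_index del: uq_simps)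
  also have "\<dots> = (\<Sum>(x, y)\<leftarrow>ps. \<Sum>(x', y')\<leftarrow>rs. entry k l (x \<otimes>\<^bsub>U\<^esub> x') (y \<otimes>\<^bsub>U\<^esub> y'))"
    using ps rs entry_bilinear[OF kl] by (simp add: U.tens_mult del: uq_simps)
  also have "\<dots> = (\<Sum>(x, y)\<leftarrow>ps. \<Sum>(x', y')\<leftarrow>rs. \<Sum>m<d * e. entry k m x y * entry m l x' y')"
    using ps(1) rs(1)
    by (intro arg_cong[of _ _ sum_list] map_cong)
      (auto intro!: arg_cong[of _ _ sum_list] entry_mult[OF _ _ _ _ kl])
  also have "\<dots> = (\<Sum>m<d * e. (\<Sum>(x, y)\<leftarrow>ps. entry k m x y) * (\<Sum>(x', y')\<leftarrow>rs. entry m l x' y'))"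
  proof -
    have "(\<Sum>r\<leftarrow>rs. \<Sum>m\<in>M. f m * g m r) = (\<Sum>m\<in>M. f m * (\<Sum>r\<leftarrow>rs. g m r))"
      for f :: "nat \<Rightarrow> complex" and g :: "nat \<Rightarrow> falg set \<times> falg set \<Rightarrow> complex" and M
      by (induction rs) (simp_all add: sum.distrib distrib_left)
    then have "(\<Sum>p\<leftarrow>ps. \<Sum>r\<leftarrow>rs. \<Sum>m\<in>M. f m p * g m r) = (\<Sum>m\<in>M. (\<Sum>p\<leftarrow>ps. f m p) * (\<Sum>r\<leftarrow>rs. g m r))"
      for f g :: "nat \<Rightarrow> falg set \<times> falg set \<Rightarrow> complex" and M
      by (induction ps) (simp_all add: sum.distrib distrib_right)
    then show ?thesis
      by (simp add: case_prod_unfold)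
  qed
  also have "\<dots> = (\<Sum>m<d * e. tensor_rep X $$ (k, m) * tensor_rep Y $$ (m, l))"
    using kl ps(2) rs(2) entry_bilinear by (simp add: tensor_rep_index tens_def del: uq_simps)
  also have "\<dots> = (tensor_rep X * tensor_rep Y) $$ (k, l)"
    by (rule mult_mat_index[OF tensor_rep_carrier tensor_rep_carrier kl, symmetric])
  finally show "tensor_rep (X \<otimes>\<^bsub>U\<^esub> Y) $$ (k, l) = (tensor_rep X * tensor_rep Y) $$ (k, l)" .
qed (simp_all add: tensor_rep_def)

lemma tensor_rep_pure:
  assumes X: "\<Delta> X = x \<boxtimes> y" and xy: "x \<in> carrier U" "y \<in> carrier U"
  shows "tensor_rep X = kron (\<rho> x) (\<sigma> y)"
proof (rule eq_matI)
  fix k l assume "k < dim_row (kron (\<rho> x) (\<sigma> y))" "l < dim_col (kron (\<rho> x) (\<sigma> y))"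
  then have kl: "k < d * e" "l < d * e"
    using kron_carrier[OF \<rho>.rep_carrier[OF xy(1)] \<sigma>.rep_carrier[OF xy(2)]] by auto
  then show "tensor_rep X $$ (k, l) = kron (\<rho> x) (\<sigma> y) $$ (k, l)"
    using xy entry_bilinear[OF kl] by (simp add: tensor_rep_index X pure_tensor_def entry_kron del: uq_simps)
qed (use kron_carrier[OF \<rho>.rep_carrier[OF xy(1)] \<sigma>.rep_carrier[OF xy(2)]] in \<open>auto simp: tensor_rep_def\<close>)

lemma uq_rep_tensor_rep: "uq_rep n q (d * e) tensor_rep"
  unfolding uq_rep_def
proof (intro conjI allI ballI)
  have one: "tensor_rep \<one>\<^bsub>U\<^esub> = 1\<^sub>m (d * e)"
    using Delta.hom_one by (subst tensor_rep_pure[of _ "\<one>\<^bsub>U\<^esub>" "\<one>\<^bsub>U\<^esub>"])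
      (simp_all add: tensor_alg_simps(3) \<rho>.rep_one \<sigma>.rep_one kron_one)
  show "tensor_rep \<in> Ring.ring_hom (uq n q) (ring_mat TYPE(complex) (d * e) ())"
  proof (rule ring_hom_memI; simp add: ring_mat_simps tensor_rep_carrier tensor_rep_mult one del: uq_simps(7,8))
    fix X Y assume "X \<in> carrier U" "Y \<in> carrier U"
    then have D: "\<Delta> (X \<oplus>\<^bsub>U\<^esub> Y) = (\<lambda>\<beta>. \<Delta> X \<beta> + \<Delta> Y \<beta>)"
      using Delta.hom_add T.add_fun by auto
    show "tensor_rep (X \<oplus>\<^bsub>U\<^esub> Y) = tensor_rep X + tensor_rep Y"
      by (rule eq_matI) (simp_all only: tensor_rep_def D, auto)
  qed
  fix c X assume "X \<in> carrier (uq n q)"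
  then have D: "\<Delta> (c \<odot>\<^bsub>U\<^esub> X) = (\<lambda>\<beta>. c * \<Delta> X \<beta>)"
    using Delta.hom_smult[of X c] T.smult_fun by auto
  show "tensor_rep (c \<odot>\<^bsub>uq n q\<^esub> X) = c \<cdot>\<^sub>m tensor_rep X"
    by (rule eq_matI) (simp_all only: tensor_rep_def D uq_simps(6), auto)
qed

lemma tensor_rep_coeff:
  assumes uv: "u \<in> carrier_vec d" "v \<in> carrier_vec d" "u' \<in> carrier_vec e" "v' \<in> carrier_vec e"
    and X: "X \<in> carrier U"
  shows "\<Delta> X (\<lambda>x y. (u \<bullet> (\<rho> x *\<^sub>v v)) * (u' \<bullet> (\<sigma> y *\<^sub>v v'))) =
    kron_vec u u' \<bullet> (tensor_rep X *\<^sub>v kron_vec v v')"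
proof -
  obtain ps where ps: "set ps \<subseteq> carrier U \<times> carrier U" "\<Delta> X = tens U ps"
    using X Delta_tens by blast
  define w where "w = kron_vec u u'"
  define z where "z = kron_vec v v'"
  have z: "z \<in> carrier_vec (d * e)"
    using uv by (simp add: z_def kron_vec_carrier)
  have *: "(u \<bullet> (\<rho> x *\<^sub>v v)) * (u' \<bullet> (\<sigma> y *\<^sub>v v')) =
      (\<Sum>k<d * e. \<Sum>l<d * e. w $ k * entry k l x y * z $ l)" if xy: "x \<in> carrier U" "y \<in> carrier U" for x y
  proof -
    note c = \<rho>.rep_carrier[OF xy(1)] \<sigma>.rep_carrier[OF xy(2)]
    have "(u \<bullet> (\<rho> x *\<^sub>v v)) * (u' \<bullet> (\<sigma> y *\<^sub>v v')) = w \<bullet> (kron (\<rho> x) (\<sigma> y) *\<^sub>v z)"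
      unfolding w_def z_def kron_mult_vec[OF c uv(2,4)]
      using uv c by (intro scalar_prod_kron_vec[symmetric]) auto
    also have "\<dots> = (\<Sum>k<d * e. \<Sum>l<d * e. w $ k * entry k l x y * z $ l)"
      using xy by (simp add: scalar_prod_mult_mat_vec[OF kron_carrier[OF c] z] entry_kron)
    finally show ?thesis .
  qed
  have "\<Delta> X (\<lambda>x y. (u \<bullet> (\<rho> x *\<^sub>v v)) * (u' \<bullet> (\<sigma> y *\<^sub>v v'))) =
      (\<Sum>(x, y)\<leftarrow>ps. (u \<bullet> (\<rho> x *\<^sub>v v)) * (u' \<bullet> (\<sigma> y *\<^sub>v v')))"
    using bilinear_form_product[OF \<rho>.rep_coeff_linear[OF uv(1,2)] \<sigma>.rep_coeff_linear[OF uv(3,4)]]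
    unfolding ps(2) by (simp add: tens_def)
  also have "\<dots> = (\<Sum>(x, y)\<leftarrow>ps. \<Sum>k<d * e. \<Sum>l<d * e. w $ k * entry k l x y * z $ l)"
    using ps(1) by (intro arg_cong[of _ _ sum_list] map_cong) (auto simp: *)
  also have "\<dots> = (\<Sum>k<d * e. \<Sum>l<d * e. w $ k * (\<Sum>(x, y)\<leftarrow>ps. entry k l x y) * z $ l)"
    by (induction ps) (auto simp: algebra_simps sum.distrib)
  also have "\<dots> = (\<Sum>k<d * e. \<Sum>l<d * e. w $ k * tensor_rep X $$ (k, l) * z $ l)"
    using ps(2) entry_bilinear by (simp add: tensor_rep_index tens_def del: uq_simps)
  also have "\<dots> = w \<bullet> (tensor_rep X *\<^sub>v z)"
    by (rule scalar_prod_mult_mat_vec[OF tensor_rep_carrier z, symmetric])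
  finally show ?thesis
    by (simp add: w_def z_def)
qed

text \<open>
  Since \<open>\<Delta>(K\<^sub>i) = K\<^sub>i \<otimes> K\<^sub>i\<close>, tensor products of weight vectors are weight vectors and their weights add up.
\<close>

lemma type1_tensor_rep:
  assumes "type1 n q d \<rho>" "type1 n q e \<sigma>"
  shows "type1 n q (d * e) tensor_rep"
proof -
  obtain P where P: "P \<in> carrier_mat d d" "invertible_mat P" and
    wP: "\<forall>k<d. \<exists>wt :: nat \<Rightarrow> int. \<forall>i\<in>{1..n}. \<rho> (K i) *\<^sub>v col P k = complex_of_real (q powi wt i) \<cdot>\<^sub>v col P k"
    using assms(1) by (auto simp: type1_def)
  obtain Q where Q: "Q \<in> carrier_mat e e" "invertible_mat Q" and
    wQ: "\<forall>k<e. \<exists>wt :: nat \<Rightarrow> int. \<forall>i\<in>{1..n}. \<sigma> (K i) *\<^sub>v col Q k = complex_of_real (q powi wt i) \<cdot>\<^sub>v col Q k"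
    using assms(2) by (auto simp: type1_def)
  have "\<exists>wt :: nat \<Rightarrow> int. \<forall>i\<in>{1..n}. tensor_rep (K i) *\<^sub>v col (kron P Q) k =
      complex_of_real (q powi wt i) \<cdot>\<^sub>v col (kron P Q) k" if k: "k < d * e" for k
  proof -
    obtain a :: "nat \<Rightarrow> int" where a: "\<forall>i\<in>{1..n}. \<rho> (K i) *\<^sub>v col P (k div e) = complex_of_real (q powi a i) \<cdot>\<^sub>v col P (k div e)"
      using wP div_mod_less[OF k] by blast
    obtain b :: "nat \<Rightarrow> int" where b: "\<forall>i\<in>{1..n}. \<sigma> (K i) *\<^sub>v col Q (k mod e) = complex_of_real (q powi b i) \<cdot>\<^sub>v col Q (k mod e)"
      using wQ div_mod_less[OF k] by blast
    have "tensor_rep (K i) *\<^sub>v col (kron P Q) k = complex_of_real (q powi (a i + b i)) \<cdot>\<^sub>v col (kron P Q) k"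
      if i: "i \<in> {1..n}" for i
    proof -
      note Ki = gens_closed(3)[OF i]
      have "\<Delta> (K i) = K i \<boxtimes> K i"
        using Delta_gen[of "gK i"] i by (simp del: uq_simps)
      then have t: "tensor_rep (K i) = kron (\<rho> (K i)) (\<sigma> (K i))"
        by (rule tensor_rep_pure[OF _ Ki Ki])
      have "kron_vec (s \<cdot>\<^sub>v v) (t \<cdot>\<^sub>v w) = (s * t) \<cdot>\<^sub>v kron_vec v w" for s t v w
        by (rule eq_vecI) (auto simp: kron_vec_def dest: div_mod_less)
      then show ?thesis
        unfolding t col_kron[OF P(1) Q(1) k]
        using a b i col_dim[of P "k div e"] col_dim[of Q "k mod e"] P(1) Q(1)
          kron_mult_vec[OF \<rho>.rep_carrier[OF Ki] \<sigma>.rep_carrier[OF Ki], of "col P (k div e)" "col Q (k mod e)"]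
        by (simp add: power_int_add q_nonzero)
    qed
    then show ?thesis by (intro exI[of _ "\<lambda>i. a i + b i"]) blast
  qed
  then show ?thesis
    using kron_carrier[OF P(1) Q(1)] invertible_kron[OF P Q] unfolding type1_def by blast
qed

end

lemma uq_rep_matrix_rep: "uq_rep n q d \<rho> \<Longrightarrow> matrix_rep (uq_alg n q) d \<rho>"
  by (simp add: uq_rep_def matrix_rep_def matrix_rep_axioms_def complex_algebra_uq_alg Ring.ring_hom_def)

context uq_presentation begin

abbreviation "C \<equiv> oq_carrier n q"

abbreviation "conv \<equiv> convolution (uq n q)"

lemma linear_dual_uq: "fsubspace (linear_dual (uq n q))"
  by (rule linear_dual_subspace) simp_all

lemma oq_carrier_subspace: "fsubspace C"
  unfolding oq_carrier_def by (rule fs.subspace_span)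

lemma matrix_coeff_linear:
  assumes "uq_rep n q d \<rho>" "u \<in> carrier_vec d" "v \<in> carrier_vec d"
  shows "matrix_coeff n q \<rho> u v \<in> linear_dual (uq n q)"
proof -
  interpret matrix_rep "uq_alg n q" d \<rho>
    by (rule uq_rep_matrix_rep[OF assms(1)])
  show ?thesis
    using rep_coeff_linear[OF assms(2,3)]
    by (simp add: matrix_coeff_def linear_dual_def restrict0_def linear_form_def)
qed

lemma oq_carrier_linear: "C \<subseteq> linear_dual (uq n q)"
  unfolding oq_carrier_def
  by (rule fs.span_minimal[OF _ linear_dual_uq]) (auto simp: matrix_coeff_linear)

lemma linear_dual_linear_form: "f \<in> linear_dual (uq n q) \<Longrightarrow> linear_form U f"
  by (simp add: linear_dual_def linear_form_def)

lemma conv_eq: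
  assumes "f \<in> linear_dual (uq n q)" "g \<in> linear_dual (uq n q)" "X \<in> carrier U" "\<Delta> X = tens U ps"
  shows "conv f g X = (\<Sum>(x, y)\<leftarrow>ps. f x * g y)"
  using assms bilinear_form_product[OF assms(1,2)[THEN linear_dual_linear_form]]
  by (simp add: convolution_def restrict0_def tens_def del: uq_simps(7))

lemma conv_outside: "X \<notin> carrier U \<Longrightarrow> conv f g X = 0"
  by (simp add: convolution_def restrict0_def)

lemma conv_linearL:
  assumes "f \<in> linear_dual (uq n q)" "f' \<in> linear_dual (uq n q)" "g \<in> linear_dual (uq n q)"
  shows "conv (f + f') g = conv f g + conv f' g" "conv (fscale c f) g = fscale c (conv f g)"
proof -
  note ld = fs.subspace_add[OF linear_dual_uq assms(1,2)] fs.subspace_scale[OF linear_dual_uq assms(1), of c]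
  have "conv (f + f') g X = conv f g X + conv f' g X \<and> conv (fscale c f) g X = c * conv f g X" for X
  proof (cases "X \<in> carrier U")
    case True
    then obtain ps where ps: "\<Delta> X = tens U ps" using Delta_tens by blast
    have "(\<Sum>(x, y)\<leftarrow>ps. (f + f') x * g y) = (\<Sum>(x, y)\<leftarrow>ps. f x * g y) + (\<Sum>(x, y)\<leftarrow>ps. f' x * g y)"
      "(\<Sum>(x, y)\<leftarrow>ps. fscale c f x * g y) = c * (\<Sum>(x, y)\<leftarrow>ps. f x * g y)"
      by (induction ps) (auto simp: algebra_simps fscale_def)
    then show ?thesis
      using conv_eq[OF ld(1) assms(3) True ps] conv_eq[OF ld(2) assms(3) True ps]
        conv_eq[OF assms(1,3) True ps] conv_eq[OF assms(2,3) True ps] by simp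
  qed (simp add: conv_outside)
  then show "conv (f + f') g = conv f g + conv f' g" "conv (fscale c f) g = fscale c (conv f g)"
    by (auto simp: fscale_def)
qed

lemma conv_linearR:
  assumes "f \<in> linear_dual (uq n q)" "f' \<in> linear_dual (uq n q)" "g \<in> linear_dual (uq n q)"
  shows "conv g (f + f') = conv g f + conv g f'" "conv g (fscale c f) = fscale c (conv g f)"
proof -
  note ld = fs.subspace_add[OF linear_dual_uq assms(1,2)] fs.subspace_scale[OF linear_dual_uq assms(1), of c]
  have "conv g (f + f') X = conv g f X + conv g f' X \<and> conv g (fscale c f) X = c * conv g f X" for X
  proof (cases "X \<in> carrier U")
    case True
    then obtain ps where ps: "\<Delta> X = tens U ps" using Delta_tens by blast
    have "(\<Sum>(x, y)\<leftarrow>ps. g x * (f + f') y) = (\<Sum>(x, y)\<leftarrow>ps. g x * f y) + (\<Sum>(x, y)\<leftarrow>ps. g x * f' y)"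
      "(\<Sum>(x, y)\<leftarrow>ps. g x * fscale c f y) = c * (\<Sum>(x, y)\<leftarrow>ps. g x * f y)"
      by (induction ps) (auto simp: algebra_simps fscale_def)
    then show ?thesis
      using conv_eq[OF assms(3) ld(1) True ps] conv_eq[OF assms(3) ld(2) True ps]
        conv_eq[OF assms(3,1) True ps] conv_eq[OF assms(3,2) True ps] by simp
  qed (simp add: conv_outside)
  then show "conv g (f + f') = conv g f + conv g f'" "conv g (fscale c f) = fscale c (conv g f)"
    by (auto simp: fscale_def)
qed

lemma conv_matrix_coeff:
  assumes \<rho>: "uq_rep n q d \<rho>" "type1 n q d \<rho>" "u \<in> carrier_vec d" "v \<in> carrier_vec d"
    and \<sigma>: "uq_rep n q e \<sigma>" "type1 n q e \<sigma>" "u' \<in> carrier_vec e" "v' \<in> carrier_vec e"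
  shows "conv (matrix_coeff n q \<rho> u v) (matrix_coeff n q \<sigma> u' v') \<in> C"
proof -
  interpret \<rho>: matrix_rep "uq_alg n q" d \<rho> by (rule uq_rep_matrix_rep[OF \<rho>(1)])
  interpret \<sigma>: matrix_rep "uq_alg n q" e \<sigma> by (rule uq_rep_matrix_rep[OF \<sigma>(1)])
  interpret rep_pair n q d \<rho> e \<sigma> by unfold_locales
  have "conv (matrix_coeff n q \<rho> u v) (matrix_coeff n q \<sigma> u' v') X =
      matrix_coeff n q tensor_rep (kron_vec u u') (kron_vec v v') X" for X
  proof (cases "X \<in> carrier U")
    case True
    then obtain ps where ps: "set ps \<subseteq> carrier U \<times> carrier U" "\<Delta> X = tens U ps"
      using Delta_tens by blast
    have "conv (matrix_coeff n q \<rho> u v) (matrix_coeff n q \<sigma> u' v') X =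
        (\<Sum>(x, y)\<leftarrow>ps. matrix_coeff n q \<rho> u v x * matrix_coeff n q \<sigma> u' v' y)"
      using True ps(2) \<rho> \<sigma> by (intro conv_eq matrix_coeff_linear)
    also have "\<dots> = (\<Sum>(x, y)\<leftarrow>ps. (u \<bullet> (\<rho> x *\<^sub>v v)) * (u' \<bullet> (\<sigma> y *\<^sub>v v')))"
      using ps(1) by (intro arg_cong[of _ _ sum_list] map_cong) (auto simp: matrix_coeff_def restrict0_def)
    also have "\<dots> = \<Delta> X (\<lambda>x y. (u \<bullet> (\<rho> x *\<^sub>v v)) * (u' \<bullet> (\<sigma> y *\<^sub>v v')))"
      using bilinear_form_product[OF \<rho>.rep_coeff_linear[OF \<rho>(3,4)] \<sigma>.rep_coeff_linear[OF \<sigma>(3,4)]]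
      unfolding ps(2) by (simp add: tens_def)
    also have "\<dots> = matrix_coeff n q tensor_rep (kron_vec u u') (kron_vec v v') X"
      using True \<rho> \<sigma> by (simp add: tensor_rep_coeff matrix_coeff_def restrict0_def del: uq_simps(7))
    finally show ?thesis .
  qed (simp add: conv_outside matrix_coeff_def restrict0_def)
  then have "conv (matrix_coeff n q \<rho> u v) (matrix_coeff n q \<sigma> u' v') =
      matrix_coeff n q tensor_rep (kron_vec u u') (kron_vec v v')"
    by blast
  then show ?thesis
    unfolding oq_carrier_def
    using uq_rep_tensor_rep type1_tensor_rep[OF \<rho>(2) \<sigma>(2)] kron_vec_carrier[OF \<rho>(3) \<sigma>(3)]
      kron_vec_carrier[OF \<rho>(4) \<sigma>(4)]
    by (auto intro!: fs.span_base)
qed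

text \<open>
  The product is bilinear on linear functionals, so both arguments can be reduced to matrix coefficients, one
  after the other.
\<close>

lemma conv_closed:
  assumes f: "f \<in> C" and g: "g \<in> C"
  shows "conv f g \<in> C"
proof -
  let ?M = "{matrix_coeff n q \<rho> u v | d \<rho> u v.
     uq_rep n q d \<rho> \<and> type1 n q d \<rho> \<and> u \<in> carrier_vec d \<and> v \<in> carrier_vec d}"
  let ?L = "linear_dual (uq n q)"
  have subL: "fsubspace {h \<in> ?L. conv h m \<in> C}" if m: "m \<in> ?L" for m
  proof (rule fs.subspaceI)
    have "conv 0 m = 0"
      using conv_linearL(2)[OF fs.subspace_0[OF linear_dual_uq] fs.subspace_0[OF linear_dual_uq] m, of 0]
      by (simp only: fs.scale_zero_left)
    then show "0 \<in> {h \<in> ?L. conv h m \<in> C}"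
      using fs.subspace_0[OF linear_dual_uq] fs.subspace_0[OF oq_carrier_subspace] by (simp only: mem_Collect_eq)
  next
    fix x y assume "x \<in> {h \<in> ?L. conv h m \<in> C}" "y \<in> {h \<in> ?L. conv h m \<in> C}"
    then show "x + y \<in> {h \<in> ?L. conv h m \<in> C}"
      using fs.subspace_add[OF linear_dual_uq] fs.subspace_add[OF oq_carrier_subspace] conv_linearL(1)[OF _ _ m]
      by (simp only: mem_Collect_eq)
  next
    fix c x assume "x \<in> {h \<in> ?L. conv h m \<in> C}"
    then show "fscale c x \<in> {h \<in> ?L. conv h m \<in> C}"
      using fs.subspace_scale[OF linear_dual_uq] fs.subspace_scale[OF oq_carrier_subspace] conv_linearL(2)[of x x m c] m
      by (simp only: mem_Collect_eq)
  qed
  have subR: "fsubspace {h \<in> ?L. conv m h \<in> C}" if m: "m \<in> ?L" for m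
  proof (rule fs.subspaceI)
    have "conv m 0 = 0"
      using conv_linearR(2)[OF fs.subspace_0[OF linear_dual_uq] fs.subspace_0[OF linear_dual_uq] m, of 0]
      by (simp only: fs.scale_zero_left)
    then show "0 \<in> {h \<in> ?L. conv m h \<in> C}"
      using fs.subspace_0[OF linear_dual_uq] fs.subspace_0[OF oq_carrier_subspace] by (simp only: mem_Collect_eq)
  next
    fix x y assume "x \<in> {h \<in> ?L. conv m h \<in> C}" "y \<in> {h \<in> ?L. conv m h \<in> C}"
    then show "x + y \<in> {h \<in> ?L. conv m h \<in> C}"
      using fs.subspace_add[OF linear_dual_uq] fs.subspace_add[OF oq_carrier_subspace] conv_linearR(1)[OF _ _ m]
      by (simp only: mem_Collect_eq)
  next
    fix c x assume "x \<in> {h \<in> ?L. conv m h \<in> C}"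
    then show "fscale c x \<in> {h \<in> ?L. conv m h \<in> C}"
      using fs.subspace_scale[OF linear_dual_uq] fs.subspace_scale[OF oq_carrier_subspace] conv_linearR(2)[of x x m c] m
      by (simp only: mem_Collect_eq)
  qed
  have M: "?M \<subseteq> ?L"
    by (auto simp: matrix_coeff_linear)
  have MC: "?M \<subseteq> {h \<in> ?L. conv h m \<in> C}" if "m \<in> ?M" for m
    using that M conv_matrix_coeff by blast
  have *: "conv f m \<in> C" if m: "m \<in> ?M" for m
    using fs.span_minimal[OF MC[OF m] subL] m M f unfolding oq_carrier_def by blast
  have "?M \<subseteq> {h \<in> ?L. conv f h \<in> C}"
    using * M by blast
  from fs.span_minimal[OF this subR] show ?thesis
    using f g oq_carrier_linear unfolding oq_carrier_def by blast
qed

end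

section \<open>Coproducts of functionals\<close>

lemma convolution_alg_simps [simp]:
  "carrier (convolution_alg H S) = S"
  "monoid.mult (convolution_alg H S) = convolution H"
  "one (convolution_alg H S) = restrict0 H (counit H)"
  "zero (convolution_alg H S) = 0"
  "add (convolution_alg H S) = (+)"
  "smult (convolution_alg H S) = fscale"
  by (simp_all add: convolution_alg_def)

lemma dual_bialg_simps [simp]:
  "carrier (dual_bialg H S) = S"
  "monoid.mult (dual_bialg H S) = convolution H"
  "one (dual_bialg H S) = restrict0 H (counit H)"
  "zero (dual_bialg H S) = 0"
  "add (dual_bialg H S) = (+)"
  "smult (dual_bialg H S) = fscale"
  "comult (dual_bialg H S) = (\<lambda>f. THE t. is_dual_coproduct H S f t)"
  "counit (dual_bialg H S) = (\<lambda>f. f \<one>\<^bsub>H\<^esub>)"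
  by (simp_all add: dual_bialg_def module.defs bialg.defs)

lemma tensor_space_dual_bialg: "tensor_space (dual_bialg H S) = tensor_space (convolution_alg H S)"
  by (simp add: tensor_space_def[abs_def] pure_tensor_def[abs_def] bilinear_form_def linear_form_def)

lemma evaluation_bilinear: "bilinear_form (convolution_alg H S) (\<lambda>g h. g a * h b)"
  by (simp add: bilinear_form_def linear_form_def fscale_def algebra_simps)

text \<open>
  Functionals are separated by their values, so a tensor of functionals is determined by its
  values on pairs. If the first leg \<open>g\<close> of the first summand does not vanish, say \<open>g a \<noteq> 0\<close>, the values
  at \<open>a\<close> express its second leg through the other ones, which shortens the sum.
\<close>

lemma tens_eq_0:
  assumes S: "S \<subseteq> linear_dual H" "fsubspace S"
    and ps: "set ps \<subseteq> S \<times> S"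
    and zero: "\<And>a b. a \<in> carrier H \<Longrightarrow> b \<in> carrier H \<Longrightarrow> (\<Sum>(g, h)\<leftarrow>ps. g a * h b) = 0"
    and \<beta>: "bilinear_form (convolution_alg H S) \<beta>"
  shows "(\<Sum>(g, h)\<leftarrow>ps. \<beta> g h) = 0"
  using ps zero
proof (induction "length ps" arbitrary: ps)
  case (Suc k)
  then obtain g h rs where p: "ps = (g, h) # rs" and k: "k = length rs"
    by (cases ps) auto
  have gh: "g \<in> S" "h \<in> S" and rs: "set rs \<subseteq> S \<times> S"
    using Suc.prems p by auto
  have \<beta>add: "\<beta> (x + y) z = \<beta> x z + \<beta> y z" "\<beta> z (x + y) = \<beta> z x + \<beta> z y"
    "\<beta> (fscale c x) z = c * \<beta> x z" "\<beta> z (fscale c x) = c * \<beta> z x"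
    if "x \<in> S" "y \<in> S" "z \<in> S" for x y z c
    using bilinear_form_simps[OF \<beta>] that by simp_all
  have \<beta>0: "\<beta> 0 z = 0" if "z \<in> S" for z
    using \<beta>add(3)[of 0 0 z 0] fs.subspace_0[OF S(2)] that by (simp only: fs.scale_zero_left mult_zero_left)
  have outside: "f x = 0" if "f \<in> S" "x \<notin> carrier H" for f x
    using S(1) that by (auto simp: linear_dual_def)
  show ?case
  proof (cases "\<exists>a\<in>carrier H. g a \<noteq> 0")
    case False
    then have g0: "g x = 0" for x
      using outside[OF gh(1)] by blast
    then have g: "g = 0"
      by auto
    have "(\<Sum>(g, h)\<leftarrow>rs. \<beta> g h) = 0"
      using Suc.hyps(1)[OF k rs] Suc.prems(2) by (simp add: p g0)
    then show ?thesis
      using \<beta>0[OF gh(2)] by (simp add: p g)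
  next
    case True
    then obtain a where a: "a \<in> carrier H" "g a \<noteq> 0" by blast
    \<comment> \<open>As \<open>h = (\<Sum>i. c g\<^sub>i \<cdot> h\<^sub>i)\<close>, the sum \<open>g \<otimes> h + (\<Sum>i. g\<^sub>i \<otimes> h\<^sub>i)\<close> equals \<open>(\<Sum>i. (g\<^sub>i + c g\<^sub>i \<cdot> g) \<otimes> h\<^sub>i)\<close>, which is shorter.\<close>
    define c where "c f = - f a / g a" for f
    define rs' where "rs' = map (\<lambda>(g', h'). (g' + fscale (c g') g, h')) rs"
    define w where "w = (\<Sum>(g', h')\<leftarrow>rs. fscale (c g') h')"
    have w_apply: "w b = (\<Sum>(g', h')\<leftarrow>rs. c g' * h' b)" for b
      unfolding w_def by (induction rs) (auto simp: fscale_def)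
    have h: "h = w"
    proof
      fix b
      show "h b = w b"
      proof (cases "b \<in> carrier H")
        case True
        have "g a * w b + (\<Sum>(g', h')\<leftarrow>rs. g' a * h' b) = 0"
          unfolding w_apply using a(2) by (induction rs) (auto simp: c_def field_simps)
        moreover have "g a * h b + (\<Sum>(g', h')\<leftarrow>rs. g' a * h' b) = 0"
          using Suc.prems(2)[OF a(1) True] by (simp add: p)
        ultimately have "g a * h b = g a * w b"
          by (metis add_right_cancel)
        then show ?thesis
          using a(2) by simp
      next
        case False
        have "(\<Sum>(g', h')\<leftarrow>rs. c g' * h' b) = 0"
          using rs outside[OF _ False] by (induction rs) auto
        then show ?thesis
          using outside[OF gh(2) False] by (simp add: w_apply)
      qed
    qed
    have rs'_in: "set rs' \<subseteq> S \<times> S"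
      using rs gh(1) by (auto simp: rs'_def intro!: fs.subspace_add[OF S(2)] fs.subspace_scale[OF S(2)]
          simp del: plus_fun_apply)
    have sum': "(\<Sum>(g', h')\<leftarrow>rs'. g' x * h' y) = (\<Sum>(g', h')\<leftarrow>rs. g' x * h' y) + g x * w y" for x y
      unfolding rs'_def w_apply by (induction rs) (auto simp: fscale_def algebra_simps)
    have "(\<Sum>(g, h)\<leftarrow>rs'. g x * h y) = 0" if "x \<in> carrier H" "y \<in> carrier H" for x y
      using Suc.prems(2)[OF that] by (simp add: sum' p h add.commute)
    then have "(\<Sum>(g, h)\<leftarrow>rs'. \<beta> g h) = 0"
      using Suc.hyps(1)[of rs'] rs'_in by (simp add: rs'_def k)
    moreover have "w \<in> S \<and> \<beta> g w = (\<Sum>(g', h')\<leftarrow>rs. c g' * \<beta> g h')"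
      unfolding w_def using rs
    proof (induction rs)
      case Nil
      have "\<beta> g 0 = 0"
        using \<beta>add(4)[of 0 0 g 0] fs.subspace_0[OF S(2)] gh(1)
        by (simp only: fs.scale_zero_left mult_zero_left)
      then show ?case
        using fs.subspace_0[OF S(2)] by (simp only: list.map sum_list.Nil)
    next
      case (Cons r rs)
      obtain g' h' where r: "r = (g', h')" by force
      have h': "h' \<in> S" "fscale (c g') h' \<in> S"
        using Cons.prems r fs.subspace_scale[OF S(2)] by auto
      have IH: "(\<Sum>(g', h')\<leftarrow>rs. fscale (c g') h') \<in> S"
        "\<beta> g (\<Sum>(g', h')\<leftarrow>rs. fscale (c g') h') = (\<Sum>(g', h')\<leftarrow>rs. c g' * \<beta> g h')"
        using Cons by auto
      show ?case
        using IH(2) fs.subspace_add[OF S(2) h'(2) IH(1)] \<beta>add(2)[OF h'(2) IH(1) gh(1)]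
          \<beta>add(4)[OF h'(1) h'(1) gh(1)]
        by (simp only: list.map sum_list.Cons r prod.case)
    qed
    moreover have "(\<Sum>(g', h')\<leftarrow>rs'. \<beta> g' h') = (\<Sum>(g', h')\<leftarrow>rs. \<beta> g' h') + (\<Sum>(g', h')\<leftarrow>rs. c g' * \<beta> g h')"
      unfolding rs'_def using rs
    proof (induction rs)
      case (Cons r rs)
      obtain g' h' where r: "r = (g', h')" by force
      have gh': "g' \<in> S" "h' \<in> S" "fscale (c g') g \<in> S"
        using Cons.prems r fs.subspace_scale[OF S(2) gh(1)] by auto
      have "\<beta> (g' + fscale (c g') g) h' = \<beta> g' h' + c g' * \<beta> g h'"
        using \<beta>add(1)[OF gh'(1,3,2)] \<beta>add(3)[OF gh(1) gh(1) gh'(2)] by simp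
      moreover have "set rs \<subseteq> S \<times> S"
        using Cons.prems by auto
      ultimately show ?case
        using Cons.IH by (simp only: list.map sum_list.Cons r prod.case) (simp add: algebra_simps)
    qed simp
    ultimately show ?thesis
      by (simp add: p h add.commute)
  qed
qed simp

lemma dual_coproduct_unique:
  assumes S: "S \<subseteq> linear_dual H" "fsubspace S"
    and t: "is_dual_coproduct H S f t" and t': "is_dual_coproduct H S f t'"
  shows "t = t'"
proof -
  let ?V = "convolution_alg H S"
  have sm: "c \<odot>\<^bsub>?V\<^esub> x \<in> S" if "x \<in> S" for c x
    using fs.subspace_scale[OF S(2)] that by simp
  obtain ps where ps: "set ps \<subseteq> S \<times> S" "t = tens ?V ps"
    using tensor_space_tens[of t ?V S S] t sm by (auto simp: is_dual_coproduct_def)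
  obtain rs where rs: "set rs \<subseteq> S \<times> S" "t' = tens ?V rs"
    using tensor_space_tens[of t' ?V S S] t' sm by (auto simp: is_dual_coproduct_def)
  \<comment> \<open>The list \<open>us\<close> represents \<open>t - t'\<close>, whose values vanish; a named scalar keeps its scaling in the form \<open>fscale\<close>.\<close>
  define m :: complex where "m = - 1"
  define us where "us = ps @ map (\<lambda>(x, y). (fscale m x, y)) rs"
  have us: "set us \<subseteq> S \<times> S"
    using ps(1) rs(1) fs.subspace_scale[OF S(2)] unfolding us_def by auto
  have sum_us: "(\<Sum>(g, h)\<leftarrow>us. \<beta> g h) = (\<Sum>(g, h)\<leftarrow>ps. \<beta> g h) - (\<Sum>(g, h)\<leftarrow>rs. \<beta> g h)"
    if \<beta>: "bilinear_form ?V \<beta>" for \<beta>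
  proof -
    have "(\<Sum>(g, h)\<leftarrow>map (\<lambda>(x, y). (fscale m x, y)) rs. \<beta> g h) = m * (\<Sum>(g, h)\<leftarrow>rs. \<beta> g h)"
      using rs(1) bilinear_form_smultL[OF \<beta>, of _ _ m] by (induction rs) (auto simp: distrib_left)
    then show ?thesis by (simp add: us_def m_def)
  qed
  have "(\<Sum>(g, h)\<leftarrow>us. \<beta> g h) = 0" if \<beta>: "bilinear_form ?V \<beta>" for \<beta>
  proof (rule tens_eq_0[OF S us _ \<beta>])
    fix a b assume ab: "a \<in> carrier H" "b \<in> carrier H"
    then have "t (\<lambda>g h. g a * h b) = t' (\<lambda>g h. g a * h b)"
      using t t' by (simp add: is_dual_coproduct_def)
    then show "(\<Sum>(g, h)\<leftarrow>us. g a * h b) = 0"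
      using sum_us[OF evaluation_bilinear] evaluation_bilinear[of H S a b] by (simp add: ps(2) rs(2) tens_def)
  qed
  then show ?thesis
    using sum_us unfolding ps(2) rs(2) tens_def by (intro ext) auto
qed

lemma is_dual_coproduct_add:
  "is_dual_coproduct H S f t \<Longrightarrow> is_dual_coproduct H S f' t' \<Longrightarrow> is_dual_coproduct H S (f + f') (t + t')"
  unfolding is_dual_coproduct_def tensor_space_def using fs.span_add by auto

lemma is_dual_coproduct_scale:
  "is_dual_coproduct H S f t \<Longrightarrow> is_dual_coproduct H S (fscale c f) (fscale c t)"
  unfolding is_dual_coproduct_def tensor_space_def using fs.span_scale by (auto simp: fscale_apply)

lemma is_dual_coproduct_zero: "is_dual_coproduct H S 0 0"
  unfolding is_dual_coproduct_def tensor_space_def using fs.span_zero by auto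

lemma finite_dual_subspace:
  assumes "fsubspace (linear_dual H)"
  shows "fsubspace (finite_dual H)"
proof (rule fs.subspaceI)
  show "0 \<in> finite_dual H"
    unfolding finite_dual_def mem_Collect_eq
    by (intro conjI exI) (rule fs.subspace_0[OF assms], rule is_dual_coproduct_zero)
next
  fix x y assume "x \<in> finite_dual H" "y \<in> finite_dual H"
  then show "x + y \<in> finite_dual H"
    unfolding finite_dual_def mem_Collect_eq
    using fs.subspace_add[OF assms, of x y] is_dual_coproduct_add[of H _ x _ y] by blast
next
  fix c x assume "x \<in> finite_dual H"
  then show "fscale c x \<in> finite_dual H"
    unfolding finite_dual_def mem_Collect_eq
    using fs.subspace_scale[OF assms, of x c] is_dual_coproduct_scale[of H _ x _ c] by blast
qed

section \<open>The tangent space\<close>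

context uq_presentation begin

abbreviation "A \<equiv> oq n q"
abbreviation "asf \<equiv> as_functional n q"
abbreviation "D \<equiv> finite_dual (oq n q)"

lemma oq_simps [simp]:
  "carrier A = C" "monoid.mult A = conv" "one A = restrict0 (uq n q) (counit (uq n q))"
  "zero A = 0" "add A = (+)" "smult A = fscale" "counit A = (\<lambda>f. f \<one>\<^bsub>U\<^esub>)"
  by (simp_all add: oq_def del: uq_simps(7,8))

lemma as_functional_apply: "f \<in> C \<Longrightarrow> asf X f = f X"
  by (simp add: as_functional_def restrict0_def)

lemma linear_dual_oq: "fsubspace (linear_dual A)"
  by (rule linear_dual_subspace)
    (simp_all add: fs.subspace_add[OF oq_carrier_subspace] fs.subspace_scale[OF oq_carrier_subspace]
      del: plus_fun_apply)

lemma as_functional_linear: "asf X \<in> linear_dual A"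
  using fs.subspace_add[OF oq_carrier_subspace] fs.subspace_scale[OF oq_carrier_subspace]
  by (auto simp: linear_dual_def linear_form_def as_functional_def restrict0_def fscale_apply)

text \<open>
  For \<open>\<Delta>(X) = (\<Sum>i. x\<^sub>i \<otimes> y\<^sub>i)\<close>, both sides of the defining equation of a coproduct are \<open>(\<Sum>i. a(x\<^sub>i) b(y\<^sub>i))\<close>; the
  right-hand side is evaluation at \<open>X\<close> of the product \<open>a b\<close>, which lies in the coordinate algebra again. The
  space \<open>S\<close> is the full linear dual when showing that evaluation at \<open>X\<close> belongs to the finite dual, and the
  finite dual when computing its coproduct there.
\<close>

lemma as_functional_coproduct:
  assumes X: "X \<in> carrier U" and D: "\<Delta> X = tens U ps"
    and S: "\<And>x y. (x, y) \<in> set ps \<Longrightarrow> asf x \<in> S \<and> asf y \<in> S"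
  shows "is_dual_coproduct A S (asf X) (tens (convolution_alg A S) (map (\<lambda>(x, y). (asf x, asf y)) ps))"
  unfolding is_dual_coproduct_def
proof (intro conjI ballI)
  show "tens (convolution_alg A S) (map (\<lambda>(x, y). (asf x, asf y)) ps) \<in> tensor_space (convolution_alg A S) S S"
    using S by (intro tens_in_tensor_space) auto
  fix a b assume "a \<in> carrier A" "b \<in> carrier A"
  then have ab: "a \<in> C" "b \<in> C" by simp_all
  have "tens (convolution_alg A S) (map (\<lambda>(x, y). (asf x, asf y)) ps) (\<lambda>g h. g a * h b) = (\<Sum>(x, y)\<leftarrow>ps. a x * b y)"
    using evaluation_bilinear[of A S a b] by (simp add: tens_def as_functional_apply ab case_prod_unfold o_def)
  also have "\<dots> = asf X (conv a b)"
    using conv_eq[OF subsetD[OF oq_carrier_linear ab(1)] subsetD[OF oq_carrier_linear ab(2)] X D]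
    by (simp add: as_functional_apply conv_closed[OF ab])
  finally show "tens (convolution_alg A S) (map (\<lambda>(x, y). (asf x, asf y)) ps) (\<lambda>g h. g a * h b) =
      asf X (a \<otimes>\<^bsub>A\<^esub> b)" by simp
qed

lemma as_functional_finite_dual:
  assumes "X \<in> carrier U"
  shows "asf X \<in> D"
proof -
  obtain ps where "\<Delta> X = tens U ps" using assms Delta_tens by blast
  then show ?thesis
    unfolding finite_dual_def
    using as_functional_coproduct[OF assms, of ps "linear_dual A"] as_functional_linear by auto
qed

lemma finite_dual_oq: "fsubspace D" "D \<subseteq> linear_dual A"
  using finite_dual_subspace[OF linear_dual_oq] by (auto simp: finite_dual_def)

abbreviation "\<T> \<equiv> T01 n q"
abbreviation "\<T>\<^sub>1 \<equiv> plus_unit (hopf_dual A) \<T>"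

lemma unit_hopf_dual: "\<one>\<^bsub>hopf_dual A\<^esub> = asf \<one>\<^bsub>U\<^esub>"
  by (simp add: hopf_dual_def as_functional_def del: uq_simps(7,8))

lemma T01_subspace: "fsubspace \<T>"
  unfolding T01_def by (rule fs.subspace_span)

lemma T1_I: "t \<in> \<T> \<Longrightarrow> t \<in> \<T>\<^sub>1" "\<one>\<^bsub>hopf_dual A\<^esub> \<in> \<T>\<^sub>1"
proof -
  show "t \<in> \<T>\<^sub>1" if "t \<in> \<T>"
    using that unfolding plus_unit_def mem_Collect_eq
    by (intro exI[of _ t] exI[of _ 0]) (simp only: fs.scale_zero_left add_0_right)
  show "\<one>\<^bsub>hopf_dual A\<^esub> \<in> \<T>\<^sub>1"
    unfolding plus_unit_def mem_Collect_eq
    by (intro exI[of _ 0] exI[of _ 1]) (simp only: fs.scale_one add_0_left fs.subspace_0[OF T01_subspace])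
qed

lemma root_functional_T: "1 \<le> i \<Longrightarrow> i < j \<Longrightarrow> j \<le> n + 1 \<Longrightarrow> asf (R j i) \<in> \<T>"
  unfolding T01_def by (rule fs.span_base) blast

text \<open>
  The functionals with a coproduct whose first legs lie in \<open>\<T>\<^sub>1\<close>. They form a subspace, so it suffices
  to find the unit and the root vectors in it.
\<close>

definition coideal :: "((falg set \<Rightarrow> complex) \<Rightarrow> complex) set" where
  "coideal = {X \<in> D. \<exists>t \<in> tensor_space (convolution_alg A D) \<T>\<^sub>1 D. is_dual_coproduct A D X t}"

lemma coideal_subspace: "fsubspace coideal"
proof (rule fs.subspaceI)
  show "0 \<in> coideal"
    unfolding coideal_def tensor_space_def
    using fs.subspace_0[OF finite_dual_oq(1)] fs.span_zero is_dual_coproduct_zero by blast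
next
  fix x y assume "x \<in> coideal" "y \<in> coideal"
  then show "x + y \<in> coideal"
    unfolding coideal_def tensor_space_def
    using fs.subspace_add[OF finite_dual_oq(1)] fs.span_add is_dual_coproduct_add by blast
next
  fix c x assume "x \<in> coideal"
  then show "fscale c x \<in> coideal"
    unfolding coideal_def tensor_space_def
    using fs.subspace_scale[OF finite_dual_oq(1)] fs.span_scale is_dual_coproduct_scale by blast
qed

lemma as_functional_coideal:
  assumes X: "X \<in> carrier U" "\<Delta> X = tens U ps" "set ps \<subseteq> carrier U \<times> carrier U"
    and legs: "\<And>x y. (x, y) \<in> set ps \<Longrightarrow> asf x \<in> \<T>\<^sub>1"
  shows "asf X \<in> coideal"
proof -
  let ?t = "tens (convolution_alg A D) (map (\<lambda>(x, y). (asf x, asf y)) ps)"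
  have D: "asf x \<in> D" "asf y \<in> D" if "(x, y) \<in> set ps" for x y
    using that X(3) as_functional_finite_dual by auto
  have "is_dual_coproduct A D (asf X) ?t"
    using D by (intro as_functional_coproduct[OF X(1,2)]) auto
  moreover have "?t \<in> tensor_space (convolution_alg A D) \<T>\<^sub>1 D"
    using D legs by (intro tens_in_tensor_space) auto
  ultimately show ?thesis
    unfolding coideal_def using as_functional_finite_dual[OF X(1)] by blast
qed

lemma unit_coideal: "\<one>\<^bsub>hopf_dual A\<^esub> \<in> coideal"
proof -
  have "\<Delta> \<one>\<^bsub>U\<^esub> = tens U [(\<one>\<^bsub>U\<^esub>, \<one>\<^bsub>U\<^esub>)]"
    using Delta.hom_one by (simp add: tensor_alg_simps(3) pure_tensor_eq_tens)
  then show ?thesis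
    using T1_I(2) unfolding unit_hopf_dual by (intro as_functional_coideal) auto
qed

lemma root_functional_coideal:
  assumes ij: "1 \<le> i" "i < j" "j \<le> n + 1"
  shows "asf (R j i) \<in> coideal"
proof -
  obtain \<kappa> ps where D: "\<Delta> (R j i) = tens U ((R j i, \<kappa>) # ps)" and \<kappa>: "\<kappa> \<in> carrier U"
    and ps: "set ps \<subseteq> lower_legs j i \<times> weight_space j"
    using Delta_root_vec[OF ij] by blast
  have legs: "x \<in> carrier U" "asf x \<in> \<T>\<^sub>1" if "x \<in> lower_legs j i" for x
    using that ij T1_I(1)[OF root_functional_T[of i]] T1_I(2) root_vec_closed[of i] unit_hopf_dual
    by (auto simp: lower_legs_def)
  show ?thesis
  proof (rule as_functional_coideal[OF root_vec_closed[OF ij] D])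
    show "set ((R j i, \<kappa>) # ps) \<subseteq> carrier U \<times> carrier U"
      using ps legs(1) \<kappa> root_vec_closed[OF ij] by (auto simp: weight_space_def)
    fix x y assume "(x, y) \<in> set ((R j i, \<kappa>) # ps)"
    then show "asf x \<in> \<T>\<^sub>1"
      using ps legs(2) T1_I(1)[OF root_functional_T[OF ij]] by auto
  qed
qed

lemma T01_coideal: "\<T> \<subseteq> coideal"
  unfolding T01_def
  by (rule fs.span_minimal[OF _ coideal_subspace]) (use root_functional_coideal in blast)

lemma T1_coideal: "\<T>\<^sub>1 \<subseteq> coideal"
  using T01_coideal unit_coideal fs.subspace_add[OF coideal_subspace] fs.subspace_scale[OF coideal_subspace]
  unfolding plus_unit_def by blast

lemma counit_root_vec:
  assumes "1 \<le> i" "i < j" "j \<le> n + 1"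
  shows "counit (uq n q) (R j i) = 0"
  using assms(2,3)
proof (induction j)
  case (Suc j)
  interpret \<epsilon>: algebra_hom U complex_alg "counit (uq n q)"
    by (rule counit_hom)
  have Ej: "counit (uq n q) (E j) = 0" "E j \<in> carrier U"
    using Suc.prems assms(1) counit_gen[of "gE j"] gens_closed(1)[of j] by (simp_all del: uq_simps)
  show ?case
  proof (cases "j = i")
    case False
    then have ij: "i < j" "j \<le> n"
      using Suc.prems by auto
    have Rj: "R j i \<in> carrier U"
      using ij assms(1) by (intro root_vec_closed) auto
    have "counit (uq n q) (R (Suc j) i) = qcomm complex_alg qi 0 (counit (uq n q) (R j i))"
      unfolding root_vec_step[OF assms(1) ij] by (subst \<epsilon>.hom_qcomm[OF Ej(2) Rj]) (simp add: Ej del: uq_simps)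
    also have "\<dots> = 0"
      by (subst \<epsilon>.cod.qcomm_eq) (simp_all add: complex_alg_def)
    finally show ?thesis .
  qed (use Ej in \<open>simp del: uq_simps\<close>)
qed simp

lemma T01_vanishes:
  assumes "X \<in> \<T>"
  shows "X \<one>\<^bsub>A\<^esub> = 0"
proof -
  have "fsubspace {X. X \<one>\<^bsub>A\<^esub> = 0}"
    by (rule fs.subspaceI) (auto simp: fscale_def)
  moreover have "asf (R j i) \<one>\<^bsub>A\<^esub> = 0" if "1 \<le> i" "i < j" "j \<le> n + 1" for i j
    using counit_root_vec[OF that] by (simp add: as_functional_def restrict0_def del: uq_simps)
  ultimately have "\<T> \<subseteq> {X. X \<one>\<^bsub>A\<^esub> = 0}"
    unfolding T01_def by (intro fs.span_minimal) auto
  then show ?thesis using assms by blast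
qed

lemma tangent_space_T01: "tangent_space A \<T>"
  unfolding tangent_space_def
proof (intro conjI ballI)
  have carr: "carrier (hopf_dual A) = D"
    by (simp add: hopf_dual_def)
  show "fsubspace \<T>" by (rule T01_subspace)
  show "\<T> \<subseteq> carrier (hopf_dual A)"
    using T01_coideal by (auto simp: carr coideal_def)
  show "X \<one>\<^bsub>A\<^esub> = 0" if "X \<in> \<T>" for X
    using T01_vanishes[OF that] .
  fix X assume "X \<in> \<T>\<^sub>1"
  then obtain t where t: "t \<in> tensor_space (convolution_alg A D) \<T>\<^sub>1 D" "is_dual_coproduct A D X t"
    using T1_coideal unfolding coideal_def by blast
  have "(THE t. is_dual_coproduct A D X t) = t"
    using t(2) dual_coproduct_unique[OF finite_dual_oq(2,1)] by (intro the_equality) auto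
  then show "comult (hopf_dual A) X \<in> tensor_space (hopf_dual A) \<T>\<^sub>1 (carrier (hopf_dual A))"
    using t(1) unfolding carr by (simp add: hopf_dual_def tensor_space_dual_bialg)
qed

end

theorem corollary3p4:
  fixes q :: real and n :: nat
  assumes "q \<noteq> - 1" and "q \<noteq> 0" and "q \<noteq> 1"
    and "n \<ge> 1"
  shows "tangent_space (oq n q) (T01 n q)"
proof -
  interpret uq_presentation n q
    using assms(2) by unfold_locales
  show ?thesis by (rule tangent_space_T01)
qed

end
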